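(* Let $\mathbf{g}$ be an elliptic Darboux integrable Lorentzian metric with a timelike Killing field on $M$. Then up to local coordinate transformations on $M$, $\mathbf{g}$ is locally equivalent to $$\mathbf{g}=\sin^2u\,(dv)^2-\cos^4u\,(du)^2,\quad\text{with } K=\sec^4u.$$
   Context: $M$ is a Lorentzian surface with orthonormal frame bundle $\mathcal{F}_M$, canonical dual forms $\eta^1,\eta^2$ (so $\mathbf{g}=(\eta^1)^2-(\eta^2)^2$) and connection form $\eta^1_2=\eta^2_1$ satisfying $$d\eta^1=-\eta^1_2\wedge\eta^2,\quad d\eta^2=-\eta^2_1\wedge\eta^1,\quad d\eta^1_2=-K\,\eta^1\wedge\eta^2,$$ which fixes the sign convention for the Gauss curvature $K$. The metric is elliptic if $K>0$ and hyperbolic if $K<0$. A vector $X$ is spacelike if $\langle X,X\rangle<0$ and timelike if $\langle X,X\rangle>0$. The Killing field meant is $V=q_1v_2-q_2v_1$, where $q=|K|^{-3/4}$, $dq=q_1\eta^1+q_2\eta^2$ and $(v_1,v_2)$ is the orthonormal framing of $M$ dual to $(\eta^1,\eta^2)$ ($V$ is a Killing field whenever $\mathbf{g}$ is Darboux integrable). $\mathbb{R}^{1,2}$ is $\mathbb{R}^3$ with inner product of signature $(1,2)$. $\mathcal{F}_{\mathbb{R}^{1,2}}$ is the bundle of orthonormal frames $(e_1,e_2,e_3)$ with $\langle e_1,e_1\rangle=1$, $\langle e_2,e_2\rangle=\langle e_3,e_3\rangle=-1$, $\langle e_a,e_b\rangle=0$ for $a\ne b$; with basepoint map $\rho$, its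 canonical and connection forms are defined by $d\rho=e_i\omega^i$, $de_i=e_j\omega^j_i$. The isometric embedding system $\mathcal{I}$ is the Pfaffian exterior differential system on $\mathcal{F}_M\times\mathcal{F}_{\mathbb{R}^{1,2}}$ generated by $\theta_0=\omega^3$, $\theta_1=\omega^1-\eta^1$, $\theta_2=\omega^2-\eta^2$, $\theta_3=\omega^1_2-\eta^1_2$. Put $k=\sqrt{|K|}$. If $K<0$, its singular systems are $V_\pm=\operatorname{span}\{\theta_0,\theta_1,\theta_2,\theta_3,\omega^3_1\mp k\eta^2,\omega^3_2\pm k\eta^1\}$; if $K>0$, they are $W=\operatorname{span}_{\mathbb{C}}\{\theta_0,\theta_1,\theta_2,\theta_3,\omega^3_1-\mathrm{i}k\eta^2,\omega^3_2+\mathrm{i}k\eta^1\}$ in the complexified cotangent bundle and its conjugate $\overline{W}$. The metric $\mathbf{g}$ is Darboux integrable if, locally, each of the two singular systems contains a (real, respectively complex) Frobenius subbundle of rank at least $2$ that intersects the span of $\theta_0,\theta_1,\theta_2,\theta_3$ only in $0$.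
   Formalization: The metric is shown locally equivalent to C·(sin²u dv² − cos⁴u du²) with C·K = sec⁴u for some constant C > 0; without C the claim fails, since 4 times the model also satisfies all hypotheses but is not locally isometric to the model. *)

theory Defs
  imports "HOL-Analysis.Analysis"
begin

section \<open>Smooth maps and differential forms on open subsets of Euclidean space\<close>

fun Ck_on :: "nat \<Rightarrow> 'a::euclidean_space set \<Rightarrow> ('a \<Rightarrow> 'b::real_normed_vector) \<Rightarrow> bool" where
  "Ck_on 0 S f \<longleftrightarrow> continuous_on S f"
| "Ck_on (Suc n) S f \<longleftrightarrow>
     (\<forall>x\<in>S. f differentiable (at x)) \<and> (\<forall>h. Ck_on n S (\<lambda>x. frechet_derivative f (at x) h))"

definition smooth_on :: "'a::euclidean_space set \<Rightarrow> ('a \<Rightarrow> 'b::real_normed_vector) \<Rightarrow> bool" where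
  "smooth_on S f \<longleftrightarrow> (\<forall>n. Ck_on n S f)"

text \<open>A 1-form is a function of a point and a tangent vector. For values in the complex numbers it
  is a section of the complexified cotangent bundle.\<close>

type_synonym ('e, 'f) form1 = "'e \<Rightarrow> 'e \<Rightarrow> 'f"

definition smooth_form1 :: "'e::euclidean_space set \<Rightarrow> ('e, 'f::real_normed_field) form1 \<Rightarrow> bool" where
  "smooth_form1 S \<alpha> \<longleftrightarrow> (\<forall>y\<in>S. linear (\<alpha> y)) \<and> (\<forall>h. smooth_on S (\<lambda>y. \<alpha> y h))"

definition ext_d :: "('e::euclidean_space, 'f::real_normed_field) form1 \<Rightarrow> 'e \<Rightarrow> 'e \<Rightarrow> 'e \<Rightarrow> 'f" where
  "ext_d \<alpha> y h k = frechet_derivative (\<lambda>z. \<alpha> z k) (at y) h - frechet_derivative (\<lambda>z. \<alpha> z h) (at y) k"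

definition wedge :: "('e \<Rightarrow> 'f::real_normed_field) \<Rightarrow> ('e \<Rightarrow> 'f) \<Rightarrow> 'e \<Rightarrow> 'e \<Rightarrow> 'f" where
  "wedge \<phi> \<psi> h k = \<phi> h * \<psi> k - \<phi> k * \<psi> h"

definition pullback ::
  "('e::euclidean_space \<Rightarrow> 'p::real_normed_vector) \<Rightarrow> ('p, 'f) form1 \<Rightarrow> ('e, 'f) form1" where
  "pullback \<Psi> \<alpha> y h = \<alpha> (\<Psi> y) (frechet_derivative \<Psi> (at y) h)"

definition in_span_at :: "('e, 'f::real_normed_field) form1 list \<Rightarrow> 'e \<Rightarrow> ('e \<Rightarrow> 'f) \<Rightarrow> bool" where
  "in_span_at \<alpha>s y \<phi> \<longleftrightarrow> (\<exists>c. \<forall>h. \<phi> h = (\<Sum>i<length \<alpha>s. c i * (\<alpha>s ! i) y h))"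

definition independent_at :: "('e, 'f::real_normed_field) form1 list \<Rightarrow> 'e \<Rightarrow> bool" where
  "independent_at \<alpha>s y \<longleftrightarrow>
     (\<forall>c. (\<forall>h. (\<Sum>i<length \<alpha>s. c i * (\<alpha>s ! i) y h) = 0) \<longrightarrow> (\<forall>i<length \<alpha>s. c i = 0))"

text \<open>A local frame \<open>\<alpha>s\<close> of a Frobenius subbundle: the differential of each generator lies in the
  algebraic ideal generated by the \<open>\<alpha>s\<close>. For complex forms no condition relating the bundle to its
  conjugate is imposed.\<close>

definition frobenius_frame :: "'e::euclidean_space set \<Rightarrow> ('e, 'f::real_normed_field) form1 list \<Rightarrow> bool" where
  "frobenius_frame S \<alpha>s \<longleftrightarrow>
     (\<forall>\<alpha>\<in>set \<alpha>s. smooth_form1 S \<alpha>) \<and>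
     (\<forall>y\<in>S. independent_at \<alpha>s y \<and>
        (\<forall>\<alpha>\<in>set \<alpha>s. \<exists>\<beta>. (\<forall>j. linear (\<beta> j)) \<and>
           (\<forall>h k. ext_d \<alpha> y h k = (\<Sum>j<length \<alpha>s. wedge (\<beta> j) ((\<alpha>s ! j) y) h k))))"

text \<open>The system spanned by \<open>sys\<close> contains a Frobenius subbundle of rank at least 2 meeting the
  span of \<open>\<theta>s\<close> only in 0.\<close>

definition has_transverse_frobenius ::
  "'e::euclidean_space set \<Rightarrow> ('e, 'f::real_normed_field) form1 list \<Rightarrow> ('e, 'f) form1 list \<Rightarrow> bool" where
  "has_transverse_frobenius S sys \<theta>s \<longleftrightarrow>
     (\<exists>\<alpha>s. frobenius_frame S \<alpha>s \<and> length \<alpha>s \<ge> 2 \<and>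
        (\<forall>y\<in>S. (\<forall>\<alpha>\<in>set \<alpha>s. in_span_at sys y (\<alpha> y)) \<and>
           (\<forall>\<phi>. in_span_at \<alpha>s y \<phi> \<and> in_span_at \<theta>s y \<phi> \<longrightarrow> (\<forall>h. \<phi> h = 0))))"


section \<open>Lorentzian metrics in a coordinate domain, frames and curvature\<close>

definition ip :: "real^2^2 \<Rightarrow> real^2 \<Rightarrow> real^2 \<Rightarrow> real" where
  "ip A h k = h \<bullet> (A *v k)"

definition orthonormal_frame :: "real^2^2 \<Rightarrow> real^2 \<Rightarrow> real^2 \<Rightarrow> bool" where
  "orthonormal_frame A v1 v2 \<longleftrightarrow> ip A v1 v1 = 1 \<and> ip A v2 v2 = -1 \<and> ip A v1 v2 = 0"

definition lorentzian_metric :: "(real^2) set \<Rightarrow> (real^2 \<Rightarrow> real^2^2) \<Rightarrow> bool" where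
  "lorentzian_metric D G \<longleftrightarrow> smooth_on D G \<and>
     (\<forall>x\<in>D. transpose (G x) = G x \<and> (\<exists>v1 v2. orthonormal_frame (G x) v1 v2))"

text \<open>A point \<open>(x, v\<^sub>1, v\<^sub>2)\<close> of the frame bundle is written in the coordinates of \<open>D\<close>, and the frame
  bundle is viewed as a submanifold of the vector space of all such triples.\<close>

type_synonym frame2 = "(real^2) \<times> (real^2) \<times> (real^2)"

definition frame_bundle :: "(real^2) set \<Rightarrow> (real^2 \<Rightarrow> real^2^2) \<Rightarrow> frame2 set" where
  "frame_bundle D G = {(x, v1, v2). x \<in> D \<and> orthonormal_frame (G x) v1 v2}"

text \<open>The canonical forms are determined by \<open>dx = v\<^sub>1 \<eta>\<^sup>1 + v\<^sub>2 \<eta>\<^sup>2\<close>.\<close>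

definition eta1 :: "(real^2 \<Rightarrow> real^2^2) \<Rightarrow> (frame2, real) form1" where
  "eta1 G = (\<lambda>(x, v1, v2) (dx, dv1, dv2). ip (G x) dx v1)"

definition eta2 :: "(real^2 \<Rightarrow> real^2^2) \<Rightarrow> (frame2, real) form1" where
  "eta2 G = (\<lambda>(x, v1, v2) (dx, dv1, dv2). - ip (G x) dx v2)"

text \<open>The structure equations pulled back along a map \<open>s\<close> into the frame bundle, for \<open>\<kappa> = \<eta>\<^sup>1\<^sub>2 = \<eta>\<^sup>2\<^sub>1\<close>.
  If the pullbacks of \<open>\<eta>\<^sup>1\<close> and \<open>\<eta>\<^sup>2\<close> are independent (as for a local section, or for a submersion onto
  the frame bundle), the first two equations have a unique solution \<open>\<kappa>\<close>, the pullback of the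
  connection form, and the third one determines \<open>K\<close>.\<close>

definition structure_equations ::
  "(real^2 \<Rightarrow> real^2^2) \<Rightarrow> (real^2 \<Rightarrow> real) \<Rightarrow> 'e::euclidean_space set \<Rightarrow> ('e \<Rightarrow> frame2)
     \<Rightarrow> ('e, real) form1 \<Rightarrow> bool" where
  "structure_equations G K S s \<kappa> \<longleftrightarrow> smooth_form1 S \<kappa> \<and>
     (let \<eta>1 = pullback s (eta1 G); \<eta>2 = pullback s (eta2 G) in
      \<forall>y\<in>S. \<forall>h k.
        ext_d \<eta>1 y h k = - wedge (\<kappa> y) (\<eta>2 y) h k \<and>
        ext_d \<eta>2 y h k = - wedge (\<kappa> y) (\<eta>1 y) h k \<and>
        ext_d \<kappa> y h k = - K (fst (s y)) * wedge (\<eta>1 y) (\<eta>2 y) h k)"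

definition is_curvature :: "(real^2) set \<Rightarrow> (real^2 \<Rightarrow> real^2^2) \<Rightarrow> (real^2 \<Rightarrow> real) \<Rightarrow> bool" where
  "is_curvature D G K \<longleftrightarrow>
     (\<forall>x\<in>D. \<exists>S v1 v2 \<kappa>. open S \<and> x \<in> S \<and> S \<subseteq> D \<and> smooth_on S v1 \<and> smooth_on S v2 \<and>
        (\<forall>y\<in>S. orthonormal_frame (G y) (v1 y) (v2 y)) \<and>
        structure_equations G K S (\<lambda>y. (y, v1 y, v2 y)) \<kappa>)"

text \<open>The vector field \<open>V = q\<^sub>1 v\<^sub>2 - q\<^sub>2 v\<^sub>1\<close>, where \<open>q\<^sub>i = dq(v\<^sub>i)\<close> and \<open>q\<close> is \<open>\<bar>K\<bar>\<close> to the power \<open>-3/4\<close>.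
  Changing the orthonormal frame changes \<open>V\<close> at most by a sign.\<close>

definition killing_V :: "(real^2 \<Rightarrow> real) \<Rightarrow> real^2 \<Rightarrow> real^2 \<Rightarrow> real^2 \<Rightarrow> real^2" where
  "killing_V K x v1 v2 =
     (let dq = frechet_derivative (\<lambda>y. \<bar>K y\<bar> powr (-3/4)) (at x) in dq v1 *\<^sub>R v2 - dq v2 *\<^sub>R v1)"

definition timelike_V :: "(real^2) set \<Rightarrow> (real^2 \<Rightarrow> real^2^2) \<Rightarrow> (real^2 \<Rightarrow> real) \<Rightarrow> bool" where
  "timelike_V D G K \<longleftrightarrow>
     (\<forall>x\<in>D. \<forall>v1 v2. orthonormal_frame (G x) v1 v2 \<longrightarrow>
        ip (G x) (killing_V K x v1 v2) (killing_V K x v1 v2) > 0)"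


section \<open>Orthonormal frames of Minkowski space with signature (1,2)\<close>

definition sgn12 :: "3 \<Rightarrow> real" where
  "sgn12 i = (if i = 1 then 1 else -1)"

definition ip12 :: "real^3 \<Rightarrow> real^3 \<Rightarrow> real" where
  "ip12 a b = (\<Sum>i\<in>UNIV. sgn12 i * a $ i * b $ i)"

text \<open>A point is \<open>(\<rho>, e)\<close>, where \<open>e $ i\<close> is the frame vector \<open>e\<^sub>i\<close>.\<close>

type_synonym frame3 = "(real^3) \<times> (real^3^3)"

definition frame_bundle12 :: "frame3 set" where
  "frame_bundle12 = {(\<rho>, e). \<forall>i j. ip12 (e $ i) (e $ j) = (if i = j then sgn12 i else 0)}"

text \<open>On \<open>frame_bundle12\<close> these are the coefficients in \<open>d\<rho> = e\<^sub>i \<omega>\<^sup>i\<close> and \<open>de\<^sub>i = e\<^sub>j \<omega>\<^sup>j\<^sub>i\<close>;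
  \<open>\<omega>\<^sup>j\<^sub>i\<close> is \<open>omega2 j i\<close>.\<close>

definition omega1 :: "3 \<Rightarrow> (frame3, real) form1" where
  "omega1 i = (\<lambda>(\<rho>, e) (d\<rho>, de). sgn12 i * ip12 d\<rho> (e $ i))"

definition omega2 :: "3 \<Rightarrow> 3 \<Rightarrow> (frame3, real) form1" where
  "omega2 j i = (\<lambda>(\<rho>, e) (d\<rho>, de). sgn12 j * ip12 (de $ i) (e $ j))"

lemma ip12_expansion:
  assumes "(\<rho>, e) \<in> frame_bundle12"
  shows "w = (\<Sum>i\<in>UNIV. (sgn12 i * ip12 w (e $ i)) *\<^sub>R e $ i)"
proof -
  define B :: "real^3^3" where "B = (\<chi> k i. sgn12 i * sgn12 k * e $ i $ k)"
  have "(e ** B) $ i $ j = (mat 1 :: real^3^3) $ i $ j" for i j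
  proof -
    have "(e ** B) $ i $ j = sgn12 j * ip12 (e $ i) (e $ j)"
      by (simp add: matrix_matrix_mult_def B_def ip12_def sum_3 algebra_simps)
    with assms show ?thesis by (simp add: frame_bundle12_def mat_def sgn12_def)
  qed
  then have "B ** e = mat 1" by (metis matrix_left_right_inverse vec_eq_iff)
  then have "w v* B v* e = w" by (simp add: vector_matrix_mul_assoc)
  moreover have "(w v* B) $ i = sgn12 i * ip12 w (e $ i)" for i
    by (simp add: vector_matrix_mult_def B_def ip12_def sum_3 algebra_simps)
  ultimately have "w $ j = (\<Sum>i\<in>UNIV. (sgn12 i * ip12 w (e $ i)) * e $ i $ j)" for j
    by (metis (no_types, lifting) vector_matrix_mult_def vec_lambda_beta sum.cong mult.commute)
  then show ?thesis by (simp add: vec_eq_iff)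
qed

lemma omega_expansion:
  assumes "(\<rho>, e) \<in> frame_bundle12"
  shows "d\<rho> = (\<Sum>i\<in>UNIV. omega1 i (\<rho>, e) (d\<rho>, de) *\<^sub>R e $ i)"
    and "de $ i = (\<Sum>j\<in>UNIV. omega2 j i (\<rho>, e) (d\<rho>, de) *\<^sub>R e $ j)"
  using ip12_expansion[OF assms] by (simp_all add: omega1_def omega2_def)


section \<open>The isometric embedding system and Darboux integrability\<close>

text \<open>Local coordinates on the 9-dimensional submanifold \<open>N\<close> (the product of the two frame bundles):
  a smooth parametrization \<open>\<Psi>\<close> of a relatively open subset of \<open>N\<close>.\<close>

definition parametrization ::
  "(real^9) set \<Rightarrow> (real^9 \<Rightarrow> frame2 \<times> frame3) \<Rightarrow> (frame2 \<times> frame3) set \<Rightarrow> bool" where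
  "parametrization S \<Psi> N \<longleftrightarrow> open S \<and> smooth_on S \<Psi> \<and> inj_on \<Psi> S \<and>
     (\<forall>y\<in>S. inj (frechet_derivative \<Psi> (at y))) \<and> openin (top_of_set N) (\<Psi> ` S)"

text \<open>The generators of the system and of its singular systems, all pulled back along \<open>\<Psi>\<close>; \<open>\<kappa>\<close> is
  the pullback of \<open>\<eta>\<^sup>1\<^sub>2\<close>. The singular systems \<open>V\<^sub>+, V\<^sub>-\<close> are those with \<open>s = 1, -1\<close> over the reals, and
  \<open>W\<close> and its conjugate are those with \<open>s = \<i>, -\<i>\<close> over the complex numbers.\<close>

definition thetas :: "(real^2 \<Rightarrow> real^2^2) \<Rightarrow> (real^9 \<Rightarrow> frame2 \<times> frame3) \<Rightarrow> (real^9, real) form1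
    \<Rightarrow> (real^9, 'f::real_normed_field) form1 list" where
  "thetas G \<Psi> \<kappa> =
     (let \<eta>1 = pullback (fst \<circ> \<Psi>) (eta1 G); \<eta>2 = pullback (fst \<circ> \<Psi>) (eta2 G);
          \<omega> = (\<lambda>i. pullback (snd \<circ> \<Psi>) (omega1 i)); \<omega>12 = pullback (snd \<circ> \<Psi>) (omega2 1 2)
      in [\<lambda>y h. of_real (\<omega> 3 y h),
          \<lambda>y h. of_real (\<omega> 1 y h - \<eta>1 y h),
          \<lambda>y h. of_real (\<omega> 2 y h - \<eta>2 y h),
          \<lambda>y h. of_real (\<omega>12 y h - \<kappa> y h)])"

definition singular_system :: "'f::real_normed_field \<Rightarrow> (real^2 \<Rightarrow> real^2^2) \<Rightarrow> (real^2 \<Rightarrow> real)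
    \<Rightarrow> (real^9 \<Rightarrow> frame2 \<times> frame3) \<Rightarrow> (real^9, real) form1 \<Rightarrow> (real^9, 'f) form1 list" where
  "singular_system s G K \<Psi> \<kappa> =
     (let \<eta>1 = pullback (fst \<circ> \<Psi>) (eta1 G); \<eta>2 = pullback (fst \<circ> \<Psi>) (eta2 G);
          \<omega>31 = pullback (snd \<circ> \<Psi>) (omega2 3 1); \<omega>32 = pullback (snd \<circ> \<Psi>) (omega2 3 2);
          k = (\<lambda>y. sqrt \<bar>K (fst (fst (\<Psi> y)))\<bar>)
      in thetas G \<Psi> \<kappa> @
         [\<lambda>y h. of_real (\<omega>31 y h) - s * of_real (k y * \<eta>2 y h),
          \<lambda>y h. of_real (\<omega>32 y h) + s * of_real (k y * \<eta>1 y h)])"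

definition locally_integrable :: "'f::real_normed_field \<Rightarrow> (real^2) set \<Rightarrow> (real^2 \<Rightarrow> real^2^2)
    \<Rightarrow> (real^2 \<Rightarrow> real) \<Rightarrow> bool" where
  "locally_integrable s D G K \<longleftrightarrow>
     (\<forall>z \<in> frame_bundle D G \<times> frame_bundle12. \<exists>S \<Psi> \<kappa>.
        parametrization S \<Psi> (frame_bundle D G \<times> frame_bundle12) \<and> z \<in> \<Psi> ` S \<and>
        structure_equations G K S (fst \<circ> \<Psi>) \<kappa> \<and>
        has_transverse_frobenius S (singular_system s G K \<Psi> \<kappa>) (thetas G \<Psi> \<kappa>))"

definition darboux_integrable :: "(real^2) set \<Rightarrow> (real^2 \<Rightarrow> real^2^2) \<Rightarrow> (real^2 \<Rightarrow> real) \<Rightarrow> bool" where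
  "darboux_integrable D G K \<longleftrightarrow>
     ((\<forall>x\<in>D. K x < 0) \<and> locally_integrable (1::real) D G K \<and> locally_integrable (-1::real) D G K) \<or>
     ((\<forall>x\<in>D. K x > 0) \<and> locally_integrable \<i> D G K \<and> locally_integrable (-\<i>) D G K)"


section \<open>Lorentzian surfaces\<close>

type_synonym 'a chart = "'a set \<times> ('a \<Rightarrow> real^2)"

definition chart_image :: "'a chart \<Rightarrow> (real^2) set" where
  "chart_image c = snd c ` fst c"

definition chart_inv :: "'a chart \<Rightarrow> real^2 \<Rightarrow> 'a" where
  "chart_inv c = inv_into (fst c) (snd c)"

definition smooth_atlas :: "'a topology \<Rightarrow> 'a chart set \<Rightarrow> bool" where
  "smooth_atlas X A \<longleftrightarrow>
     (\<Union>c\<in>A. fst c) = topspace X \<and>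
     (\<forall>c\<in>A. openin X (fst c) \<and> open (chart_image c) \<and>
        homeomorphic_map (subtopology X (fst c)) (top_of_set (chart_image c)) (snd c)) \<and>
     (\<forall>c\<in>A. \<forall>c'\<in>A. smooth_on (snd c ` (fst c \<inter> fst c')) (snd c' \<circ> chart_inv c))"

text \<open>\<open>G\<close> and \<open>G'\<close> are the coordinate expressions of one metric in the charts \<open>c\<close> and \<open>c'\<close>.\<close>

definition same_metric :: "'a chart \<Rightarrow> (real^2 \<Rightarrow> real^2^2) \<Rightarrow> 'a chart \<Rightarrow> (real^2 \<Rightarrow> real^2^2) \<Rightarrow> bool" where
  "same_metric c G c' G' \<longleftrightarrow>
     (let \<tau> = snd c' \<circ> chart_inv c in
      \<forall>x \<in> snd c ` (fst c \<inter> fst c'). \<forall>h k.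
        ip (G x) h k =
        ip (G' (\<tau> x)) (frechet_derivative \<tau> (at x) h) (frechet_derivative \<tau> (at x) k))"

definition lorentzian_surface :: "'a topology \<Rightarrow> 'a chart set \<Rightarrow> ('a chart \<Rightarrow> real^2 \<Rightarrow> real^2^2) \<Rightarrow> bool" where
  "lorentzian_surface X A g \<longleftrightarrow>
     Hausdorff_space X \<and> second_countable X \<and> smooth_atlas X A \<and>
     (\<forall>c\<in>A. lorentzian_metric (chart_image c) (g c)) \<and>
     (\<forall>c\<in>A. \<forall>c'\<in>A. same_metric c (g c) c' (g c'))"

text \<open>The metric \<open>sin\<^sup>2u (dv)\<^sup>2 - cos\<^sup>4u (du)\<^sup>2\<close> in the coordinates \<open>x = (u, v)\<close>, with
  curvature \<open>sec\<^sup>4u\<close>. Multiplying a metric by a constant \<open>C > 0\<close> divides its curvature by \<open>C\<close> and preserves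
  Darboux integrability, so this form can only represent metrics up to such a constant.\<close>

definition model_metric :: "real^2 \<Rightarrow> real^2^2" where
  "model_metric x = vector [vector [- (cos (x $ 1) ^ 4), 0], vector [0, sin (x $ 1) ^ 2]]"

end

theory Submission
  imports Defs
begin

text \<open>Write \<open>K = k\<^sup>2\<close>, \<open>f = ln K / 4\<close> and \<open>\<lambda> = \<i> k\<close>. A Frobenius subbundle transverse to the \<open>\<theta>\<^sub>i\<close> has
  rank exactly 2, and the complex vectors on which its two generators vanish form an involutive
  distribution, so the differentials of the generators vanish on them. Evaluating these differentials
  on suitable vectors determines the coefficients of the generators step by step, as in the
  computation of the derived flag of the singular system, and leaves as an integrability condition
  the tensor equation \<open>Hess f = 3 df \<otimes> df - K g\<close>.

  This equation implies that \<open>\<Phi> = exp (-2 f) - exp (-6 f) \<bar>df\<bar>\<^sup>2\<close> is locally constant, and that the metric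
  dual of the Killing field divided by its squared length is closed. The Killing field being timelike
  gives \<open>\<bar>df\<bar>\<^sup>2 < 0\<close>, hence \<open>\<Phi> > exp (-2 f)\<close>. With \<open>C = \<Phi>\<^sup>2\<close> and \<open>cos u = exp (- f) / sqrt \<Phi>\<close>, and with a
  multiple of the closed form as \<open>dv\<close>, the metric is \<open>C\<close> times the normal form.\<close>

subsection \<open>Calculus of smooth maps\<close>

text \<open>The logarithm is scaled so that k = exp (2 f), hence dk = 2 k df, and the function q
  behind the Killing field is exp (-3 f). The two normalised generators have eight unknown
  coefficients, whose derivatives are unknown as well. Every evaluation is therefore made on vectors
  where those derivatives cancel: either all \<theta>_i vanish there, or the coefficients found so
  far are functions of the frame of the surface alone and do not vary in the remaining directions.
  The last derivatives are eliminated by the symmetry of the Hessian, which identifies one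
  coefficient of each generator. The closing algebra is done only at frames whose first vector lies
  in the kernel of df. This suffices because the equation is tensorial, integrability holds near
  every frame, and a boost to such a frame exists exactly when the kernel of df, which is spanned by
  the Killing field, is timelike. Regularity has to be earned twice: the curvature becomes smooth
  through the third structure equation, and the coefficients of the generators become differentiable
  through the frame dual to the coframe.\<close>

lemma frechet_derivative_eqI:
  "(f has_derivative f') (at x) \<Longrightarrow> frechet_derivative f (at x) = f'"
  by (rule frechet_derivative_at[symmetric])

section \<open>Closure properties of maps of class C^k on an open set\<close>

lemma Ck_on_cong:
  assumes "open S" "\<And>x. x \<in> S \<Longrightarrow> f x = g x" "Ck_on n S f"
  shows "Ck_on n S g"
  using assms(2,3)
proof (induction n arbitrary: f g)
  case 0
  then show ?case using continuous_on_cong by force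
next
  case (Suc n)
  have df: "f differentiable (at x)" if "x \<in> S" for x
    using Suc.prems that by simp
  have dg: "(g has_derivative frechet_derivative f (at x)) (at x)" if "x \<in> S" for x
    by (rule has_derivative_transform_within_open[OF _ \<open>open S\<close> that Suc.prems(1)])
      (simp_all add: df[OF that] frechet_derivative_works[symmetric])
  then have eq: "frechet_derivative g (at x) = frechet_derivative f (at x)" if "x \<in> S" for x
    using frechet_derivative_eqI that by blast
  have "Ck_on n S (\<lambda>x. frechet_derivative g (at x) h)" for h
    by (rule Suc.IH[of "\<lambda>x. frechet_derivative f (at x) h"]) (use Suc.prems eq in simp_all)
  then show ?case using dg by (auto simp: differentiable_def)
qed

lemma Ck_on_subset: "Ck_on n S f \<Longrightarrow> T \<subseteq> S \<Longrightarrow> Ck_on n T f"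
  by (induction n arbitrary: f) (auto intro: continuous_on_subset)

lemma Ck_on_SucD: "Ck_on (Suc n) S f \<Longrightarrow> Ck_on n S f"
proof (induction n arbitrary: f)
  case 0
  then show ?case
    by (auto intro!: continuous_at_imp_continuous_on differentiable_imp_continuous_within)
next
  case (Suc n)
  then show ?case by (metis Ck_on.simps(2))
qed

text \<open>\<open>Ck_on\<close> refers to \<open>frechet_derivative\<close>; here any explicit
  family of derivatives may take its place, so that each differentiation rule yields one induction
  step.\<close>

lemma Ck_on_SucI:
  assumes "open S" "\<And>x. x \<in> S \<Longrightarrow> (f has_derivative f' x) (at x)"
    "\<And>h. Ck_on n S (\<lambda>x. f' x h)"
  shows "Ck_on (Suc n) S f"
proof -
  have "f' x h = frechet_derivative f (at x) h" if "x \<in> S" for x h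
    using frechet_derivative_eqI[OF assms(2)[OF that]] by simp
  then have "Ck_on n S (\<lambda>x. frechet_derivative f (at x) h)" for h
    by (intro Ck_on_cong[OF assms(1) _ assms(3)[of h]])
  then show ?thesis using assms(2) by (auto simp: differentiable_def)
qed

lemma Ck_on_SucE:
  assumes "Ck_on (Suc n) S f"
  shows "\<And>x. x \<in> S \<Longrightarrow> (f has_derivative frechet_derivative f (at x)) (at x)"
    and "\<And>h. Ck_on n S (\<lambda>x. frechet_derivative f (at x) h)"
  using assms frechet_derivative_works by auto

lemma Ck_on_const: "Ck_on n S (\<lambda>x. c)"
  by (induction n arbitrary: c) (auto simp: continuous_on_const)

lemma Ck_on_bounded_linear:
  assumes "bounded_linear L" "open S"
  shows "Ck_on n S L"
proof (cases n)
  case 0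
  then show ?thesis using assms by (simp add: linear_continuous_on)
next
  case (Suc m)
  then show ?thesis
    using Ck_on_SucI[OF \<open>open S\<close> bounded_linear_imp_has_derivative[OF assms(1)] Ck_on_const]
    by blast
qed

lemma Ck_on_add:
  assumes "open S" "Ck_on n S f" "Ck_on n S g"
  shows "Ck_on n S (\<lambda>x. f x + g x)"
  using assms(2,3)
proof (induction n arbitrary: f g)
  case 0
  then show ?case by (simp add: continuous_on_add)
next
  case (Suc n)
  show ?case
    by (rule Ck_on_SucI[OF \<open>open S\<close> has_derivative_add])
      (rule Ck_on_SucE(1)[OF Suc.prems(1)] Ck_on_SucE(1)[OF Suc.prems(2)] Suc.IH
        Ck_on_SucE(2)[OF Suc.prems(1)] Ck_on_SucE(2)[OF Suc.prems(2)]; assumption?)+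
qed

lemma (in bounded_bilinear) Ck_on_prod:
  fixes f :: "'e::euclidean_space \<Rightarrow> 'a" and g :: "'e \<Rightarrow> 'b"
  assumes "open S" "Ck_on n S f" "Ck_on n S g"
  shows "Ck_on n S (\<lambda>x. prod (f x) (g x))"
  using assms(2,3)
proof (induction n arbitrary: f g)
  case 0
  then show ?case by (simp add: continuous_on)
next
  case (Suc n)
  show ?case
    by (rule Ck_on_SucI[OF \<open>open S\<close> FDERIV])
      (rule Ck_on_SucE(1)[OF Suc.prems(1)] Ck_on_SucE(1)[OF Suc.prems(2)]
        Ck_on_add[OF \<open>open S\<close>] Suc.IH Ck_on_SucE(2)[OF Suc.prems(1)] Ck_on_SucE(2)[OF Suc.prems(2)]
        Ck_on_SucD[OF Suc.prems(1)] Ck_on_SucD[OF Suc.prems(2)]; assumption?)+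
qed

lemma Ck_on_sum:
  assumes "open S" "\<And>i. i \<in> I \<Longrightarrow> Ck_on n S (f i)"
  shows "Ck_on n S (\<lambda>x. \<Sum>i\<in>I. f i x)"
  using assms(2)
  by (induction I rule: infinite_finite_induct) (auto intro: Ck_on_const Ck_on_add[OF \<open>open S\<close>])

lemma linear_Basis_expansion:
  fixes L :: "'a::euclidean_space \<Rightarrow> 'b::real_vector"
  assumes "linear L"
  shows "L h = (\<Sum>b\<in>Basis. (h \<bullet> b) *\<^sub>R L b)"
proof -
  have "L h = L (\<Sum>b\<in>Basis. (h \<bullet> b) *\<^sub>R b)" by (simp add: euclidean_representation)
  also have "\<dots> = (\<Sum>b\<in>Basis. (h \<bullet> b) *\<^sub>R L b)"
    by (simp add: linear_sum[OF assms] linear_cmul[OF assms])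
  finally show ?thesis .
qed

lemma Ck_on_inner:
  assumes "open S" "Ck_on n S f" "Ck_on n S g"
  shows "Ck_on n S (\<lambda>x. f x \<bullet> g x)"
  by (rule bounded_bilinear.Ck_on_prod[OF bounded_bilinear_inner assms])

lemma Ck_on_scaleR:
  assumes "open S" "Ck_on n S f" "Ck_on n S g"
  shows "Ck_on n S (\<lambda>x. f x *\<^sub>R g x)"
  by (rule bounded_bilinear.Ck_on_prod[OF bounded_bilinear_scaleR assms])

text \<open>In the chain rule the derivative of \<open>g\<close> is applied to a vector that varies
  with \<open>x\<close>. Expanding this vector in \<open>Basis\<close> leaves a finite sum of
  products to which the induction hypothesis applies; hence the intermediate space is
  Euclidean.\<close>

lemma Ck_on_compose:
  fixes f :: "'a::euclidean_space \<Rightarrow> 'b::euclidean_space" and g :: "'b \<Rightarrow> 'c::real_normed_vector"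
  assumes "open S" "open T" "Ck_on n S f" "Ck_on n T g" "f ` S \<subseteq> T"
  shows "Ck_on n S (\<lambda>x. g (f x))"
  using assms(3,4)
proof (induction n arbitrary: g)
  case 0
  then show ?case using \<open>f ` S \<subseteq> T\<close> by (auto intro: continuous_on_compose2)
next
  case (Suc n)
  let ?f = "\<lambda>x. frechet_derivative f (at x)" and ?g = "\<lambda>x. frechet_derivative g (at x)"
  have f: "(f has_derivative ?f x) (at x)" if "x \<in> S" for x
    using Ck_on_SucE[OF Suc.prems(1)] that by blast
  have g: "(g has_derivative ?g (f x)) (at (f x))" if "x \<in> S" for x
    using Ck_on_SucE[OF Suc.prems(2)] that \<open>f ` S \<subseteq> T\<close> by blast
  have "Ck_on n S (\<lambda>x. \<Sum>b\<in>Basis. (?f x h \<bullet> b) *\<^sub>R ?g (f x) b)" for h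
    by (intro Ck_on_sum Ck_on_scaleR Ck_on_inner Ck_on_const \<open>open S\<close>
        Ck_on_SucE(2)[OF Suc.prems(1)] Suc.IH Ck_on_SucE(2)[OF Suc.prems(2)]
        Ck_on_SucD[OF Suc.prems(1)])
  moreover have "(\<Sum>b\<in>Basis. (?f x h \<bullet> b) *\<^sub>R ?g (f x) b) = ?g (f x) (?f x h)"
    if "x \<in> S" for x h
    by (rule linear_Basis_expansion[OF has_derivative_linear[OF g[OF that]], symmetric])
  ultimately have "Ck_on n S (\<lambda>x. ?g (f x) (?f x h))" for h
    by (rule Ck_on_cong[OF \<open>open S\<close>, rotated])
  then show ?case
    by (intro Ck_on_SucI[OF \<open>open S\<close> has_derivative_compose[OF f g]])
qed

section \<open>Closure properties of smooth maps\<close>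

lemma smooth_on_cong:
  assumes "open S" "\<And>x. x \<in> S \<Longrightarrow> f x = g x" "smooth_on S f"
  shows "smooth_on S g"
  unfolding smooth_on_def
  by (intro allI Ck_on_cong[OF assms(1,2)]) (use assms(3) in \<open>simp_all add: smooth_on_def\<close>)

lemma smooth_on_subset: "smooth_on S f \<Longrightarrow> T \<subseteq> S \<Longrightarrow> smooth_on T f"
  unfolding smooth_on_def using Ck_on_subset by blast

lemma smooth_on_has_derivative:
  "smooth_on S f \<Longrightarrow> x \<in> S \<Longrightarrow> (f has_derivative frechet_derivative f (at x)) (at x)"
  unfolding smooth_on_def using Ck_on_SucE(1) by blast

lemma smooth_on_differentiable: "smooth_on S f \<Longrightarrow> x \<in> S \<Longrightarrow> f differentiable (at x)"
  using smooth_on_has_derivative differentiable_def by blast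

lemma smooth_on_linear_derivative:
  "smooth_on S f \<Longrightarrow> x \<in> S \<Longrightarrow> linear (frechet_derivative f (at x))"
  using smooth_on_has_derivative has_derivative_linear by blast

lemma smooth_on_continuous_on: "smooth_on S f \<Longrightarrow> continuous_on S f"
  unfolding smooth_on_def using Ck_on.simps(1) by blast

lemma smooth_on_derivative: "smooth_on S f \<Longrightarrow> smooth_on S (\<lambda>x. frechet_derivative f (at x) h)"
  unfolding smooth_on_def using Ck_on_SucE(2) by blast

lemma smooth_onI:
  assumes "open S" "\<And>x. x \<in> S \<Longrightarrow> (f has_derivative f' x) (at x)"
    "\<And>h. smooth_on S (\<lambda>x. f' x h)"
  shows "smooth_on S f"
proof -
  have "Ck_on (Suc n) S f" for n
    by (rule Ck_on_SucI[OF assms(1,2)]) (use assms(3) in \<open>auto simp: smooth_on_def\<close>)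
  then show ?thesis unfolding smooth_on_def using Ck_on_SucD by blast
qed

lemma smooth_on_const [simp, intro]: "smooth_on S (\<lambda>x. c)"
  by (simp add: smooth_on_def Ck_on_const)

lemma smooth_on_bounded_linear: "bounded_linear L \<Longrightarrow> open S \<Longrightarrow> smooth_on S L"
  by (simp add: smooth_on_def Ck_on_bounded_linear)

lemma smooth_on_ident: "open S \<Longrightarrow> smooth_on S (\<lambda>x. x)"
  by (rule smooth_on_bounded_linear[OF bounded_linear_ident])

lemma smooth_on_add: "open S \<Longrightarrow> smooth_on S f \<Longrightarrow> smooth_on S g \<Longrightarrow> smooth_on S (\<lambda>x. f x + g x)"
  by (simp add: smooth_on_def Ck_on_add)

lemma (in bounded_bilinear) smooth_on_prod:
  "open S \<Longrightarrow> smooth_on S f \<Longrightarrow> smooth_on S g \<Longrightarrow> smooth_on S (\<lambda>x. prod (f x) (g x))"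
  by (simp add: smooth_on_def Ck_on_prod)

lemmas smooth_on_mult = bounded_bilinear.smooth_on_prod[OF bounded_bilinear_mult]
lemmas smooth_on_scaleR = bounded_bilinear.smooth_on_prod[OF bounded_bilinear_scaleR]
lemmas smooth_on_inner = bounded_bilinear.smooth_on_prod[OF bounded_bilinear_inner]

lemma smooth_on_sum:
  "open S \<Longrightarrow> (\<And>i. i \<in> I \<Longrightarrow> smooth_on S (f i)) \<Longrightarrow> smooth_on S (\<lambda>x. \<Sum>i\<in>I. f i x)"
  by (simp add: smooth_on_def Ck_on_sum)

lemma smooth_on_compose:
  fixes f :: "'a::euclidean_space \<Rightarrow> 'b::euclidean_space" and g :: "'b \<Rightarrow> 'c::real_normed_vector"
  shows "open S \<Longrightarrow> open T \<Longrightarrow> smooth_on S f \<Longrightarrow> smooth_on T g \<Longrightarrow> f ` S \<subseteq> T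
    \<Longrightarrow> smooth_on S (\<lambda>x. g (f x))"
  by (simp add: smooth_on_def Ck_on_compose)

lemma smooth_on_linear_compose:
  fixes f :: "'a::euclidean_space \<Rightarrow> 'b::euclidean_space" and L :: "'b \<Rightarrow> 'c::real_normed_vector"
  assumes "linear L" "open S" "smooth_on S f"
  shows "smooth_on S (\<lambda>x. L (f x))"
  by (rule smooth_on_compose[OF assms(2) open_UNIV assms(3)])
    (use assms(1) in \<open>auto simp: smooth_on_bounded_linear linear_conv_bounded_linear\<close>)

lemma smooth_on_uminus:
  "open S \<Longrightarrow> smooth_on S f \<Longrightarrow> smooth_on S (\<lambda>x. - f x)"
  using smooth_on_scaleR[OF _ smooth_on_const[of S "-1::real"], of f] by simp

lemma smooth_on_diff:
  "open S \<Longrightarrow> smooth_on S f \<Longrightarrow> smooth_on S g \<Longrightarrow> smooth_on S (\<lambda>x. f x - g x)"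
  using smooth_on_add[OF _ _ smooth_on_uminus] by fastforce

text \<open>A family of linear maps need only be smooth on each fixed vector to be smooth on a
  moving one, again by expansion in \<open>Basis\<close>. This serves for derivatives, Christoffel
  symbols and Hessians evaluated on moving frames.\<close>

lemma smooth_on_linear_family:
  fixes L :: "'a::euclidean_space \<Rightarrow> 'b::euclidean_space \<Rightarrow> 'c::real_normed_vector"
  assumes "open S" "\<And>x. x \<in> S \<Longrightarrow> linear (L x)" "\<And>b. smooth_on S (\<lambda>x. L x b)" "smooth_on S v"
  shows "smooth_on S (\<lambda>x. L x (v x))"
proof -
  have "smooth_on S (\<lambda>x. \<Sum>b\<in>Basis. (v x \<bullet> b) *\<^sub>R L x b)"
    by (intro smooth_on_sum smooth_on_scaleR smooth_on_inner smooth_on_const assms)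
  then show ?thesis
    by (rule smooth_on_cong[OF assms(1), rotated])
      (use linear_Basis_expansion[OF assms(2)] in simp)
qed

lemma smooth_on_fst:
  fixes f :: "'a::euclidean_space \<Rightarrow> 'b::euclidean_space \<times> 'c::euclidean_space"
  shows "open S \<Longrightarrow> smooth_on S f \<Longrightarrow> smooth_on S (\<lambda>x. fst (f x))"
  by (rule smooth_on_linear_compose[OF linear_fst])

lemma smooth_on_snd:
  fixes f :: "'a::euclidean_space \<Rightarrow> 'b::euclidean_space \<times> 'c::euclidean_space"
  shows "open S \<Longrightarrow> smooth_on S f \<Longrightarrow> smooth_on S (\<lambda>x. snd (f x))"
  by (rule smooth_on_linear_compose[OF linear_snd])

lemma smooth_on_vec_nth:
  fixes f :: "'a::euclidean_space \<Rightarrow> 'b::euclidean_space ^ 'n"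
  shows "open S \<Longrightarrow> smooth_on S f \<Longrightarrow> smooth_on S (\<lambda>x. f x $ i)"
  by (rule smooth_on_linear_compose[where L = "\<lambda>v. v $ i"])
    (simp_all add: bounded_linear.linear bounded_linear_vec_nth)

lemma bounded_bilinear_matrix_vector_mult:
  "bounded_bilinear ((*v) :: real^'n^'m \<Rightarrow> real^'n \<Rightarrow> real^'m)"
proof -
  have "bilinear ((*v) :: real^'n^'m \<Rightarrow> real^'n \<Rightarrow> real^'m)"
    unfolding bilinear_def linear_iff
    by (auto simp: matrix_vector_mult_add_rdistrib matrix_vector_right_distrib
        matrix_vector_mult_scaleR scaleR_matrix_vector_assoc)
  then show ?thesis by (simp add: bilinear_conv_bounded_bilinear)
qed

lemmas smooth_on_matrix_vector_mult =
  bounded_bilinear.smooth_on_prod[OF bounded_bilinear_matrix_vector_mult]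

text \<open>The derivative is a constant times two copies of \<open>inverse\<close>, so the
  induction closes without any formula for higher derivatives.\<close>

lemma smooth_on_inverse_real: "smooth_on (- {0}) (inverse :: real \<Rightarrow> real)"
proof -
  have o: "open (- {0::real})" by auto
  have "Ck_on n (- {0}) (inverse :: real \<Rightarrow> real)" for n
  proof (induction n)
    case 0
    then show ?case by (auto intro!: continuous_intros)
  next
    case (Suc n)
    have "Ck_on n (- {0}) (\<lambda>x::real. - 1 * (inverse x * h * inverse x))" for h
      by (intro bounded_bilinear.Ck_on_prod[OF bounded_bilinear_mult] Ck_on_const o Suc)
    then show ?case
      by (intro Ck_on_SucI[OF o has_derivative_inverse']) auto
  qed
  then show ?thesis by (simp add: smooth_on_def)
qed

lemma smooth_on_inverse:
  fixes f :: "'a::euclidean_space \<Rightarrow> real"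
  assumes "open S" "smooth_on S f" "\<And>x. x \<in> S \<Longrightarrow> f x \<noteq> 0"
  shows "smooth_on S (\<lambda>x. inverse (f x))"
  by (rule smooth_on_compose[OF assms(1) _ assms(2) smooth_on_inverse_real]) (use assms(3) in auto)

lemma smooth_on_divide:
  fixes f g :: "'a::euclidean_space \<Rightarrow> real"
  assumes "open S" "smooth_on S f" "smooth_on S g" "\<And>x. x \<in> S \<Longrightarrow> g x \<noteq> 0"
  shows "smooth_on S (\<lambda>x. f x / g x)"
  unfolding divide_inverse by (intro smooth_on_mult smooth_on_inverse assms)

lemma smooth_on_ln:
  fixes f :: "'a::euclidean_space \<Rightarrow> real"
  assumes "open S" "smooth_on S f" "\<And>x. x \<in> S \<Longrightarrow> f x > 0"
  shows "smooth_on S (\<lambda>x. ln (f x))"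
proof (rule smooth_onI[OF assms(1)])
  show "((\<lambda>x. ln (f x)) has_derivative (\<lambda>h. frechet_derivative f (at x) h * inverse (f x))) (at x)"
    if "x \<in> S" for x
    by (rule has_derivative_eq_rhs[OF has_derivative_ln[OF assms(3)[OF that]
          smooth_on_has_derivative[OF assms(2) that]]]) (simp add: divide_inverse)
  show "smooth_on S (\<lambda>x. frechet_derivative f (at x) h * inverse (f x))" for h
    by (intro smooth_on_mult smooth_on_inverse smooth_on_derivative assms) (use assms(3) in force)
qed

lemma smooth_on_exp:
  fixes f :: "'a::euclidean_space \<Rightarrow> real"
  assumes "open S" "smooth_on S f"
  shows "smooth_on S (\<lambda>x. exp (f x))"
proof -
  have "Ck_on n S (\<lambda>x. exp (f x))" for n
  proof (induction n)
    case 0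
    then show ?case using smooth_on_continuous_on[OF assms(2)] by (auto intro!: continuous_intros)
  next
    case (Suc n)
    have "Ck_on n S (\<lambda>x. exp (f x) * frechet_derivative f (at x) h)" for h
      by (intro bounded_bilinear.Ck_on_prod[OF bounded_bilinear_mult] Suc assms(1))
        (use smooth_on_derivative[OF assms(2)] in \<open>simp add: smooth_on_def\<close>)
    then show ?case
      by (intro Ck_on_SucI[OF assms(1) has_derivative_exp[OF smooth_on_has_derivative[OF assms(2)]]])
        (simp_all add: mult.commute)
  qed
  then show ?thesis by (simp add: smooth_on_def)
qed

lemma smooth_on_sqrt:
  fixes f :: "'a::euclidean_space \<Rightarrow> real"
  assumes "open S" "smooth_on S f" "\<And>x. x \<in> S \<Longrightarrow> f x > 0"
  shows "smooth_on S (\<lambda>x. sqrt (f x))"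
proof -
  have "smooth_on S (\<lambda>x. exp (ln (f x) * (1/2)))"
    by (intro smooth_on_exp smooth_on_mult smooth_on_ln smooth_on_const assms)
  moreover have "exp (ln (f x) * (1/2)) = sqrt (f x)" if "x \<in> S" for x
    using assms(3)[OF that] exp_ln[of "sqrt (f x)"] by (simp add: ln_sqrt)
  ultimately show ?thesis by (rule smooth_on_cong[OF assms(1), rotated])
qed

text \<open>Symmetry of second derivatives: by the mean value theorem, applied twice in each order, the
  second difference along \<open>h\<close> and \<open>k\<close> is, up to the factor \<open>t\<^sup>2\<close>, a value of either mixed derivative
  at a nearby point.\<close>

lemma second_difference_eq:
  fixes f :: "'a::real_normed_vector \<Rightarrow> real"
  assumes t: "0 < t"
    and dom: "\<And>a b. a \<in> {0..t} \<Longrightarrow> b \<in> {0..t} \<Longrightarrow> x + a *\<^sub>R h + b *\<^sub>R k \<in> S"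
    and f: "\<And>z. z \<in> S \<Longrightarrow> (f has_derivative f' z) (at z)"
    and f': "\<And>z. z \<in> S \<Longrightarrow> ((\<lambda>z. f' z h) has_derivative f'' z) (at z)"
  obtains a b where "a \<in> {0<..<t}" "b \<in> {0<..<t}"
    "f (x + t *\<^sub>R h + t *\<^sub>R k) - f (x + t *\<^sub>R h) - f (x + t *\<^sub>R k) + f x
      = t\<^sup>2 * f'' (x + a *\<^sub>R h + b *\<^sub>R k) k"
proof -
  define \<phi> where "\<phi> a = f (x + a *\<^sub>R h + t *\<^sub>R k) - f (x + a *\<^sub>R h)" for a
  have d1: "((\<lambda>a. f (x + a *\<^sub>R h + b *\<^sub>R k)) has_derivative (\<lambda>s. s * f' (x + a *\<^sub>R h + b *\<^sub>R k) h)) (at a)"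
    if "a \<in> {0..t}" "b \<in> {0..t}" for a b
  proof -
    have "((\<lambda>a. x + a *\<^sub>R h + b *\<^sub>R k) has_derivative (\<lambda>s. s *\<^sub>R h)) (at a)"
      by (auto intro!: derivative_eq_intros)
    from has_derivative_compose[OF this f[OF dom[OF that]]]
    show ?thesis
      using linear_cmul[OF has_derivative_linear[OF f[OF dom[OF that]]]] by simp
  qed
  have "\<exists>a. 0 < a \<and> a < t \<and> \<phi> t - \<phi> 0 = (t - 0) * (f' (x + a *\<^sub>R h + t *\<^sub>R k) h - f' (x + a *\<^sub>R h) h)"
  proof (rule MVT2[OF t])
    fix a assume "0 \<le> a" "a \<le> t"
    then have a: "a \<in> {0..t}" by simp
    show "DERIV \<phi> a :> f' (x + a *\<^sub>R h + t *\<^sub>R k) h - f' (x + a *\<^sub>R h) h"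
      unfolding \<phi>_def has_field_derivative_def
      by (rule has_derivative_eq_rhs[OF has_derivative_diff[OF d1[OF a, of t] d1[OF a, of 0, simplified]]])
        (use t in \<open>auto simp: algebra_simps\<close>)
  qed
  then obtain a where a: "0 < a" "a < t"
    "\<phi> t - \<phi> 0 = t * (f' (x + a *\<^sub>R h + t *\<^sub>R k) h - f' (x + a *\<^sub>R h) h)" by auto
  have "\<exists>b. 0 < b \<and> b < t \<and> f' (x + a *\<^sub>R h + t *\<^sub>R k) h - f' (x + a *\<^sub>R h + 0 *\<^sub>R k) h
      = (t - 0) * f'' (x + a *\<^sub>R h + b *\<^sub>R k) k"
  proof (rule MVT2[OF t])
    fix b assume "0 \<le> b" "b \<le> t"
    then have z: "x + a *\<^sub>R h + b *\<^sub>R k \<in> S" using dom a by simp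
    have "((\<lambda>b. x + a *\<^sub>R h + b *\<^sub>R k) has_derivative (\<lambda>s. s *\<^sub>R k)) (at b)"
      by (auto intro!: derivative_eq_intros)
    from has_derivative_compose[OF this f'[OF z]]
    show "DERIV (\<lambda>b. f' (x + a *\<^sub>R h + b *\<^sub>R k) h) b :> f'' (x + a *\<^sub>R h + b *\<^sub>R k) k"
      unfolding has_field_derivative_def
      by (rule has_derivative_eq_rhs)
        (use linear_cmul[OF has_derivative_linear[OF f'[OF z]]] in auto)
  qed
  then obtain b where b: "0 < b" "b < t"
    "f' (x + a *\<^sub>R h + t *\<^sub>R k) h - f' (x + a *\<^sub>R h) h = t * f'' (x + a *\<^sub>R h + b *\<^sub>R k) k" by auto
  show thesis
    by (rule that[of a b]) (use a b in \<open>auto simp: \<phi>_def power2_eq_square algebra_simps\<close>)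
qed

lemma second_derivative_symmetric_real:
  fixes f :: "'a::euclidean_space \<Rightarrow> real"
  assumes "open S" "smooth_on S f" "x \<in> S"
  shows "frechet_derivative (\<lambda>z. frechet_derivative f (at z) k) (at x) h
       = frechet_derivative (\<lambda>z. frechet_derivative f (at z) h) (at x) k"
proof -
  let ?D = "\<lambda>h z. frechet_derivative (\<lambda>z. frechet_derivative f (at z) h) (at z)"
  have d: "(f has_derivative frechet_derivative f (at z)) (at z)" if "z \<in> S" for z
    using smooth_on_has_derivative[OF assms(2) that] .
  have d2: "((\<lambda>z. frechet_derivative f (at z) h) has_derivative ?D h z) (at z)" if "z \<in> S" for z h
    using smooth_on_has_derivative[OF smooth_on_derivative[OF assms(2)] that] .
  have cont: "isCont (\<lambda>z. ?D h z k) x" for h k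
    using smooth_on_continuous_on[OF smooth_on_derivative[OF smooth_on_derivative[OF assms(2)]]]
      assms(1,3) continuous_on_eq_continuous_at by blast
  obtain e where e: "e > 0" "ball x e \<subseteq> S" using assms(1,3) openE by blast
  have "\<bar>?D k x h - ?D h x k\<bar> \<le> \<epsilon>" if "\<epsilon> > 0" for \<epsilon>
  proof -
    obtain r1 where r1: "r1 > 0" "\<And>z. dist z x < r1 \<Longrightarrow> \<bar>?D h z k - ?D h x k\<bar> < \<epsilon> / 2"
      using cont[of h k] \<open>\<epsilon> > 0\<close> unfolding continuous_at_eps_delta
      by (metis dist_real_def half_gt_zero)
    obtain r2 where r2: "r2 > 0" "\<And>z. dist z x < r2 \<Longrightarrow> \<bar>?D k z h - ?D k x h\<bar> < \<epsilon> / 2"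
      using cont[of k h] \<open>\<epsilon> > 0\<close> unfolding continuous_at_eps_delta
      by (metis dist_real_def half_gt_zero)
    define r where "r = min e (min r1 r2)"
    have r: "r > 0" "r \<le> e" "r \<le> r1" "r \<le> r2" using e r1 r2 by (auto simp: r_def)
    \<comment> \<open>With this step the parallelogram spanned by \<open>t *\<^sub>R h\<close> and
      \<open>t *\<^sub>R k\<close> stays within distance \<open>r / 2\<close> of \<open>x\<close>;
      the summand 1 keeps the denominator positive when both vectors vanish.\<close>
    define t where "t = r / (2 * (norm h + norm k + 1))"
    have n: "0 < norm h + norm k + 1" by (simp add: add_nonneg_pos)
    have t: "t > 0" using r n by (simp add: t_def)
    have "t * (norm h + norm k) < r"
    proof -
      have "t * (norm h + norm k) \<le> t * (norm h + norm k + 1)" using t by simp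
      also have "\<dots> = r / 2" using n by (simp add: t_def field_simps)
      finally show ?thesis using r by linarith
    qed
    then have near: "dist (x + a *\<^sub>R h + b *\<^sub>R k) x < r" if "a \<in> {0..t}" "b \<in> {0..t}" for a b
    proof -
      have "dist (x + a *\<^sub>R h + b *\<^sub>R k) x = norm (a *\<^sub>R h + b *\<^sub>R k)" by (simp add: dist_norm)
      also have "\<dots> \<le> a * norm h + b * norm k"
        using norm_triangle_ineq[of "a *\<^sub>R h" "b *\<^sub>R k"] that by simp
      also have "\<dots> \<le> t * norm h + t * norm k"
        using that by (intro add_mono mult_right_mono) auto
      finally show ?thesis using \<open>t * (norm h + norm k) < r\<close> by (simp add: algebra_simps)
    qed
    have dom: "x + a *\<^sub>R h + b *\<^sub>R k \<in> S" "x + a *\<^sub>R k + b *\<^sub>R h \<in> S"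
      if "a \<in> {0..t}" "b \<in> {0..t}" for a b
      using near[OF that] near[OF that(2,1)] e(2) r(2)
      by (auto simp: subset_iff dist_commute algebra_simps)
    obtain a b where ab: "a \<in> {0<..<t}" "b \<in> {0<..<t}"
      "f (x + t *\<^sub>R h + t *\<^sub>R k) - f (x + t *\<^sub>R h) - f (x + t *\<^sub>R k) + f x
        = t\<^sup>2 * ?D h (x + a *\<^sub>R h + b *\<^sub>R k) k"
      by (rule second_difference_eq[where S = S, OF t dom(1) d d2])
    obtain a' b' where ab': "a' \<in> {0<..<t}" "b' \<in> {0<..<t}"
      "f (x + t *\<^sub>R k + t *\<^sub>R h) - f (x + t *\<^sub>R k) - f (x + t *\<^sub>R h) + f x
        = t\<^sup>2 * ?D k (x + a' *\<^sub>R k + b' *\<^sub>R h) h"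
      by (rule second_difference_eq[where S = S, OF t dom(2) d d2])
    have "f (x + t *\<^sub>R k + t *\<^sub>R h) - f (x + t *\<^sub>R k) - f (x + t *\<^sub>R h) + f x
        = f (x + t *\<^sub>R h + t *\<^sub>R k) - f (x + t *\<^sub>R h) - f (x + t *\<^sub>R k) + f x"
      by (simp add: algebra_simps)
    then have eq: "?D h (x + a *\<^sub>R h + b *\<^sub>R k) k = ?D k (x + a' *\<^sub>R k + b' *\<^sub>R h) h"
      using ab(3) ab'(3) t by simp
    have "dist (x + a *\<^sub>R h + b *\<^sub>R k) x < r" "dist (x + a' *\<^sub>R k + b' *\<^sub>R h) x < r"
      using near[of a b] near[of b' a'] ab ab' by (auto simp: algebra_simps)
    then have "\<bar>?D h (x + a *\<^sub>R h + b *\<^sub>R k) k - ?D h x k\<bar> < \<epsilon> / 2"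
        "\<bar>?D k (x + a' *\<^sub>R k + b' *\<^sub>R h) h - ?D k x h\<bar> < \<epsilon> / 2"
      using r1(2) r2(2) r(3,4) by force+
    then show ?thesis using eq by linarith
  qed
  then show ?thesis using field_le_epsilon by (metis abs_le_zero_iff add_0 eq_iff_diff_eq_0)
qed

lemma frechet_derivative_inner_left:
  assumes "f differentiable (at x)"
  shows "frechet_derivative (\<lambda>z. f z \<bullet> b) (at x) h = frechet_derivative f (at x) h \<bullet> b"
  using frechet_derivative_eqI[OF has_derivative_inner_left[OF
        frechet_derivative_works[THEN iffD1, OF assms]]] by metis

lemma second_derivative_symmetric:
  fixes f :: "'a::euclidean_space \<Rightarrow> 'b::euclidean_space"
  assumes S: "open S" "smooth_on S f" "x \<in> S"
  shows "frechet_derivative (\<lambda>z. frechet_derivative f (at z) k) (at x) h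
       = frechet_derivative (\<lambda>z. frechet_derivative f (at z) h) (at x) k"
proof (rule euclidean_eqI)
  fix b :: 'b assume "b \<in> Basis"
  let ?f = "\<lambda>z. f z \<bullet> b"
  have sm: "smooth_on S ?f" by (intro smooth_on_inner S smooth_on_const)
  have *: "frechet_derivative (\<lambda>z. frechet_derivative f (at z) k) (at x) h \<bullet> b
      = frechet_derivative (\<lambda>z. frechet_derivative ?f (at z) k) (at x) h" for h k
  proof -
    have "frechet_derivative (\<lambda>z. frechet_derivative f (at z) k) (at x) h \<bullet> b
        = frechet_derivative (\<lambda>z. frechet_derivative f (at z) k \<bullet> b) (at x) h"
      using smooth_on_differentiable[OF smooth_on_derivative[OF S(2)] S(3)]
      by (simp add: frechet_derivative_inner_left)
    also have "\<dots> = frechet_derivative (\<lambda>z. frechet_derivative ?f (at z) k) (at x) h"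
    proof -
      have "frechet_derivative f (at z) k \<bullet> b = frechet_derivative ?f (at z) k" if "z \<in> S" for z
        using smooth_on_differentiable[OF S(2) that] by (simp add: frechet_derivative_inner_left)
      then show ?thesis
        using frechet_derivative_transform_within_open[OF _ S(1,3),
            where f = "\<lambda>z. frechet_derivative f (at z) k \<bullet> b"
              and g = "\<lambda>z. frechet_derivative ?f (at z) k"]
          smooth_on_differentiable[OF smooth_on_inner[OF S(1) smooth_on_derivative[OF S(2)]
              smooth_on_const] S(3)] by simp
    qed
    finally show ?thesis .
  qed
  show "frechet_derivative (\<lambda>z. frechet_derivative f (at z) k) (at x) h \<bullet> b
      = frechet_derivative (\<lambda>z. frechet_derivative f (at z) h) (at x) k \<bullet> b"
    unfolding * by (rule second_derivative_symmetric_real[OF S(1) sm S(3)])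
qed

subsection \<open>Complexified forms\<close>

text \<open>A pair \<open>(h, h')\<close> stands for the complex tangent vector \<open>h + \<i> h'\<close>.\<close>

definition cext1 :: "('e \<Rightarrow> complex) \<Rightarrow> 'e \<times> 'e \<Rightarrow> complex" where
  "cext1 \<phi> H = \<phi> (fst H) + \<i> * \<phi> (snd H)"

definition cext2 :: "('e \<Rightarrow> 'e \<Rightarrow> complex) \<Rightarrow> 'e \<times> 'e \<Rightarrow> 'e \<times> 'e \<Rightarrow> complex" where
  "cext2 B H L = B (fst H) (fst L) + \<i> * B (fst H) (snd L) + \<i> * B (snd H) (fst L)
     - B (snd H) (snd L)"

lemma cext2_wedge: "cext2 (wedge \<phi> \<psi>) H L = wedge (cext1 \<phi>) (cext1 \<psi>) H L"
  by (simp add: cext1_def cext2_def wedge_def algebra_simps)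

lemma cext1_add: "cext1 (\<lambda>h. \<phi> h + \<psi> h) H = cext1 \<phi> H + cext1 \<psi> H"
  by (simp add: cext1_def algebra_simps)

lemma cext1_diff: "cext1 (\<lambda>h. \<phi> h - \<psi> h) H = cext1 \<phi> H - cext1 \<psi> H"
  by (simp add: cext1_def algebra_simps)

lemma cext1_uminus: "cext1 (\<lambda>h. - \<phi> h) H = - cext1 \<phi> H"
  by (simp add: cext1_def)

lemma cext1_scale: "cext1 (\<lambda>h. c * \<phi> h) H = c * cext1 \<phi> H"
  by (simp add: cext1_def algebra_simps)

lemma cext1_scale_right: "cext1 (\<lambda>h. \<phi> h * c) H = cext1 \<phi> H * c"
  by (simp add: cext1_def algebra_simps)

lemma cext1_sum: "cext1 (\<lambda>h. \<Sum>i\<in>I. \<phi> i h) H = (\<Sum>i\<in>I. cext1 (\<phi> i) H)"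
  by (simp add: cext1_def sum.distrib sum_distrib_left)

lemma cext1_zero: "cext1 (\<lambda>h. 0) H = 0"
  by (simp add: cext1_def)

lemmas cext1_simps = cext1_add cext1_diff cext1_uminus cext1_scale cext1_scale_right cext1_sum
  cext1_zero

lemma cext2_add: "cext2 (\<lambda>h l. B h l + C h l) H L = cext2 B H L + cext2 C H L"
  by (simp add: cext2_def algebra_simps)

lemma cext2_scale: "cext2 (\<lambda>h l. c * B h l) H L = c * cext2 B H L"
  by (simp add: cext2_def algebra_simps)

lemma cext2_sum: "cext2 (\<lambda>h l. \<Sum>i\<in>I. B i h l) H L = (\<Sum>i\<in>I. cext2 (B i) H L)"
  by (simp add: cext2_def sum.distrib sum_distrib_left sum_subtractf)

lemma sum_lessThan_9:
  "(\<Sum>i<9. f i) = f 0 + f 1 + f 2 + f 3 + f 4 + f 5 + f 6 + f 7 + (f (8::nat) :: 'a::comm_monoid_add)"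
  by (simp add: eval_nat_numeral)

text \<open>The Leibniz rule at a single point. Differentiability at \<open>y\<close> is all that is
  asked of the coefficients, since those of the normalised generators are not known to be
  smooth.\<close>

lemma ext_d_combination:
  fixes \<alpha> :: "'i \<Rightarrow> ('e::euclidean_space, 'f::real_normed_field) form1" and c :: "'i \<Rightarrow> 'e \<Rightarrow> 'f"
  assumes S: "open S" "y \<in> S"
    and \<beta>: "\<And>z h. z \<in> S \<Longrightarrow> \<beta> z h = (\<Sum>i\<in>I. c i z * \<alpha> i z h)"
    and c: "\<And>i. i \<in> I \<Longrightarrow> (c i has_derivative c' i) (at y)"
    and \<alpha>: "\<And>i h. i \<in> I \<Longrightarrow> (\<lambda>z. \<alpha> i z h) differentiable (at y)"
  shows "ext_d \<beta> y h l = (\<Sum>i\<in>I. wedge (c' i) (\<alpha> i y) h l + c i y * ext_d (\<alpha> i) y h l)"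
proof -
  have d: "frechet_derivative (\<lambda>z. \<beta> z l) (at y) h = (\<Sum>i\<in>I. c i y *
      frechet_derivative (\<lambda>z. \<alpha> i z l) (at y) h + c' i h * \<alpha> i y l)" for h l
  proof -
    have "((\<lambda>z. \<Sum>i\<in>I. c i z * \<alpha> i z l) has_derivative (\<lambda>h. \<Sum>i\<in>I. c i y *
      frechet_derivative (\<lambda>z. \<alpha> i z l) (at y) h + c' i h * \<alpha> i y l)) (at y)"
      by (intro has_derivative_sum has_derivative_mult c \<alpha>[unfolded frechet_derivative_works])
    then have "((\<lambda>z. \<beta> z l) has_derivative (\<lambda>h. \<Sum>i\<in>I. c i y *
      frechet_derivative (\<lambda>z. \<alpha> i z l) (at y) h + c' i h * \<alpha> i y l)) (at y)"
      by (rule has_derivative_transform_within_open[OF _ S]) (simp add: \<beta>)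
    from frechet_derivative_eqI[OF this] show ?thesis by simp
  qed
  show ?thesis
    unfolding ext_d_def d sum_subtractf[symmetric]
    by (intro sum.cong refl) (simp add: wedge_def algebra_simps)
qed

lemma ext_d_of_real:
  fixes \<alpha> :: "('e::euclidean_space, real) form1"
  assumes "\<And>h. (\<lambda>z. \<alpha> z h) differentiable (at y)"
  shows "ext_d (\<lambda>z h. of_real (\<alpha> z h) :: complex) y h l = of_real (ext_d \<alpha> y h l)"
  unfolding ext_d_def
  by (simp add: frechet_derivative_eqI[OF has_derivative_of_real[OF assms[unfolded frechet_derivative_works]]])

subsection \<open>The Frobenius conditions for the singular system\<close>

text \<open>The forms \<open>e 0, \<dots>, e 8\<close> are the pullbacks of
  \<open>\<eta>\<^sup>1, \<eta>\<^sup>2, \<eta>\<^sup>1\<^sub>2, \<omega>\<^sup>1, \<omega>\<^sup>2, \<omega>\<^sup>3, \<omega>\<^sup>1\<^sub>2, \<omega>\<^sup>3\<^sub>1, \<omega>\<^sup>3\<^sub>2\<close>; \<open>p1, p2\<close> are the components of the differential of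
  \<open>f = ln k / 2\<close> in the moving frame, and \<open>H11, H12, H22\<close> those of its Hessian.\<close>

locale embedding_coframe =
  fixes S :: "'e::euclidean_space set" and e :: "nat \<Rightarrow> ('e, real) form1"
    and k p1 p2 H11 H12 H22 :: "'e \<Rightarrow> real"
  assumes open_S: "open S"
    and differentiable_e: "\<And>y i h. y \<in> S \<Longrightarrow> i < 9 \<Longrightarrow> (\<lambda>z. e i z h) differentiable (at y)"
    and linear_e: "\<And>y i. y \<in> S \<Longrightarrow> i < 9 \<Longrightarrow> linear (e i y)"
    and onto: "\<And>y v. y \<in> S \<Longrightarrow> \<exists>h. \<forall>i<9. e i y h = v i"
    and d_e: "\<And>y h l. y \<in> S \<Longrightarrow> ext_d (e 0) y h l = - wedge (e 2 y) (e 1 y) h l"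
      "\<And>y h l. y \<in> S \<Longrightarrow> ext_d (e 1) y h l = - wedge (e 2 y) (e 0 y) h l"
      "\<And>y h l. y \<in> S \<Longrightarrow> ext_d (e 2) y h l = - (k y)\<^sup>2 * wedge (e 0 y) (e 1 y) h l"
      "\<And>y h l. y \<in> S \<Longrightarrow> ext_d (e 3) y h l
         = - wedge (e 6 y) (e 4 y) h l - wedge (e 7 y) (e 5 y) h l"
      "\<And>y h l. y \<in> S \<Longrightarrow> ext_d (e 4) y h l
         = - wedge (e 6 y) (e 3 y) h l + wedge (e 8 y) (e 5 y) h l"
      "\<And>y h l. y \<in> S \<Longrightarrow> ext_d (e 5) y h l
         = - wedge (e 7 y) (e 3 y) h l - wedge (e 8 y) (e 4 y) h l"
      "\<And>y h l. y \<in> S \<Longrightarrow> ext_d (e 6) y h l = - wedge (e 7 y) (e 8 y) h l"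
      "\<And>y h l. y \<in> S \<Longrightarrow> ext_d (e 7) y h l = - wedge (e 8 y) (e 6 y) h l"
      "\<And>y h l. y \<in> S \<Longrightarrow> ext_d (e 8) y h l = - wedge (e 7 y) (e 6 y) h l"
    and k_pos: "\<And>y. y \<in> S \<Longrightarrow> k y > 0"
    and derivative_k: "\<And>y. y \<in> S \<Longrightarrow>
      (k has_derivative (\<lambda>h. 2 * k y * (p1 y * e 0 y h + p2 y * e 1 y h))) (at y)"
    and derivative_p1: "\<And>y. y \<in> S \<Longrightarrow>
      (p1 has_derivative (\<lambda>h. H11 y * e 0 y h + H12 y * e 1 y h + p2 y * e 2 y h)) (at y)"
    and derivative_p2: "\<And>y. y \<in> S \<Longrightarrow>
      (p2 has_derivative (\<lambda>h. H12 y * e 0 y h + H22 y * e 1 y h + p1 y * e 2 y h)) (at y)"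
    and derivative_H: "\<And>y f. y \<in> S \<Longrightarrow> f \<in> {H11, H12, H22} \<Longrightarrow>
      \<exists>D. (f has_derivative D) (at y) \<and>
        (\<forall>h. e 0 y h = 0 \<and> e 1 y h = 0 \<and> e 2 y h = 0 \<longrightarrow> D h = 0)"
begin

definition ev :: "'e \<Rightarrow> nat \<Rightarrow> 'e \<times> 'e \<Rightarrow> complex" where
  "ev y i = cext1 (\<lambda>h. of_real (e i y h))"

text \<open>The value on complex vectors of the wedge product of \<open>e i\<close> and
  \<open>e j\<close>.\<close>

abbreviation ww :: "'e \<Rightarrow> 'e \<times> 'e \<Rightarrow> 'e \<times> 'e \<Rightarrow> nat \<Rightarrow> nat \<Rightarrow> complex" where
  "ww y H L i j \<equiv> ev y i H * ev y j L - ev y i L * ev y j H"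

lemma onto_complex:
  assumes "y \<in> S"
  obtains H where "\<And>i. i < 9 \<Longrightarrow> ev y i H = v i"
proof -
  obtain h l where "\<forall>i<9. e i y h = Re (v i)" "\<forall>i<9. e i y l = Im (v i)"
    using onto[OF assms, of "\<lambda>i. Re (v i)"] onto[OF assms, of "\<lambda>i. Im (v i)"] by blast
  then show thesis
    by (intro that[of "(h, l)"]) (auto simp: ev_def cext1_def complex_eq_iff)
qed

lemma cext2_d_e:
  assumes "y \<in> S"
  shows "cext2 (\<lambda>h l. of_real (ext_d (e 0) y h l)) H L = - ww y H L 2 1"
    "cext2 (\<lambda>h l. of_real (ext_d (e 1) y h l)) H L = - ww y H L 2 0"
    "cext2 (\<lambda>h l. of_real (ext_d (e 2) y h l)) H L = - (of_real (k y))\<^sup>2 * ww y H L 0 1"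
    "cext2 (\<lambda>h l. of_real (ext_d (e 3) y h l)) H L = - ww y H L 6 4 - ww y H L 7 5"
    "cext2 (\<lambda>h l. of_real (ext_d (e 4) y h l)) H L = - ww y H L 6 3 + ww y H L 8 5"
    "cext2 (\<lambda>h l. of_real (ext_d (e 5) y h l)) H L = - ww y H L 7 3 - ww y H L 8 4"
    "cext2 (\<lambda>h l. of_real (ext_d (e 6) y h l)) H L = - ww y H L 7 8"
    "cext2 (\<lambda>h l. of_real (ext_d (e 7) y h l)) H L = - ww y H L 8 6"
    "cext2 (\<lambda>h l. of_real (ext_d (e 8) y h l)) H L = - ww y H L 7 6"
  unfolding d_e[OF assms] ev_def
  by (simp_all add: cext2_def cext1_def wedge_def algebra_simps)

text \<open>The structure equations are substituted here once and for all, so that each later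
  evaluation is a polynomial identity in the components of two complex vectors.\<close>

lemma cext2_ext_d_combination:
  fixes c :: "nat \<Rightarrow> 'e \<Rightarrow> complex"
  assumes y: "y \<in> S"
    and \<beta>: "\<And>z h. z \<in> S \<Longrightarrow> \<beta> z h = (\<Sum>i<9. c i z * of_real (e i z h))"
    and c: "\<And>i. i < 9 \<Longrightarrow> (c i has_derivative c' i) (at y)"
  shows "cext2 (ext_d \<beta> y) H L =
    (\<Sum>i<9. cext1 (c' i) H * ev y i L - cext1 (c' i) L * ev y i H)
    - c 0 y * ww y H L 2 1 - c 1 y * ww y H L 2 0 - c 2 y * (of_real (k y))\<^sup>2 * ww y H L 0 1
    - c 3 y * (ww y H L 6 4 + ww y H L 7 5) + c 4 y * (ww y H L 8 5 - ww y H L 6 3)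
    - c 5 y * (ww y H L 7 3 + ww y H L 8 4) - c 6 y * ww y H L 7 8 - c 7 y * ww y H L 8 6
    - c 8 y * ww y H L 7 6"
proof -
  have "ext_d \<beta> y = (\<lambda>h l. \<Sum>i<9. wedge (c' i) (\<lambda>h. of_real (e i y h)) h l
      + c i y * of_real (ext_d (e i) y h l))"
  proof (intro ext)
    fix h l
    have "(\<lambda>z. complex_of_real (e i z h)) differentiable (at y)" if "i < 9" for i h
      using has_derivative_of_real[OF differentiable_e[OF y that, unfolded frechet_derivative_works]]
      by (auto simp: differentiable_def)
    then have "ext_d \<beta> y h l = (\<Sum>i<9. wedge (c' i) (\<lambda>h. of_real (e i y h)) h l
        + c i y * ext_d (\<lambda>z h. of_real (e i z h)) y h l)"
      by (intro ext_d_combination[OF open_S y \<beta>]) (use c in auto)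
    then show "ext_d \<beta> y h l = (\<Sum>i<9. wedge (c' i) (\<lambda>h. of_real (e i y h)) h l
        + c i y * of_real (ext_d (e i) y h l))"
      by (simp add: ext_d_of_real differentiable_e[OF y])
  qed
  then have "cext2 (ext_d \<beta> y) H L = (\<Sum>i<9. cext2 (wedge (c' i) (\<lambda>h. of_real (e i y h))) H L
      + c i y * cext2 (\<lambda>h l. of_real (ext_d (e i) y h l)) H L)"
    by (simp add: cext2_sum cext2_add cext2_scale)
  also have "\<dots> = (\<Sum>i<9. cext1 (c' i) H * ev y i L - cext1 (c' i) L * ev y i H)
      + (\<Sum>i<9. c i y * cext2 (\<lambda>h l. of_real (ext_d (e i) y h l)) H L)"
    by (simp add: cext2_wedge sum.distrib) (simp add: wedge_def ev_def)
  also have "(\<Sum>i<9. c i y * cext2 (\<lambda>h l. of_real (ext_d (e i) y h l)) H L) =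
    - c 0 y * ww y H L 2 1 - c 1 y * ww y H L 2 0 - c 2 y * (of_real (k y))\<^sup>2 * ww y H L 0 1
    - c 3 y * (ww y H L 6 4 + ww y H L 7 5) + c 4 y * (ww y H L 8 5 - ww y H L 6 3)
    - c 5 y * (ww y H L 7 3 + ww y H L 8 4) - c 6 y * ww y H L 7 8 - c 7 y * ww y H L 8 6
    - c 8 y * ww y H L 7 6"
    unfolding sum_lessThan_9 cext2_d_e[OF y] by (simp add: algebra_simps)
  finally show ?thesis by simp
qed

end

text \<open>\<open>A\<close> and \<open>B\<close> are the normalised generators \<open>\<omega>\<^sup>3\<^sub>1 - \<lambda> \<eta>\<^sup>2 + a\<^sub>i \<theta>\<^sub>i\<close> and
  \<open>\<omega>\<^sup>3\<^sub>2 + \<lambda> \<eta>\<^sup>1 + b\<^sub>i \<theta>\<^sub>i\<close> with \<open>\<lambda> = \<i> k\<close>. That they generate a Frobenius system is used in the form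
  that their differentials vanish on the complex vectors annihilated by both.\<close>

locale frobenius_pair = embedding_coframe +
  fixes a b :: "nat \<Rightarrow> 'a \<Rightarrow> complex" and A B :: "('a, complex) form1" and lam :: "'a \<Rightarrow> complex"
  assumes lam_def: "lam = (\<lambda>y. \<i> * of_real (k y))"
    and A_eq: "\<And>y h. y \<in> S \<Longrightarrow> A y h = (\<Sum>i<9. [- a 1 y, - lam y - a 2 y, - a 3 y,
      a 1 y, a 2 y, a 0 y, a 3 y, 1, 0] ! i * of_real (e i y h))"
    and B_eq: "\<And>y h. y \<in> S \<Longrightarrow> B y h = (\<Sum>i<9. [lam y - b 1 y, - b 2 y, - b 3 y,
      b 1 y, b 2 y, b 0 y, b 3 y, 0, 1] ! i * of_real (e i y h))"
    and differentiable_ab: "\<And>y j. y \<in> S \<Longrightarrow> j < 4 \<Longrightarrow> a j differentiable (at y)"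
      "\<And>y j. y \<in> S \<Longrightarrow> j < 4 \<Longrightarrow> b j differentiable (at y)"
    and closed: "\<And>y H L. y \<in> S \<Longrightarrow> cext1 (A y) H = 0 \<Longrightarrow> cext1 (B y) H = 0 \<Longrightarrow>
        cext1 (A y) L = 0 \<Longrightarrow> cext1 (B y) L = 0 \<Longrightarrow> cext2 (ext_d A y) H L = 0"
      "\<And>y H L. y \<in> S \<Longrightarrow> cext1 (A y) H = 0 \<Longrightarrow> cext1 (B y) H = 0 \<Longrightarrow>
        cext1 (A y) L = 0 \<Longrightarrow> cext1 (B y) L = 0 \<Longrightarrow> cext2 (ext_d B y) H L = 0"
begin

definition da :: "nat \<Rightarrow> 'a \<Rightarrow> 'a \<times> 'a \<Rightarrow> complex" where
  "da j y = cext1 (frechet_derivative (a j) (at y))"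

definition db :: "nat \<Rightarrow> 'a \<Rightarrow> 'a \<times> 'a \<Rightarrow> complex" where
  "db j y = cext1 (frechet_derivative (b j) (at y))"

text \<open>The differential of \<lambda> on complex vectors: \<lambda> is a constant times exp (2
  f), so d\<lambda> = 2 \<lambda> df.\<close>

definition dlam :: "'a \<Rightarrow> 'a \<times> 'a \<Rightarrow> complex" where
  "dlam y H = 2 * lam y * (of_real (p1 y) * ev y 0 H + of_real (p2 y) * ev y 1 H)"

definition annihilated :: "'a \<Rightarrow> 'a \<times> 'a \<Rightarrow> bool" where
  "annihilated y H \<longleftrightarrow> cext1 (A y) H = 0 \<and> cext1 (B y) H = 0"

lemma annihilated_iff:
  assumes "y \<in> S"
  shows "annihilated y H \<longleftrightarrow>
    - a 1 y * ev y 0 H - (lam y + a 2 y) * ev y 1 H - a 3 y * ev y 2 H + a 1 y * ev y 3 H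
      + a 2 y * ev y 4 H + a 0 y * ev y 5 H + a 3 y * ev y 6 H + ev y 7 H = 0 \<and>
    (lam y - b 1 y) * ev y 0 H - b 2 y * ev y 1 H - b 3 y * ev y 2 H + b 1 y * ev y 3 H
      + b 2 y * ev y 4 H + b 0 y * ev y 5 H + b 3 y * ev y 6 H + ev y 8 H = 0"
  unfolding annihilated_def A_eq[OF assms] B_eq[OF assms] cext1_sum cext1_scale
  unfolding sum_lessThan_9 ev_def by (simp add: algebra_simps del: One_nat_def)

lemma derivative_lam:
  assumes "y \<in> S"
  shows "(lam has_derivative (\<lambda>h. \<i> * of_real (2 * k y * (p1 y * e 0 y h + p2 y * e 1 y h)))) (at y)"
  unfolding lam_def by (intro has_derivative_mult_right has_derivative_of_real derivative_k assms)

lemma cext1_derivative_lam: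
  "cext1 (\<lambda>h. \<i> * of_real (2 * k y * (p1 y * e 0 y h + p2 y * e 1 y h))) H = dlam y H"
  unfolding dlam_def ev_def unfolding lam_def by (simp add: cext1_def algebra_simps)

text \<open>The unknown derivatives occur only in the combinations da_j \<and> \<theta>_j. They
  disappear on pairs of vectors on which all \<theta>_j vanish, and the values of the \<theta>_j
  decide which of them survive elsewhere.\<close>

lemma closed_A:
  assumes y: "y \<in> S" and H: "annihilated y H" "annihilated y L"
  shows "- da 1 y H * ev y 0 L + da 1 y L * ev y 0 H
    - (dlam y H + da 2 y H) * ev y 1 L + (dlam y L + da 2 y L) * ev y 1 H
    - da 3 y H * ev y 2 L + da 3 y L * ev y 2 H
    + da 1 y H * ev y 3 L - da 1 y L * ev y 3 H
    + da 2 y H * ev y 4 L - da 2 y L * ev y 4 H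
    + da 0 y H * ev y 5 L - da 0 y L * ev y 5 H
    + da 3 y H * ev y 6 L - da 3 y L * ev y 6 H
    + a 1 y * ww y H L 2 1 + (lam y + a 2 y) * ww y H L 2 0 + a 3 y * (of_real (k y))\<^sup>2 * ww y H L 0 1
    - a 1 y * (ww y H L 6 4 + ww y H L 7 5) + a 2 y * (ww y H L 8 5 - ww y H L 6 3)
    - a 0 y * (ww y H L 7 3 + ww y H L 8 4) - a 3 y * ww y H L 7 8 - ww y H L 8 6 = 0"
proof -
  let ?c = "\<lambda>i y. [- a 1 y, - lam y - a 2 y, - a 3 y, a 1 y, a 2 y, a 0 y, a 3 y, 1, 0] ! i"
  let ?d = "\<lambda>j. frechet_derivative (a j) (at y)"
  let ?dl = "\<lambda>h. \<i> * of_real (2 * k y * (p1 y * e 0 y h + p2 y * e 1 y h))"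
  let ?c' = "\<lambda>i h. [- ?d 1 h, - ?dl h - ?d 2 h, - ?d 3 h, ?d 1 h, ?d 2 h, ?d 0 h, ?d 3 h, 0, 0] ! i"
  have da: "(a j has_derivative ?d j) (at y)" if "j < 4" for j
    using differentiable_ab(1)[OF y that] frechet_derivative_works by blast
  have "(?c i has_derivative ?c' i) (at y)" if "i < 9" for i
  proof -
    have "i \<in> {0, 1, 2, 3, 4, 5, 6, 7, 8}" using that by auto
    then show ?thesis
      using has_derivative_minus[OF da[of 1]] has_derivative_minus[OF da[of 3]]
        has_derivative_diff[OF has_derivative_minus[OF derivative_lam[OF y]] da[of 2]]
        da[of 0] da[of 1] da[of 2] da[of 3] has_derivative_const
      by (elim insertE) simp_all
  qed
  from cext2_ext_d_combination[OF y A_eq this, of H L] closed(1)[OF y] H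
  have "0 = (\<Sum>i<9. cext1 (?c' i) H * ev y i L - cext1 (?c' i) L * ev y i H)
    - ?c 0 y * ww y H L 2 1 - ?c 1 y * ww y H L 2 0 - ?c 2 y * (of_real (k y))\<^sup>2 * ww y H L 0 1
    - ?c 3 y * (ww y H L 6 4 + ww y H L 7 5) + ?c 4 y * (ww y H L 8 5 - ww y H L 6 3)
    - ?c 5 y * (ww y H L 7 3 + ww y H L 8 4) - ?c 6 y * ww y H L 7 8 - ?c 7 y * ww y H L 8 6
    - ?c 8 y * ww y H L 7 6"
    by (simp add: annihilated_def)
  moreover have "cext1 (?c' 0) H = - da 1 y H" "cext1 (?c' 1) H = - dlam y H - da 2 y H"
    "cext1 (?c' 2) H = - da 3 y H" "cext1 (?c' 3) H = da 1 y H" "cext1 (?c' 4) H = da 2 y H"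
    "cext1 (?c' 5) H = da 0 y H" "cext1 (?c' 6) H = da 3 y H" "cext1 (?c' 7) H = 0"
    "cext1 (?c' 8) H = 0" for H
    unfolding da_def cext1_derivative_lam[symmetric] by (simp_all add: cext1_def algebra_simps)
  ultimately show ?thesis
    unfolding sum_lessThan_9 by (simp only:) (simp add: algebra_simps)
qed

lemma closed_B:
  assumes y: "y \<in> S" and H: "annihilated y H" "annihilated y L"
  shows "(dlam y H - db 1 y H) * ev y 0 L - (dlam y L - db 1 y L) * ev y 0 H
    - db 2 y H * ev y 1 L + db 2 y L * ev y 1 H
    - db 3 y H * ev y 2 L + db 3 y L * ev y 2 H
    + db 1 y H * ev y 3 L - db 1 y L * ev y 3 H
    + db 2 y H * ev y 4 L - db 2 y L * ev y 4 H
    + db 0 y H * ev y 5 L - db 0 y L * ev y 5 H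
    + db 3 y H * ev y 6 L - db 3 y L * ev y 6 H
    - (lam y - b 1 y) * ww y H L 2 1 + b 2 y * ww y H L 2 0 + b 3 y * (of_real (k y))\<^sup>2 * ww y H L 0 1
    - b 1 y * (ww y H L 6 4 + ww y H L 7 5) + b 2 y * (ww y H L 8 5 - ww y H L 6 3)
    - b 0 y * (ww y H L 7 3 + ww y H L 8 4) - b 3 y * ww y H L 7 8 - ww y H L 7 6 = 0"
proof -
  let ?c = "\<lambda>i y. [lam y - b 1 y, - b 2 y, - b 3 y, b 1 y, b 2 y, b 0 y, b 3 y, 0, 1] ! i"
  let ?d = "\<lambda>j. frechet_derivative (b j) (at y)"
  let ?dl = "\<lambda>h. \<i> * of_real (2 * k y * (p1 y * e 0 y h + p2 y * e 1 y h))"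
  let ?c' = "\<lambda>i h. [?dl h - ?d 1 h, - ?d 2 h, - ?d 3 h, ?d 1 h, ?d 2 h, ?d 0 h, ?d 3 h, 0, 0] ! i"
  have db: "(b j has_derivative ?d j) (at y)" if "j < 4" for j
    using differentiable_ab(2)[OF y that] frechet_derivative_works by blast
  have "(?c i has_derivative ?c' i) (at y)" if "i < 9" for i
  proof -
    have "i \<in> {0, 1, 2, 3, 4, 5, 6, 7, 8}" using that by auto
    then show ?thesis
      using has_derivative_minus[OF db[of 2]] has_derivative_minus[OF db[of 3]]
        has_derivative_diff[OF derivative_lam[OF y] db[of 1]]
        db[of 0] db[of 1] db[of 2] db[of 3] has_derivative_const
      by (elim insertE) simp_all
  qed
  from cext2_ext_d_combination[OF y B_eq this, of H L] closed(2)[OF y] H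
  have "0 = (\<Sum>i<9. cext1 (?c' i) H * ev y i L - cext1 (?c' i) L * ev y i H)
    - ?c 0 y * ww y H L 2 1 - ?c 1 y * ww y H L 2 0 - ?c 2 y * (of_real (k y))\<^sup>2 * ww y H L 0 1
    - ?c 3 y * (ww y H L 6 4 + ww y H L 7 5) + ?c 4 y * (ww y H L 8 5 - ww y H L 6 3)
    - ?c 5 y * (ww y H L 7 3 + ww y H L 8 4) - ?c 6 y * ww y H L 7 8 - ?c 7 y * ww y H L 8 6
    - ?c 8 y * ww y H L 7 6"
    by (simp add: annihilated_def)
  moreover have "cext1 (?c' 0) H = dlam y H - db 1 y H" "cext1 (?c' 1) H = - db 2 y H"
    "cext1 (?c' 2) H = - db 3 y H" "cext1 (?c' 3) H = db 1 y H" "cext1 (?c' 4) H = db 2 y H"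
    "cext1 (?c' 5) H = db 0 y H" "cext1 (?c' 6) H = db 3 y H" "cext1 (?c' 7) H = 0"
    "cext1 (?c' 8) H = 0" for H
    unfolding db_def cext1_derivative_lam[symmetric] by (simp_all add: cext1_def algebra_simps)
  ultimately show ?thesis
    unfolding sum_lessThan_9 by (simp only:) (simp add: algebra_simps)
qed

section \<open>Successive determination of the coefficients of the generators\<close>

lemma onto_complex_9:
  assumes "y \<in> S"
  obtains H where "ev y 0 H = v0" "ev y 1 H = v1" "ev y 2 H = v2" "ev y 3 H = v3" "ev y 4 H = v4"
    "ev y 5 H = v5" "ev y 6 H = v6" "ev y 7 H = v7" "ev y 8 H = v8"
proof -
  obtain H where H: "\<And>i. i < 9 \<Longrightarrow> ev y i H = [v0, v1, v2, v3, v4, v5, v6, v7, v8] ! i"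
    using onto_complex[OF assms] by blast
  show thesis
    by (rule that[of H])
      (use H[of 0] H[of 1] H[of 2] H[of 3] H[of 4] H[of 5] H[of 6] H[of 7] H[of 8] in simp_all)
qed

lemma lam_nonzero: "y \<in> S \<Longrightarrow> lam y \<noteq> 0"
  using k_pos[of y] by (simp add: lam_def)

lemma of_real_k_squared: "(of_real (k y))\<^sup>2 = - (lam y)\<^sup>2"
  by (simp add: lam_def power_mult_distrib)

text \<open>These vectors are annihilated by the whole singular system.\<close>

lemma X_vectors:
  assumes y: "y \<in> S"
  obtains X1 X2 where "annihilated y X1" "annihilated y X2"
    "ev y 0 X1 = 1" "ev y 1 X1 = 0" "ev y 2 X1 = 0" "ev y 3 X1 = 1" "ev y 4 X1 = 0"
    "ev y 5 X1 = 0" "ev y 6 X1 = 0" "ev y 7 X1 = 0" "ev y 8 X1 = - lam y"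
    "ev y 0 X2 = 0" "ev y 1 X2 = 1" "ev y 2 X2 = 0" "ev y 3 X2 = 0" "ev y 4 X2 = 1"
    "ev y 5 X2 = 0" "ev y 6 X2 = 0" "ev y 7 X2 = lam y" "ev y 8 X2 = 0"
proof -
  obtain X1 where X1: "ev y 0 X1 = 1" "ev y 1 X1 = 0" "ev y 2 X1 = 0" "ev y 3 X1 = 1" "ev y 4 X1 = 0"
    "ev y 5 X1 = 0" "ev y 6 X1 = 0" "ev y 7 X1 = 0" "ev y 8 X1 = - lam y"
    by (rule onto_complex_9[OF y])
  obtain X2 where X2: "ev y 0 X2 = 0" "ev y 1 X2 = 1" "ev y 2 X2 = 0" "ev y 3 X2 = 0" "ev y 4 X2 = 1"
    "ev y 5 X2 = 0" "ev y 6 X2 = 0" "ev y 7 X2 = lam y" "ev y 8 X2 = 0"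
    by (rule onto_complex_9[OF y])
  show thesis
    by (rule that[OF _ _ X1 X2])
      (simp_all add: annihilated_iff[OF y] X1 X2 algebra_simps del: One_nat_def)
qed

text \<open>All \<theta>_j vanish on \<open>X1\<close> and \<open>X2\<close>, so no derivative of a
  coefficient survives. The differential of \<lambda> and the structure equations remain, and they
  tie the coefficient of \<theta>_0 to that of \<theta>_3.\<close>

lemma first_coefficients:
  assumes y: "y \<in> S"
  shows "a 0 y = of_real (p1 y) + lam y * a 3 y" "b 0 y = of_real (p2 y) + lam y * b 3 y"
proof -
  obtain X1 X2 where X: "annihilated y X1" "annihilated y X2"
    "ev y 0 X1 = 1" "ev y 1 X1 = 0" "ev y 2 X1 = 0" "ev y 3 X1 = 1" "ev y 4 X1 = 0"
    "ev y 5 X1 = 0" "ev y 6 X1 = 0" "ev y 7 X1 = 0" "ev y 8 X1 = - lam y"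
    "ev y 0 X2 = 0" "ev y 1 X2 = 1" "ev y 2 X2 = 0" "ev y 3 X2 = 0" "ev y 4 X2 = 1"
    "ev y 5 X2 = 0" "ev y 6 X2 = 0" "ev y 7 X2 = lam y" "ev y 8 X2 = 0"
    by (rule X_vectors[OF y])
  have "2 * lam y * (a 0 y - of_real (p1 y) - lam y * a 3 y) = 0"
    using closed_A[OF y X(1,2)]
    unfolding X(3-20) dlam_def of_real_k_squared by (simp add: algebra_simps power2_eq_square)
  then have "a 0 y - of_real (p1 y) - lam y * a 3 y = 0" using lam_nonzero[OF y] by simp
  then show "a 0 y = of_real (p1 y) + lam y * a 3 y" by (simp add: diff_eq_eq add.commute)
  have "2 * lam y * (b 0 y - of_real (p2 y) - lam y * b 3 y) = 0"
    using closed_B[OF y X(1,2)]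
    unfolding X(3-20) dlam_def of_real_k_squared by (simp add: algebra_simps power2_eq_square)
  then have "b 0 y - of_real (p2 y) - lam y * b 3 y = 0" using lam_nonzero[OF y] by simp
  then show "b 0 y = of_real (p2 y) + lam y * b 3 y" by (simp add: diff_eq_eq add.commute)
qed

lemma has_derivative_ab:
  assumes "y \<in> S" "j < 4"
  shows "(a j has_derivative frechet_derivative (a j) (at y)) (at y)"
    and "(b j has_derivative frechet_derivative (b j) (at y)) (at y)"
  using differentiable_ab[OF assms] frechet_derivative_works by blast+

text \<open>The term with \<open>ev y 2\<close> is the effect of boosting the frame:
  \<open>p1\<close> and \<open>p2\<close> are components of df in a moving frame, and the connection
  form mixes them.\<close>

definition dp1 :: "'a \<Rightarrow> 'a \<times> 'a \<Rightarrow> complex" where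
  "dp1 y H = of_real (H11 y) * ev y 0 H + of_real (H12 y) * ev y 1 H + of_real (p2 y) * ev y 2 H"

definition dp2 :: "'a \<Rightarrow> 'a \<times> 'a \<Rightarrow> complex" where
  "dp2 y H = of_real (H12 y) * ev y 0 H + of_real (H22 y) * ev y 1 H + of_real (p1 y) * ev y 2 H"

lemma has_derivative_p1:
  "y \<in> S \<Longrightarrow> ((\<lambda>y. of_real (p1 y) :: complex) has_derivative (\<lambda>h. of_real
    (H11 y * e 0 y h + H12 y * e 1 y h + p2 y * e 2 y h))) (at y)"
  by (intro has_derivative_of_real derivative_p1)

lemma has_derivative_p2:
  "y \<in> S \<Longrightarrow> ((\<lambda>y. of_real (p2 y) :: complex) has_derivative (\<lambda>h. of_real
    (H12 y * e 0 y h + H22 y * e 1 y h + p1 y * e 2 y h))) (at y)"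
  by (intro has_derivative_of_real derivative_p2)

lemma cext1_derivative_p1:
  "cext1 (\<lambda>h. of_real (H11 y * e 0 y h + H12 y * e 1 y h + p2 y * e 2 y h)) H = dp1 y H"
  unfolding dp1_def ev_def by (simp add: cext1_def algebra_simps)

lemma cext1_derivative_p2:
  "cext1 (\<lambda>h. of_real (H12 y * e 0 y h + H22 y * e 1 y h + p1 y * e 2 y h)) H = dp2 y H"
  unfolding dp2_def ev_def by (simp add: cext1_def algebra_simps)

text \<open>The relations between coefficients hold on the whole open set \<open>S\<close>, so they
  may be differentiated; this is how each relation found gives information on derivatives.\<close>

lemma frechet_derivative_cong_on:
  assumes "y \<in> S" "\<And>z. z \<in> S \<Longrightarrow> f z = g z" "(f has_derivative f') (at y)"
    "(g has_derivative g') (at y)"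
  shows "f' = g'"
  by (rule has_derivative_unique[OF has_derivative_transform_within_open[OF assms(3) open_S assms(1,2)] assms(4)])

lemma da_0:
  assumes y: "y \<in> S"
  shows "da 0 y H = dp1 y H + dlam y H * a 3 y + lam y * da 3 y H"
    and "db 0 y H = dp2 y H + dlam y H * b 3 y + lam y * db 3 y H"
proof -
  have eq: "frechet_derivative (a 0) (at y) = (\<lambda>h. of_real
      (H11 y * e 0 y h + H12 y * e 1 y h + p2 y * e 2 y h) +
      (lam y * frechet_derivative (a 3) (at y) h
        + \<i> * of_real (2 * k y * (p1 y * e 0 y h + p2 y * e 1 y h)) * a 3 y))"
    by (rule frechet_derivative_cong_on[OF y first_coefficients(1) has_derivative_ab(1)[OF y] has_derivative_add[OF
          has_derivative_p1[OF y] has_derivative_mult[OF derivative_lam[OF y] has_derivative_ab(1)[OF y]]]]) auto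
  show "da 0 y H = dp1 y H + dlam y H * a 3 y + lam y * da 3 y H"
    unfolding da_def eq cext1_derivative_p1[symmetric] cext1_derivative_lam[symmetric]
    by (simp add: cext1_def algebra_simps)
  have eq: "frechet_derivative (b 0) (at y) = (\<lambda>h. of_real
      (H12 y * e 0 y h + H22 y * e 1 y h + p1 y * e 2 y h) +
      (lam y * frechet_derivative (b 3) (at y) h
        + \<i> * of_real (2 * k y * (p1 y * e 0 y h + p2 y * e 1 y h)) * b 3 y))"
    by (rule frechet_derivative_cong_on[OF y first_coefficients(2) has_derivative_ab(2)[OF y] has_derivative_add[OF
          has_derivative_p2[OF y] has_derivative_mult[OF derivative_lam[OF y] has_derivative_ab(2)[OF y]]]]) auto
  show "db 0 y H = dp2 y H + dlam y H * b 3 y + lam y * db 3 y H"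
    unfolding db_def eq cext1_derivative_p2[symmetric] cext1_derivative_lam[symmetric]
    by (simp add: cext1_def algebra_simps)
qed

text \<open>The vectors \<open>U0\<close>, and \<open>U1, U2\<close> below, have \<open>\<theta>\<^sub>3 + \<lambda> \<theta>\<^sub>0 + p\<^sub>2 \<theta>\<^sub>1 + p\<^sub>1 \<theta>\<^sub>2 = 0\<close>: this form spans the
  intersection of the second derived system with the span of the \<open>\<theta>\<^sub>i\<close>, and on its kernel the unknown
  derivatives of \<open>a 3\<close> and \<open>b 3\<close> cancel.\<close>

lemma U0_vector:
  assumes y: "y \<in> S"
  obtains U where "annihilated y U"
    "ev y 0 U = 0" "ev y 1 U = 0" "ev y 2 U = 0" "ev y 3 U = 0" "ev y 4 U = 0"
    "ev y 5 U = 1" "ev y 6 U = - lam y" "ev y 7 U = - of_real (p1 y)" "ev y 8 U = - of_real (p2 y)"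
proof -
  obtain U where U: "ev y 0 U = 0" "ev y 1 U = 0" "ev y 2 U = 0" "ev y 3 U = 0" "ev y 4 U = 0"
    "ev y 5 U = 1" "ev y 6 U = - lam y" "ev y 7 U = - of_real (p1 y)" "ev y 8 U = - of_real (p2 y)"
    by (rule onto_complex_9[OF y])
  show thesis
    by (rule that[OF _ U])
      (simp add: annihilated_iff[OF y] U first_coefficients[OF y] algebra_simps del: One_nat_def)
qed

text \<open>With \<open>first_coefficients\<close> the generators become \<open>A\<close> =
  \<omega>31 - \<lambda> \<eta>2 + p1 \<theta>_0 - \<open>be\<close> \<theta>_1 - \<open>al\<close>
  \<theta>_2 + a3 \<Theta> and \<open>B\<close> = \<omega>32 + \<lambda> \<eta>1 + p2 \<theta>_0 -
  \<open>ep\<close> \<theta>_1 - \<open>ga\<close> \<theta>_2 + b3 \<Theta>, where \<Theta> =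
  \<theta>_3 + \<lambda> \<theta>_0 + p2 \<theta>_1 + p1 \<theta>_2. The four functions are thus the
  coefficients modulo \<Theta>, up to sign.\<close>

definition al :: "'a \<Rightarrow> complex" where "al y = a 3 y * of_real (p1 y) - a 2 y"
definition be :: "'a \<Rightarrow> complex" where "be y = a 3 y * of_real (p2 y) - a 1 y"
definition ga :: "'a \<Rightarrow> complex" where "ga y = b 3 y * of_real (p1 y) - b 2 y"
definition ep :: "'a \<Rightarrow> complex" where "ep y = b 3 y * of_real (p2 y) - b 1 y"

text \<open>Pairing \<open>U0\<close> with \<open>X1\<close> or \<open>X2\<close> leaves da_0 -
  \<lambda> da_3 and its analogue for b, and both are known from \<open>da_0\<close>. The four
  functions are thereby expressed through \<lambda>, df and the Hessian.\<close>

lemma second_coefficients: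
  assumes y: "y \<in> S"
  shows "2 * lam y * al y = (lam y)\<^sup>2 + (of_real (p1 y))\<^sup>2 - of_real (H11 y)"
    and "2 * lam y * be y = of_real (p1 y) * of_real (p2 y) - of_real (H12 y)"
    and "2 * lam y * ga y = of_real (p1 y) * of_real (p2 y) - of_real (H12 y)"
    and "2 * lam y * ep y = (of_real (p2 y))\<^sup>2 - (lam y)\<^sup>2 - of_real (H22 y)"
proof -
  obtain X1 X2 where X: "annihilated y X1" "annihilated y X2"
    "ev y 0 X1 = 1" "ev y 1 X1 = 0" "ev y 2 X1 = 0" "ev y 3 X1 = 1" "ev y 4 X1 = 0"
    "ev y 5 X1 = 0" "ev y 6 X1 = 0" "ev y 7 X1 = 0" "ev y 8 X1 = - lam y"
    "ev y 0 X2 = 0" "ev y 1 X2 = 1" "ev y 2 X2 = 0" "ev y 3 X2 = 0" "ev y 4 X2 = 1"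
    "ev y 5 X2 = 0" "ev y 6 X2 = 0" "ev y 7 X2 = lam y" "ev y 8 X2 = 0"
    by (rule X_vectors[OF y])
  obtain U where U: "annihilated y U"
    "ev y 0 U = 0" "ev y 1 U = 0" "ev y 2 U = 0" "ev y 3 U = 0" "ev y 4 U = 0"
    "ev y 5 U = 1" "ev y 6 U = - lam y" "ev y 7 U = - of_real (p1 y)" "ev y 8 U = - of_real (p2 y)"
    by (rule U0_vector[OF y])
  note simps = X(3-20) U(2-10) da_0[OF y] first_coefficients[OF y] of_real_k_squared
  show "2 * lam y * al y = (lam y)\<^sup>2 + (of_real (p1 y))\<^sup>2 - of_real (H11 y)"
    using closed_A[OF y U(1) X(1)] unfolding simps dp1_def dp2_def dlam_def al_def
    by (simp add: X(3-20) U(2-10) algebra_simps power2_eq_square del: One_nat_def)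
  show "2 * lam y * be y = of_real (p1 y) * of_real (p2 y) - of_real (H12 y)"
    using closed_A[OF y U(1) X(2)] unfolding simps dp1_def dp2_def dlam_def be_def
    by (simp add: X(3-20) U(2-10) algebra_simps power2_eq_square del: One_nat_def)
  show "2 * lam y * ga y = of_real (p1 y) * of_real (p2 y) - of_real (H12 y)"
    using closed_B[OF y U(1) X(1)] unfolding simps dp1_def dp2_def dlam_def ga_def
    by (simp add: X(3-20) U(2-10) algebra_simps power2_eq_square del: One_nat_def)
  show "2 * lam y * ep y = (of_real (p2 y))\<^sup>2 - (lam y)\<^sup>2 - of_real (H22 y)"
    using closed_B[OF y U(1) X(2)] unfolding simps dp1_def dp2_def dlam_def ep_def
    by (simp add: X(3-20) U(2-10) algebra_simps power2_eq_square del: One_nat_def)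
qed

lemma ev_eq_0_iff: "ev y i U = 0 \<longleftrightarrow> e i y (fst U) = 0 \<and> e i y (snd U) = 0"
  by (auto simp: ev_def cext1_def complex_eq_iff)

text \<open>The directions in the kernel of \<open>e 0\<close>, \<open>e 1\<close>,
  \<open>e 2\<close> do not move the frame of the surface. There \<lambda>, \<open>q\<close> and
  \<open>R\<close> have zero derivative, so differentiating the relation and cancelling 2 \<lambda>
  leaves only \<open>f\<close> and \<open>g\<close>.\<close>

lemma derivative_vertical:
  fixes f g R :: "'a \<Rightarrow> complex"
  assumes y: "y \<in> S"
    and q: "(q has_derivative q') (at y)"
      "\<And>h. e 0 y h = 0 \<Longrightarrow> e 1 y h = 0 \<Longrightarrow> e 2 y h = 0 \<Longrightarrow> q' h = 0"
    and fg: "(f has_derivative f') (at y)" "(g has_derivative g') (at y)"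
    and eq: "\<And>z. z \<in> S \<Longrightarrow> 2 * lam z * (f z * of_real (q z) - g z) = R z"
    and R: "(R has_derivative R') (at y)"
      "\<And>h. e 0 y h = 0 \<Longrightarrow> e 1 y h = 0 \<Longrightarrow> e 2 y h = 0 \<Longrightarrow> R' h = 0"
    and U: "ev y 0 U = 0" "ev y 1 U = 0" "ev y 2 U = 0"
  shows "cext1 g' U = of_real (q y) * cext1 f' U"
proof -
  let ?dl = "\<lambda>h. \<i> * of_real (2 * k y * (p1 y * e 0 y h + p2 y * e 1 y h))"
  have d: "((\<lambda>z. 2 * lam z * (f z * of_real (q z) - g z)) has_derivative
     (\<lambda>h. 2 * lam y * (f y * of_real (q' h) + f' h * of_real (q y) - g' h)
       + 2 * ?dl h * (f y * of_real (q y) - g y))) (at y)"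
    by (intro has_derivative_mult[where f = "\<lambda>z. 2 * lam z"] has_derivative_mult_right
        derivative_lam[OF y] has_derivative_diff has_derivative_mult fg has_derivative_of_real q)
  have "(\<lambda>h. 2 * lam y * (f y * of_real (q' h) + f' h * of_real (q y) - g' h)
       + 2 * ?dl h * (f y * of_real (q y) - g y)) = R'"
    by (rule frechet_derivative_cong_on[OF y eq d R(1)])
  then have *: "2 * lam y * (f y * of_real (q' h) + f' h * of_real (q y) - g' h)
       + 2 * ?dl h * (f y * of_real (q y) - g y) = R' h" for h by meson
  have "g' h = of_real (q y) * f' h" if "e 0 y h = 0" "e 1 y h = 0" "e 2 y h = 0" for h
    using *[of h] lam_nonzero[OF y] unfolding q(2)[OF that] R(2)[OF that] that by (simp add: mult.commute)
  then show ?thesis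
    using U unfolding ev_eq_0_iff by (simp add: cext1_def algebra_simps)
qed

lemma vertical_derivatives:
  assumes y: "y \<in> S" and U: "ev y 0 U = 0" "ev y 1 U = 0" "ev y 2 U = 0"
  shows "da 2 y U = of_real (p1 y) * da 3 y U" "da 1 y U = of_real (p2 y) * da 3 y U"
    "db 2 y U = of_real (p1 y) * db 3 y U" "db 1 y U = of_real (p2 y) * db 3 y U"
proof -
  obtain D11 D12 D22 where D: "(H11 has_derivative D11) (at y)" "(H12 has_derivative D12) (at y)"
      "(H22 has_derivative D22) (at y)"
    and D0: "\<And>h. e 0 y h = 0 \<Longrightarrow> e 1 y h = 0 \<Longrightarrow> e 2 y h = 0 \<Longrightarrow> D11 h = 0 \<and> D12 h = 0 \<and> D22 h = 0"
    using derivative_H[OF y] by (metis insertCI)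
  let ?dl = "\<lambda>h. \<i> * of_real (2 * k y * (p1 y * e 0 y h + p2 y * e 1 y h))"
  let ?d1 = "\<lambda>h. of_real (H11 y * e 0 y h + H12 y * e 1 y h + p2 y * e 2 y h) :: complex"
  let ?d2 = "\<lambda>h. of_real (H12 y * e 0 y h + H22 y * e 1 y h + p1 y * e 2 y h) :: complex"
  note ders = has_derivative_diff has_derivative_add has_derivative_mult derivative_lam[OF y]
    has_derivative_p1[OF y] has_derivative_p2[OF y] has_derivative_of_real[OF D(1)]
    has_derivative_of_real[OF D(2)] has_derivative_of_real[OF D(3)]
  have d11: "((\<lambda>z. lam z * lam z + of_real (p1 z) * of_real (p1 z) - of_real (H11 z)) has_derivative
      (\<lambda>h. (lam y * ?dl h + ?dl h * lam y) + (of_real (p1 y) * ?d1 h + ?d1 h * of_real (p1 y))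
        - of_real (D11 h))) (at y)"
    by (intro ders)
  have d12: "((\<lambda>z. of_real (p1 z) * of_real (p2 z) - of_real (H12 z)) has_derivative
      (\<lambda>h. (of_real (p1 y) * ?d2 h + ?d1 h * of_real (p2 y)) - of_real (D12 h))) (at y)"
    by (intro ders)
  have d22: "((\<lambda>z. of_real (p2 z) * of_real (p2 z) - lam z * lam z - of_real (H22 z)) has_derivative
      (\<lambda>h. (of_real (p2 y) * ?d2 h + ?d2 h * of_real (p2 y)) - (lam y * ?dl h + ?dl h * lam y)
        - of_real (D22 h))) (at y)"
    by (intro ders)
  show "da 2 y U = of_real (p1 y) * da 3 y U" unfolding da_def
    by (rule derivative_vertical[OF y derivative_p1[OF y] _ has_derivative_ab(1)[OF y]
          has_derivative_ab(1)[OF y] second_coefficients(1)[unfolded al_def power2_eq_square] d11 _ U])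
      (simp_all add: D0)
  show "da 1 y U = of_real (p2 y) * da 3 y U" unfolding da_def
    by (rule derivative_vertical[OF y derivative_p2[OF y] _ has_derivative_ab(1)[OF y]
          has_derivative_ab(1)[OF y] second_coefficients(2)[unfolded be_def] d12 _ U])
      (simp_all add: D0)
  show "db 2 y U = of_real (p1 y) * db 3 y U" unfolding db_def
    by (rule derivative_vertical[OF y derivative_p1[OF y] _ has_derivative_ab(2)[OF y]
          has_derivative_ab(2)[OF y] second_coefficients(3)[unfolded ga_def] d12 _ U])
      (simp_all add: D0)
  show "db 1 y U = of_real (p2 y) * db 3 y U" unfolding db_def
    by (rule derivative_vertical[OF y derivative_p2[OF y] _ has_derivative_ab(2)[OF y]
          has_derivative_ab(2)[OF y] second_coefficients(4)[unfolded ep_def power2_eq_square] d22 _ U])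
      (simp_all add: D0)
qed

text \<open>Both are determined by the same Hessian entry \<open>H12\<close>. Its derivative is the
  relation that finally links the unknown derivatives in \<open>A\<close> to those in
  \<open>B\<close>.\<close>

lemma be_eq_ga: "y \<in> S \<Longrightarrow> be y = ga y"
  using second_coefficients(2,3)[of y] lam_nonzero[of y]
  by (metis mult_cancel_left no_zero_divisors zero_neq_numeral)

lemma derivative_be_eq_ga:
  assumes y: "y \<in> S"
  shows "of_real (p2 y) * da 3 y H + a 3 y * dp2 y H - da 1 y H
    = of_real (p1 y) * db 3 y H + b 3 y * dp1 y H - db 2 y H"
proof -
  note d = has_derivative_ab[OF y]
  have d_be: "(be has_derivative (\<lambda>h. a 3 y * of_real
        (H12 y * e 0 y h + H22 y * e 1 y h + p1 y * e 2 y h)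
      + frechet_derivative (a 3) (at y) h * of_real (p2 y) - frechet_derivative (a 1) (at y) h)) (at y)"
    unfolding be_def[abs_def]
    by (intro has_derivative_diff has_derivative_mult d has_derivative_p2 y) auto
  have d_ga: "(ga has_derivative (\<lambda>h. b 3 y * of_real
        (H11 y * e 0 y h + H12 y * e 1 y h + p2 y * e 2 y h)
      + frechet_derivative (b 3) (at y) h * of_real (p1 y) - frechet_derivative (b 2) (at y) h)) (at y)"
    unfolding ga_def[abs_def]
    by (intro has_derivative_diff has_derivative_mult d has_derivative_p1 y) auto
  have eq: "(\<lambda>h. a 3 y * of_real (H12 y * e 0 y h + H22 y * e 1 y h + p1 y * e 2 y h)
      + frechet_derivative (a 3) (at y) h * of_real (p2 y) - frechet_derivative (a 1) (at y) h)
    = (\<lambda>h. b 3 y * of_real (H11 y * e 0 y h + H12 y * e 1 y h + p2 y * e 2 y h)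
      + frechet_derivative (b 3) (at y) h * of_real (p1 y) - frechet_derivative (b 2) (at y) h)"
    by (rule frechet_derivative_cong_on[OF y be_eq_ga d_be d_ga])
  have "cext1 (\<lambda>h. a 3 y * of_real (H12 y * e 0 y h + H22 y * e 1 y h + p1 y * e 2 y h)
      + frechet_derivative (a 3) (at y) h * of_real (p2 y) - frechet_derivative (a 1) (at y) h) H
    = cext1 (\<lambda>h. b 3 y * of_real (H11 y * e 0 y h + H12 y * e 1 y h + p2 y * e 2 y h)
      + frechet_derivative (b 3) (at y) h * of_real (p1 y) - frechet_derivative (b 2) (at y) h) H"
    unfolding eq ..
  then show ?thesis
    unfolding cext1_diff cext1_add cext1_scale cext1_scale_right cext1_derivative_p1
      cext1_derivative_p2 da_def db_def by (simp add: mult.commute add.commute)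
qed

theorem hessian_at_adapted_frame:
  assumes y: "y \<in> S" and p: "p1 y = 0" "p2 y \<noteq> 0"
  shows "H12 y = 0" "H11 y = - (k y)\<^sup>2" "H22 y = 3 * (p2 y)\<^sup>2 + (k y)\<^sup>2"
proof -
  obtain X1 X2 where X: "annihilated y X1" "annihilated y X2"
    "ev y 0 X1 = 1" "ev y 1 X1 = 0" "ev y 2 X1 = 0" "ev y 3 X1 = 1" "ev y 4 X1 = 0"
    "ev y 5 X1 = 0" "ev y 6 X1 = 0" "ev y 7 X1 = 0" "ev y 8 X1 = - lam y"
    "ev y 0 X2 = 0" "ev y 1 X2 = 1" "ev y 2 X2 = 0" "ev y 3 X2 = 0" "ev y 4 X2 = 1"
    "ev y 5 X2 = 0" "ev y 6 X2 = 0" "ev y 7 X2 = lam y" "ev y 8 X2 = 0"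
    by (rule X_vectors[OF y])
  obtain U0 where U0: "annihilated y U0"
    "ev y 0 U0 = 0" "ev y 1 U0 = 0" "ev y 2 U0 = 0" "ev y 3 U0 = 0" "ev y 4 U0 = 0"
    "ev y 5 U0 = 1" "ev y 6 U0 = - lam y" "ev y 7 U0 = - of_real (p1 y)" "ev y 8 U0 = - of_real (p2 y)"
    by (rule U0_vector[OF y])
  \<comment> \<open>\<open>U1\<close> has \<theta>_1 = 1 and \<open>U2\<close> has \<theta>_2 = 1;
    the value of \<theta>_3 then puts them in the kernel of the form described before
    \<open>U0_vector\<close>, and the last two components are forced by annihilation.\<close>
  obtain U1 where U1: "ev y 0 U1 = 0" "ev y 1 U1 = 0" "ev y 2 U1 = 0" "ev y 3 U1 = 1" "ev y 4 U1 = 0"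
    "ev y 5 U1 = 0" "ev y 6 U1 = - of_real (p2 y)" "ev y 7 U1 = be y" "ev y 8 U1 = ep y"
    by (rule onto_complex_9[OF y])
  obtain U2 where U2: "ev y 0 U2 = 0" "ev y 1 U2 = 0" "ev y 2 U2 = 0" "ev y 3 U2 = 0" "ev y 4 U2 = 1"
    "ev y 5 U2 = 0" "ev y 6 U2 = - of_real (p1 y)" "ev y 7 U2 = al y" "ev y 8 U2 = ga y"
    by (rule onto_complex_9[OF y])
  have ann: "annihilated y U1" "annihilated y U2"
    by (simp_all add: annihilated_iff[OF y] U1 U2 al_def be_def ga_def ep_def algebra_simps
        del: One_nat_def)
  note D = da_0[OF y]
  note vU0 = vertical_derivatives[OF y U0(2-4)]
  note vU1 = vertical_derivatives[OF y U1(1-3)]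
  note vU2 = vertical_derivatives[OF y U2(1-3)]
  have co: "a 2 y = - al y" "a 1 y = a 3 y * of_real (p2 y) - be y"
    "b 2 y = - ga y" "b 1 y = b 3 y * of_real (p2 y) - ep y"
    using p(1) by (simp_all add: al_def be_def ga_def ep_def)
  define P L x z where "P = (of_real (p2 y) :: complex)" "L = lam y" "x = a 3 y" "z = b 3 y"
  have nz: "P \<noteq> 0" "L \<noteq> 0" using p lam_nonzero[OF y] by (simp_all add: P_L_x_z_def)
  note simps = U0(2-10) U1 U2 X(3-20) D vU0 vU1 vU2 co first_coefficients[OF y] of_real_k_squared
    be_eq_ga[OF y, symmetric] dp1_def dp2_def dlam_def p(1) P_L_x_z_def[symmetric]
  \<comment> \<open>All of \<open>U0\<close>, \<open>U1\<close>, \<open>U2\<close> are vertical, so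
    by \<open>vertical_derivatives\<close> no derivative survives among them: \<open>e1\<close> to
    \<open>e4\<close> are purely algebraic relations at \<open>y\<close>.\<close>
  have e1: "al y * ep y - (be y)\<^sup>2 - P\<^sup>2 - L * (al y + ep y) = 0"
    using closed_A[OF y U0(1) ann(1)] unfolding simps
    by (simp add: simps algebra_simps power2_eq_square del: One_nat_def)
  have e2: "2 * L * (be y - x * P) = 0"
    using closed_A[OF y U0(1) ann(2)] unfolding simps
    by (simp add: simps algebra_simps power2_eq_square del: One_nat_def) auto
  have e3: "2 * L * be y = 0"
    using closed_B[OF y U0(1) ann(1)] unfolding simps
    by (simp add: simps algebra_simps power2_eq_square del: One_nat_def)
  have e4: "P\<^sup>2 - L * (al y + ep y) + (be y)\<^sup>2 - al y * ep y + 2 * L * z * P = 0"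
    using closed_B[OF y U0(1) ann(2)] unfolding simps
    by (simp add: simps algebra_simps power2_eq_square del: One_nat_def)
  have be: "be y = 0" "x = 0" using e2 e3 nz by auto
  \<comment> \<open>Pairing with the horizontal \<open>X1\<close> leaves one unknown combination of
    derivatives in \<open>A\<close> (\<open>e5\<close>) and one in \<open>B\<close>
    (\<open>e6\<close>). These are the two sides of the differentiated identity
    \<open>be = ga\<close>, so \<open>e7\<close> removes them both.\<close>
  have e5: "P * da 3 y X1 - da 1 y X1 = (al y - L) * P"
    using closed_A[OF y ann(1) X(1)] unfolding simps be
    by (simp add: simps be algebra_simps power2_eq_square del: One_nat_def)
  have e6: "z * of_real (H11 y) - db 2 y X1 = (al y + L) * P - 2 * L * z * (al y - L)"
  proof -
    have "of_real (H11 y) = L * L - 2 * L * al y"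
      using second_coefficients(1)[OF y] p(1) by (simp add: P_L_x_z_def power2_eq_square)
    moreover have "- (L * P) = L * (L * z) + (P * al y + db 2 y X1)"
      using closed_B[OF y ann(2) X(1)] unfolding simps be
      by (simp add: simps be algebra_simps power2_eq_square del: One_nat_def)
    ultimately show ?thesis by algebra
  qed
  have e7: "P * da 3 y X1 - da 1 y X1 = z * of_real (H11 y) - db 2 y X1"
    using derivative_be_eq_ga[OF y, of X1] unfolding simps be
    by (simp add: simps be algebra_simps power2_eq_square del: One_nat_def)
  have "2 * L * (z * P - (al y + ep y)) = 0" using e1 e4 be by algebra
  then have zP: "z * P = al y + ep y" using nz by simp
  have "2 * L * (z * (al y - L) - P) = 0" using e5 e6 e7 by algebra
  then have zal: "z * (al y - L) = P" using nz by simp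
  \<comment> \<open>The two relations for \<open>z\<close> give P^2 = z P (al - L) = (al + ep) (al -
    L), whereas \<open>e1\<close> with \<open>be y = 0\<close> gives P^2 = al ep - L (al + ep); the
    difference is al^2.\<close>
  have "(al y)\<^sup>2 = 0" using e1 be zP zal by algebra
  then have al: "al y = 0" by simp
  then have ep: "L * ep y = - P\<^sup>2" using e1 be by algebra
  have "of_real (H12 y) = (0 :: complex)" using second_coefficients(2)[OF y] be p(1) by simp
  then show "H12 y = 0" by simp
  have "of_real (H11 y) = (lam y)\<^sup>2" using second_coefficients(1)[OF y] al p(1) by simp
  also have "\<dots> = of_real (- (k y)\<^sup>2)" using of_real_k_squared[of y] by simp
  finally show "H11 y = - (k y)\<^sup>2" using of_real_eq_iff by blast
  have "of_real (H22 y) = 3 * P\<^sup>2 - (lam y)\<^sup>2"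
    using second_coefficients(4)[OF y] ep unfolding P_L_x_z_def by algebra
  also have "\<dots> = of_real (3 * (p2 y)\<^sup>2 + (k y)\<^sup>2)"
    using of_real_k_squared[of y] by (simp add: P_L_x_z_def)
  finally show "H22 y = 3 * (p2 y)\<^sup>2 + (k y)\<^sup>2" using of_real_eq_iff by blast
qed

end

subsection \<open>Differentiability of the dual frame\<close>

text \<open>At a zero of \<open>F\<close> the product rule has no term with the derivative of
  \<open>u\<close>, so continuity of \<open>u\<close> is enough. This turns continuity of the
  solution of a linear equation into differentiability.\<close>

lemma differentiable_continuous_mult_zero:
  fixes u :: "'a::real_normed_vector \<Rightarrow> real" and F :: "'a \<Rightarrow> 'b::real_normed_vector"
  assumes u: "isCont u y" and F: "(F has_derivative F') (at y)" "F y = 0"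
  shows "((\<lambda>z. u z *\<^sub>R F z) has_derivative (\<lambda>h. u y *\<^sub>R F' h)) (at y)"
proof -
  have bl: "bounded_linear F'" using F(1) has_derivative_bounded_linear by blast
  obtain C where C: "\<And>h. norm (F' h) \<le> norm h * C" using bounded_linear.bounded[OF bl] by blast
  let ?R = "\<lambda>h. norm (F (y + h) - F y - F' h) / norm h"
  have R: "?R \<midarrow>0\<rightarrow> 0" using F(1) unfolding has_derivative_at by blast
  have uy: "(\<lambda>h. u (y + h)) \<midarrow>0\<rightarrow> u y" using u by (simp add: isCont_iff)
  have "(\<lambda>h. \<bar>u (y + h)\<bar> * ?R h + \<bar>u (y + h) - u y\<bar> * C) \<midarrow>0\<rightarrow> \<bar>u y\<bar> * 0 + \<bar>u y - u y\<bar> * C"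
    by (intro tendsto_intros R uy)
  then have lim: "(\<lambda>h. \<bar>u (y + h)\<bar> * ?R h + \<bar>u (y + h) - u y\<bar> * C) \<midarrow>0\<rightarrow> 0" by simp
  have "norm (norm (u (y + h) *\<^sub>R F (y + h) - u y *\<^sub>R F y - u y *\<^sub>R F' h) / norm h)
      \<le> \<bar>u (y + h)\<bar> * ?R h + \<bar>u (y + h) - u y\<bar> * C" if "h \<noteq> 0" for h
  proof -
    have "u (y + h) *\<^sub>R F (y + h) - u y *\<^sub>R F y - u y *\<^sub>R F' h
        = u (y + h) *\<^sub>R (F (y + h) - F y - F' h) + (u (y + h) - u y) *\<^sub>R F' h"
      using F(2) by (simp add: algebra_simps)
    also have "norm \<dots> \<le> \<bar>u (y + h)\<bar> * norm (F (y + h) - F y - F' h)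
        + \<bar>u (y + h) - u y\<bar> * (norm h * C)"
      by (intro order_trans[OF norm_triangle_ineq] add_mono)
        (simp_all add: mult_left_mono C)
    finally have "norm (u (y + h) *\<^sub>R F (y + h) - u y *\<^sub>R F y - u y *\<^sub>R F' h) / norm h
        \<le> (\<bar>u (y + h)\<bar> * norm (F (y + h) - F y - F' h) + \<bar>u (y + h) - u y\<bar> * (norm h * C)) / norm h"
      by (intro divide_right_mono) simp_all
    then show ?thesis using that by (simp add: add_divide_distrib)
  qed
  then have "(\<lambda>h. norm (u (y + h) *\<^sub>R F (y + h) - u y *\<^sub>R F y - u y *\<^sub>R F' h) / norm h) \<midarrow>0\<rightarrow> 0"
    by (intro Lim_null_comparison[OF _ lim]) (auto simp: eventually_at_filter)
  moreover have "bounded_linear (\<lambda>h. u y *\<^sub>R F' h)"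
    using bl by (intro bounded_linear_const_scaleR)
  ultimately show ?thesis unfolding has_derivative_at by blast
qed

text \<open>Writing \<open>A z = id - E z\<close> with \<open>E y = 0\<close>, the equation \<open>A z (g z) = c\<close> reads
  \<open>g z = c + E z (g z)\<close>: this first bounds \<open>g\<close>, then gives continuity and differentiability at \<open>y\<close>.\<close>

lemma differentiable_solution:
  fixes A :: "'a::real_normed_vector \<Rightarrow> 'w::euclidean_space \<Rightarrow> 'w"
  assumes S: "open S" "y \<in> S" and lin: "\<And>z. z \<in> S \<Longrightarrow> linear (A z)"
    and d: "\<And>b. (\<lambda>z. A z b) differentiable (at y)" and id: "\<And>h. A y h = h"
    and sol: "\<And>z. z \<in> S \<Longrightarrow> A z (g z) = c"
  shows "g differentiable (at y)"
proof -
  define E where "E b z = b - A z b" for b z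
  have dE: "E b differentiable (at y)" for b
    unfolding E_def by (intro differentiable_diff differentiable_const d)
  have E0: "E b y = 0" for b by (simp add: E_def id)
  have g: "g z = c + (\<Sum>b\<in>Basis. (g z \<bullet> b) *\<^sub>R E b z)" if z: "z \<in> S" for z
  proof -
    have "A z (g z) = (\<Sum>b\<in>Basis. (g z \<bullet> b) *\<^sub>R A z b)"
      by (rule linear_Basis_expansion[OF lin[OF z]])
    then have "(\<Sum>b\<in>Basis. (g z \<bullet> b) *\<^sub>R E b z) = (\<Sum>b\<in>Basis. (g z \<bullet> b) *\<^sub>R b) - c"
      unfolding E_def using sol[OF z] by (simp add: scaleR_diff_right sum_subtractf)
    then show ?thesis by (simp add: euclidean_representation)
  qed
  define \<epsilon> where "\<epsilon> z = (\<Sum>b\<in>Basis. norm (E b z))" for z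
  have bound: "norm (g z - c) \<le> norm (g z) * \<epsilon> z" if "z \<in> S" for z
  proof -
    have "norm (g z - c) = norm (\<Sum>b\<in>Basis. (g z \<bullet> b) *\<^sub>R E b z)"
      by (metis g[OF that] add_diff_cancel_left')
    also have "\<dots> \<le> (\<Sum>b\<in>Basis. norm (g z) * norm (E b z))"
      by (intro sum_norm_le) (simp add: mult_right_mono Basis_le_norm)
    finally show ?thesis by (simp add: \<epsilon>_def sum_distrib_left)
  qed
  have cE: "isCont (E b) y" for b by (rule differentiable_imp_continuous_within[OF dE])
  have "(\<epsilon> \<longlongrightarrow> (\<Sum>b\<in>(Basis::'w set). norm (E b y))) (at y)"
    unfolding \<epsilon>_def by (intro tendsto_intros cE[unfolded isCont_def])
  then have \<epsilon>: "(\<epsilon> \<longlongrightarrow> 0) (at y)" by (simp add: E0)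
  have gy: "g y = c" using sol[OF S(2)] id by simp
  have ev: "\<forall>\<^sub>F z in at y. z \<in> S" using S by (simp add: eventually_at_topological) blast
  have "\<forall>\<^sub>F z in at y. \<epsilon> z < 1 / 2" using order_tendstoD(2)[OF \<epsilon>, of "1 / 2"] by simp
  then have "\<forall>\<^sub>F z in at y. norm (g z - c) \<le> 2 * norm c * \<epsilon> z"
    using ev
  proof eventually_elim
    case (elim z)
    have "\<epsilon> z \<ge> 0" by (simp add: \<epsilon>_def sum_nonneg)
    have "norm (g z) \<le> norm c + norm (g z - c)" using norm_triangle_ineq[of c "g z - c"] by simp
    also have "\<dots> \<le> norm c + norm (g z) * (1 / 2)"
      using bound[OF elim(2)] mult_left_mono[of "\<epsilon> z" "1/2" "norm (g z)"] elim(1) by simp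
    finally have "norm (g z) \<le> 2 * norm c" by simp
    then show ?case using bound[OF elim(2)] mult_right_mono[OF _ \<open>\<epsilon> z \<ge> 0\<close>] by fastforce
  qed
  moreover have "((\<lambda>z. 2 * norm c * \<epsilon> z) \<longlongrightarrow> 0) (at y)"
    using tendsto_mult_right_zero[OF \<epsilon>] by simp
  ultimately have "((\<lambda>z. g z - c) \<longlongrightarrow> 0) (at y)" by (rule Lim_null_comparison)
  then have cont: "isCont g y" using gy by (simp add: isCont_def LIM_zero_iff)
  have "(\<lambda>z. c + (\<Sum>b\<in>Basis. (g z \<bullet> b) *\<^sub>R E b z)) differentiable (at y)"
  proof (intro differentiable_add differentiable_const differentiable_sum ballI)
    fix b :: 'w
    have "isCont (\<lambda>z. g z \<bullet> b) y" using cont by (intro continuous_intros)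
    from differentiable_continuous_mult_zero[OF this dE[unfolded frechet_derivative_works] E0]
    show "(\<lambda>z. (g z \<bullet> b) *\<^sub>R E b z) differentiable (at y)" by (auto simp: differentiable_def)
  qed simp
  then obtain D where "((\<lambda>z. c + (\<Sum>b\<in>Basis. (g z \<bullet> b) *\<^sub>R E b z)) has_derivative D) (at y)"
    by (auto simp: differentiable_def)
  then have "(g has_derivative D) (at y)"
    by (rule has_derivative_transform_within_open[OF _ S]) (simp add: g[symmetric])
  then show ?thesis by (auto simp: differentiable_def)
qed

text \<open>The dual vectors are picked pointwise by choice, so their regularity has to come from
  the linear equations that determine them.\<close>

lemma dual_frame:
  fixes e :: "nat \<Rightarrow> 'e::euclidean_space \<Rightarrow> 'e \<Rightarrow> real"
  assumes S: "open S"
    and d: "\<And>y i h. y \<in> S \<Longrightarrow> i < n \<Longrightarrow> (\<lambda>z. e i z h) differentiable (at y)"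
    and lin: "\<And>y i. y \<in> S \<Longrightarrow> i < n \<Longrightarrow> linear (e i y)"
    and onto: "\<And>y v. y \<in> S \<Longrightarrow> \<exists>h. \<forall>i<n. e i y h = v i"
    and inj: "\<And>y h. y \<in> S \<Longrightarrow> (\<forall>i<n. e i y h = 0) \<Longrightarrow> h = 0"
  shows "\<exists>E. (\<forall>y\<in>S. \<forall>i<n. \<forall>j. e i y (E j y) = (if i = j then 1 else 0)) \<and>
    (\<forall>y\<in>S. \<forall>j<n. E j differentiable (at y))"
proof -
  define E where "E j y = (SOME h. \<forall>i<n. e i y h = (if i = j then 1 else 0))" for j y
  have E: "e i y (E j y) = (if i = j then 1 else 0)" if "y \<in> S" "i < n" for i j y
    using someI_ex[OF onto[OF that(1), of "\<lambda>i. if i = j then 1 else 0"]] that(2)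
    unfolding E_def by blast
  have "E j differentiable (at y)" if y: "y \<in> S" and j: "j < n" for j y
  \<comment> \<open>The operator takes the coefficients of \<open>h\<close> in the coframe at
    \<open>z\<close> and recombines them with the frame vectors at \<open>y\<close>. It is the
    identity for \<open>z = y\<close> and sends \<open>E j z\<close> to the constant
    \<open>E j y\<close>.\<close>
  proof (rule differentiable_solution[OF S y, where A = "\<lambda>z h. \<Sum>i<n. e i z h *\<^sub>R E i y" and c = "E j y"])
    show "linear (\<lambda>h. \<Sum>i<n. e i z h *\<^sub>R E i y)" if "z \<in> S" for z
      using lin[OF that]
      by (auto simp: linear_iff sum.distrib scaleR_left_distrib scaleR_sum_right intro!: sum.cong)
    show "(\<lambda>z. \<Sum>i<n. e i z b *\<^sub>R E i y) differentiable (at y)" for b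
      by (intro differentiable_sum ballI differentiable_scaleR differentiable_const d y) auto
    show "(\<Sum>i<n. e i y h *\<^sub>R E i y) = h" for h
    proof -
      have "e l y (h - (\<Sum>i<n. e i y h *\<^sub>R E i y)) = 0" if l: "l < n" for l
      proof -
        have "e l y (\<Sum>i<n. e i y h *\<^sub>R E i y) = (\<Sum>i<n. if l = i then e i y h else 0)"
          unfolding linear_sum[OF lin[OF y l]]
          by (intro sum.cong refl) (simp add: linear_cmul[OF lin[OF y l]] E[OF y l])
        then show ?thesis using l by (simp add: linear_diff[OF lin[OF y l]])
      qed
      then show ?thesis using inj[OF y, of "h - (\<Sum>i<n. e i y h *\<^sub>R E i y)"] by simp
    qed
    show "(\<Sum>i<n. e i z (E j z) *\<^sub>R E i y) = E j y" if "z \<in> S" for z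
    proof -
      have "(\<Sum>i<n. e i z (E j z) *\<^sub>R E i y) = (\<Sum>i<n. if i = j then E i y else 0)"
        by (intro sum.cong refl) (simp add: E[OF that])
      then show ?thesis using j by simp
    qed
  qed
  with E show ?thesis by blast
qed

subsection \<open>Normalisation of a transverse Frobenius system\<close>

lemma sum_lessThan_6:
  "(\<Sum>i<6. f i) = f 0 + f 1 + f 2 + f 3 + f 4 + (f (5::nat) :: 'a::comm_monoid_add)"
  by (simp add: eval_nat_numeral)

lemma sum_lessThan_4: "(\<Sum>i<4. f i) = f 0 + f 1 + f 2 + (f (3::nat) :: 'a::comm_monoid_add)"
  by (simp add: eval_nat_numeral)

context embedding_coframe
begin

definition theta_forms :: "('e, complex) form1 list" where
  "theta_forms = [\<lambda>y h. of_real (e 5 y h), \<lambda>y h. of_real (e 3 y h - e 0 y h),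
     \<lambda>y h. of_real (e 4 y h - e 1 y h), \<lambda>y h. of_real (e 6 y h - e 2 y h)]"

definition singular_forms :: "('e, complex) form1 list" where
  "singular_forms = theta_forms @
     [\<lambda>y h. of_real (e 7 y h) - \<i> * of_real (k y * e 1 y h),
      \<lambda>y h. of_real (e 8 y h) + \<i> * of_real (k y * e 0 y h)]"

text \<open>Modulo the \<theta>_j the singular system has rank 2, and transversality makes the
  projection of the Frobenius bundle to this quotient injective. The bundle therefore has rank 2 and
  a unique basis that projects to the two additional forms; Cramer's rule produces it.\<close>

lemma transverse_frobenius_imp_frobenius_pair:
  assumes inj: "\<And>y h. y \<in> S \<Longrightarrow> (\<forall>i<9. e i y h = 0) \<Longrightarrow> h = 0"
    and F: "has_transverse_frobenius S singular_forms theta_forms"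
  shows "\<exists>a b A B. frobenius_pair S e k p1 p2 H11 H12 H22 a b A B (\<lambda>y. \<i> * of_real (k y))"
proof -
  have "\<exists>E. (\<forall>y\<in>S. \<forall>i<9. \<forall>j. e i y (E j y) = (if i = j then 1 else 0)) \<and>
    (\<forall>y\<in>S. \<forall>j<9. E j differentiable (at y))"
    by (rule dual_frame[OF open_S]) (simp_all add: differentiable_e linear_e onto inj)
  then obtain E where E: "\<And>y i j. y \<in> S \<Longrightarrow> i < 9 \<Longrightarrow> e i y (E j y) = (if i = j then 1 else 0)"
    and dE: "\<And>y j. y \<in> S \<Longrightarrow> j < 9 \<Longrightarrow> E j differentiable (at y)"
    by blast
  obtain \<alpha>s where fr: "frobenius_frame S \<alpha>s" and len: "length \<alpha>s \<ge> 2"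
    and sp: "\<And>y \<alpha>. y \<in> S \<Longrightarrow> \<alpha> \<in> set \<alpha>s \<Longrightarrow> in_span_at singular_forms y (\<alpha> y)"
    and tr: "\<And>y \<phi> h. y \<in> S \<Longrightarrow> in_span_at \<alpha>s y \<phi> \<Longrightarrow> in_span_at theta_forms y \<phi> \<Longrightarrow> \<phi> h = 0"
    using F unfolding has_transverse_frobenius_def by blast
  \<comment> \<open>These vectors are dual to \<theta>_0, \<theta>_1, \<theta>_2, \<theta>_3 and the
    two additional forms, in the order of \<open>singular_forms\<close>, so \<open>c m l\<close> is
    the coefficient of the \<open>m\<close>-th generator at the \<open>l\<close>-th form.\<close>
  define D where "D l = E ([5, 3, 4, 6, 7, 8] ! l)" for l :: nat
  define c where "c m l y = (\<alpha>s ! m) y (D l y)" for m l y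
  let ?s = "singular_forms" and ?t = "theta_forms"
  have len_st: "length ?s = 6" "length ?t = 4" by (simp_all add: singular_forms_def theta_forms_def)
  have span: "(\<alpha>s ! m) y h = (\<Sum>l<6. c m l y * (?s ! l) y h)" if y: "y \<in> S" and m: "m < length \<alpha>s" for m y h
  proof -
    obtain b where b: "\<And>h. (\<alpha>s ! m) y h = (\<Sum>l<6. b l * (?s ! l) y h)"
      using sp[OF y nth_mem[OF m]]
      unfolding in_span_at_def len_st by blast
    have "c m l y = b l" if "l < 6" for l
    proof -
      have "l \<in> {0, 1, 2, 3, 4, 5}" using that by auto
      then show ?thesis unfolding c_def b sum_lessThan_6
        by (elim insertE) (simp_all add: singular_forms_def theta_forms_def D_def E[OF y])
    qed
    then show ?thesis unfolding b by simp
  qed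
  have smooth: "smooth_form1 S (\<alpha>s ! m)" if "m < length \<alpha>s" for m
    using fr nth_mem[OF that] unfolding frobenius_frame_def by blast
  have dc: "c m l differentiable (at y)" if y: "y \<in> S" and m: "m < length \<alpha>s" and l: "l < 6" for m l y
  proof -
    have "[5, 3, 4, 6, 7, 8] ! l < (9::nat)"
      using l by (auto simp: less_Suc_eq eval_nat_numeral)
    then have dD: "D l differentiable (at y)" unfolding D_def by (rule dE[OF y])
    have "(\<lambda>z. \<Sum>b\<in>Basis. (D l z \<bullet> b) *\<^sub>R (\<alpha>s ! m) z b) differentiable (at y)"
      using smooth[OF m] dD y
      by (intro differentiable_sum ballI differentiable_scaleR differentiable_inner differentiable_const)
        (auto simp: smooth_form1_def intro: smooth_on_differentiable)
    then obtain d where "((\<lambda>z. \<Sum>b\<in>Basis. (D l z \<bullet> b) *\<^sub>R (\<alpha>s ! m) z b) has_derivative d) (at y)"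
      by (auto simp: differentiable_def)
    moreover have "(\<Sum>b\<in>Basis. (D l z \<bullet> b) *\<^sub>R (\<alpha>s ! m) z b) = c m l z" if "z \<in> S" for z
      unfolding c_def by (rule linear_Basis_expansion[symmetric])
        (use smooth[OF m] that in \<open>simp add: smooth_form1_def\<close>)
    ultimately have "(c m l has_derivative d) (at y)"
      by (rule has_derivative_transform_within_open[OF _ open_S y])
    then show ?thesis by (auto simp: differentiable_def)
  qed
  \<comment> \<open>A combination without components along the last two singular forms lies in the
    span of the \<theta>_j and vanishes by transversality; independence of the generators then
    applies.\<close>
  have indep: "\<forall>i<length \<alpha>s. b i = 0"
    if y: "y \<in> S" and b: "(\<Sum>m<length \<alpha>s. b m * c m 4 y) = 0" "(\<Sum>m<length \<alpha>s. b m * c m 5 y) = 0" for y b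
  proof -
    define \<phi> where "\<phi> h = (\<Sum>m<length \<alpha>s. b m * (\<alpha>s ! m) y h)" for h
    have "\<phi> h = (\<Sum>m<length \<alpha>s. \<Sum>l<6. b m * c m l y * (?s ! l) y h)" for h
      unfolding \<phi>_def by (intro sum.cong refl) (simp add: span[OF y] sum_distrib_left mult.assoc)
    also have "\<dots> h = (\<Sum>l<6. (\<Sum>m<length \<alpha>s. b m * c m l y) * (?s ! l) y h)" for h
      by (subst sum.swap) (simp add: sum_distrib_right)
    finally have "\<phi> h = (\<Sum>l<4. (\<Sum>m<length \<alpha>s. b m * c m l y) * (?t ! l) y h)" for h
      unfolding sum_lessThan_6 sum_lessThan_4 b by (simp add: singular_forms_def theta_forms_def)
    then have "in_span_at ?t y \<phi>"
      unfolding in_span_at_def len_st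
      by (intro exI[of _ "\<lambda>l. \<Sum>m<length \<alpha>s. b m * c m l y"] allI)
    moreover have "in_span_at \<alpha>s y \<phi>" unfolding in_span_at_def \<phi>_def by blast
    ultimately have "\<forall>h. (\<Sum>i<length \<alpha>s. b i * (\<alpha>s ! i) y h) = 0" using tr[OF y] unfolding \<phi>_def by blast
    then show ?thesis
      using fr y unfolding frobenius_frame_def independent_at_def by blast
  qed
  define \<Delta> where "\<Delta> y = c 0 4 y * c 1 5 y - c 0 5 y * c 1 4 y" for y
  have sum2: "(\<Sum>m<length \<alpha>s. (if m = 0 then s else if m = 1 then t else 0) * f m) = s * f 0 + t * f (1::nat)"
    for s t and f :: "nat \<Rightarrow> complex"
  proof -
    have "(\<Sum>m<length \<alpha>s. (if m = 0 then s else if m = 1 then t else 0) * f m)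
        = (\<Sum>m\<in>{0, 1}. (if m = 0 then s else if m = 1 then t else 0) * f m)"
      by (rule sum.mono_neutral_right) (use len in auto)
    then show ?thesis by simp
  qed
  have indep2: "s = 0 \<and> t = 0" if "y \<in> S" "s * c 0 4 y + t * c 1 4 y = 0" "s * c 0 5 y + t * c 1 5 y = 0" for y s t
    using indep[OF that(1), of "\<lambda>m. if m = 0 then s else if m = 1 then t else 0"] that(2,3) len
    unfolding sum2 by (metis One_nat_def less_2_cases_iff order_less_le_trans zero_neq_one)
  have \<Delta>: "\<Delta> y \<noteq> 0" if y: "y \<in> S" for y
  proof
    assume "\<Delta> y = 0"
    then have z: "c 0 4 y * c 1 5 y = c 0 5 y * c 1 4 y" by (simp add: \<Delta>_def)
    \<comment> \<open>With zero determinant, both \<open>(c 1 4, - c 0 4)\<close> and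
      \<open>(c 1 5, - c 0 5)\<close> are relations between the first two generators. So all four
      entries vanish, and then \<open>(1, 0)\<close> is a relation as well.\<close>
    have "c 1 4 y = 0 \<and> - c 0 4 y = 0" by (rule indep2[OF y]) (use z in \<open>simp_all add: algebra_simps\<close>)
    moreover have "c 1 5 y = 0 \<and> - c 0 5 y = 0" by (rule indep2[OF y]) (use z in \<open>simp_all add: algebra_simps\<close>)
    ultimately have "(1::complex) = 0 \<and> (0::complex) = 0" by (intro indep2[OF y]) auto
    then show False by simp
  qed
  have len2: "length \<alpha>s = 2" if y: "y \<in> S" for y
  proof (rule ccontr)
    assume "length \<alpha>s \<noteq> 2"
    then have l: "length \<alpha>s > 2" using len by simp
    \<comment> \<open>The cross product of the columns 4 and 5 of three generators: a relation
      between them whose third entry is the nonzero determinant.\<close>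
    define s where "s = (c 1 4 y * c 2 5 y - c 1 5 y * c 2 4 y)"
    define t where "t = (c 0 5 y * c 2 4 y - c 0 4 y * c 2 5 y)"
    define b where "b m = (if m = 0 then s else if m = 1 then t else if m = 2 then \<Delta> y else 0)" for m :: nat
    have sum3: "(\<Sum>m<length \<alpha>s. b m * f m) = s * f 0 + t * f 1 + \<Delta> y * f 2" for f
    proof -
      have "(\<Sum>m<length \<alpha>s. b m * f m) = (\<Sum>m\<in>{0, 1, 2}. b m * f m)"
        by (rule sum.mono_neutral_right) (use l in \<open>auto simp: b_def\<close>)
      then show ?thesis by (simp add: b_def)
    qed
    have "\<forall>i<length \<alpha>s. b i = 0"
      by (rule indep[OF y]) (simp_all add: sum3 s_def t_def \<Delta>_def algebra_simps)
    then have "b 2 = 0" using l by blast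
    then show False using \<Delta>[OF y] by (simp add: b_def)
  qed
  \<comment> \<open>\<open>gA\<close> and \<open>gB\<close> are the entries of the inverse of the 2
    by 2 matrix formed by the coefficients \<open>c m 4\<close> and \<open>c m 5\<close>.\<close>
  define gA where "gA m y = (if m = 0 then c 1 5 y else - c 0 5 y) / \<Delta> y" for m :: nat and y
  define gB where "gB m y = (if m = 0 then - c 1 4 y else c 0 4 y) / \<Delta> y" for m :: nat and y
  define A where "A y h = (\<Sum>m<2. gA m y * (\<alpha>s ! m) y h)" for y h
  define B where "B y h = (\<Sum>m<2. gB m y * (\<alpha>s ! m) y h)" for y h
  define a where "a j y = (c 1 5 y * c 0 j y - c 0 5 y * c 1 j y) / \<Delta> y" for j y
  define b where "b j y = (c 0 4 y * c 1 j y - c 1 4 y * c 0 j y) / \<Delta> y" for j y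
  have l01: "0 < length \<alpha>s" "1 < length \<alpha>s" using len by linarith+
  have d\<Delta>: "\<Delta> differentiable (at y)" if "y \<in> S" for y
    unfolding \<Delta>_def by (intro differentiable_diff differentiable_mult dc that l01) simp_all
  have dgA: "gA m differentiable (at y)" if y: "y \<in> S" for m y
    unfolding gA_def
    by (cases "m = 0") (auto intro!: differentiable_divide differentiable_minus dc d\<Delta> \<Delta> y l01 simp del: One_nat_def)
  have dgB: "gB m differentiable (at y)" if y: "y \<in> S" for m y
    unfolding gB_def
    by (cases "m = 0") (auto intro!: differentiable_divide differentiable_minus dc d\<Delta> \<Delta> y l01 simp del: One_nat_def)
  have A_c: "A y h = (\<Sum>l<4. a l y * (?t ! l) y h) + (of_real (e 7 y h) - \<i> * of_real (k y * e 1 y h))"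
    and B_c: "B y h = (\<Sum>l<4. b l y * (?t ! l) y h) + (of_real (e 8 y h) + \<i> * of_real (k y * e 0 y h))"
    if y: "y \<in> S" for y h
  proof -
    have two: "(\<Sum>m<2. f m) = f 0 + f (1::nat)" for f :: "nat \<Rightarrow> complex" by (simp add: eval_nat_numeral)
    have st: "?s ! 0 = ?t ! 0" "?s ! 1 = ?t ! 1" "?s ! 2 = ?t ! 2" "?s ! 3 = ?t ! 3"
      "?s ! 4 = (\<lambda>y h. of_real (e 7 y h) - \<i> * of_real (k y * e 1 y h))"
      "?s ! 5 = (\<lambda>y h. of_real (e 8 y h) + \<i> * of_real (k y * e 0 y h))"
      by (simp_all add: singular_forms_def theta_forms_def)
    have one: "(c 1 5 y * c 0 4 y - c 0 5 y * c 1 4 y) / \<Delta> y = 1" "(c 0 4 y * c 1 5 y - c 1 4 y * c 0 5 y) / \<Delta> y = 1"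
      using \<Delta>[OF y] by (simp_all add: \<Delta>_def algebra_simps)
    let ?x = "of_real (e 7 y h) - \<i> * of_real (k y * e 1 y h) :: complex"
    let ?z = "of_real (e 8 y h) + \<i> * of_real (k y * e 0 y h) :: complex"
    have "A y h = (\<Sum>l<4. a l y * (?t ! l) y h) + (c 1 5 y * c 0 4 y - c 0 5 y * c 1 4 y) / \<Delta> y * ?x"
      unfolding A_def two span[OF y l01(1)] span[OF y l01(2)] sum_lessThan_6 sum_lessThan_4 gA_def a_def st
      by (simp add: add_divide_distrib diff_divide_distrib algebra_simps)
    then show "A y h = (\<Sum>l<4. a l y * (?t ! l) y h) + ?x" unfolding one by simp
    have "B y h = (\<Sum>l<4. b l y * (?t ! l) y h) + (c 0 4 y * c 1 5 y - c 1 4 y * c 0 5 y) / \<Delta> y * ?z"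
      unfolding B_def two span[OF y l01(1)] span[OF y l01(2)] sum_lessThan_6 sum_lessThan_4 gB_def b_def st
      by (simp add: add_divide_distrib diff_divide_distrib algebra_simps)
    then show "B y h = (\<Sum>l<4. b l y * (?t ! l) y h) + ?z" unfolding one by simp
  qed
  have \<alpha>_AB: "(\<alpha>s ! 0) y h = c 0 4 y * A y h + c 0 5 y * B y h" "(\<alpha>s ! 1) y h = c 1 4 y * A y h + c 1 5 y * B y h"
    if y: "y \<in> S" for y h
  proof -
    have two: "(\<Sum>m<2. f m) = f 0 + f (1::nat)" for f :: "nat \<Rightarrow> complex" by (simp add: eval_nat_numeral)
    have "\<Delta> y * (\<alpha>s ! 0) y h = \<Delta> y * (c 0 4 y * A y h + c 0 5 y * B y h)"
      "\<Delta> y * (\<alpha>s ! 1) y h = \<Delta> y * (c 1 4 y * A y h + c 1 5 y * B y h)"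
      unfolding A_def B_def two gA_def gB_def using \<Delta>[OF y]
      by (simp_all add: field_simps) (simp_all add: \<Delta>_def algebra_simps)
    then show "(\<alpha>s ! 0) y h = c 0 4 y * A y h + c 0 5 y * B y h"
      "(\<alpha>s ! 1) y h = c 1 4 y * A y h + c 1 5 y * B y h" using \<Delta>[OF y] by simp_all
  qed
  \<comment> \<open>By Leibniz and the Frobenius condition, every term of the differential contains
    a generator as a factor, and all generators vanish on the common kernel of \<open>A\<close> and
    \<open>B\<close>.\<close>
  have closed: "cext2 (ext_d C y) H L = 0"
    if y: "y \<in> S" and ann: "cext1 (A y) H = 0" "cext1 (B y) H = 0" "cext1 (A y) L = 0" "cext1 (B y) L = 0"
      and C: "\<And>z h. C z h = (\<Sum>m<2. g m z * (\<alpha>s ! m) z h)"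
      and g: "\<And>m. g m differentiable (at y)" for C g y H L
  proof -
    have l2: "length \<alpha>s = 2" by (rule len2[OF y])
    have z: "cext1 ((\<alpha>s ! m) y) G = 0" if "m < 2" "cext1 (A y) G = 0" "cext1 (B y) G = 0" for m G
    proof -
      have "m = 0 \<or> m = 1" using that(1) by auto
      moreover have "(\<alpha>s ! 0) y = (\<lambda>h. c 0 4 y * A y h + c 0 5 y * B y h)"
        "(\<alpha>s ! 1) y = (\<lambda>h. c 1 4 y * A y h + c 1 5 y * B y h)" using \<alpha>_AB[OF y] by blast+
      ultimately show ?thesis using that(2,3) by (auto simp: cext1_simps)
    qed
    have d0: "cext2 (ext_d (\<alpha>s ! m) y) H L = 0" if m: "m < 2" for m
    proof -
      have "\<alpha>s ! m \<in> set \<alpha>s" using m l2 by simp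
      then obtain \<beta> where "\<And>h k. ext_d (\<alpha>s ! m) y h k = (\<Sum>j<length \<alpha>s. wedge (\<beta> j) ((\<alpha>s ! j) y) h k)"
        using fr y unfolding frobenius_frame_def by meson
      then have "ext_d (\<alpha>s ! m) y = (\<lambda>h k. \<Sum>j<2. wedge (\<beta> j) ((\<alpha>s ! j) y) h k)" using l2 by auto
      then show ?thesis by (simp add: cext2_sum cext2_wedge) (simp add: wedge_def z ann)
    qed
    have d\<alpha>: "(\<lambda>z. (\<alpha>s ! m) z h) differentiable (at y)" if "m < 2" for m h
      using smooth[of m] l2 that unfolding smooth_form1_def
      by (intro smooth_on_differentiable[OF _ y]) auto
    have "ext_d C y = (\<lambda>h l. \<Sum>m<2. wedge (frechet_derivative (g m) (at y)) ((\<alpha>s ! m) y) h l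
        + g m y * ext_d (\<alpha>s ! m) y h l)"
      by (intro ext ext_d_combination[OF open_S y C])
        (use g[unfolded frechet_derivative_works] d\<alpha> in auto)
    then show ?thesis
      by (simp add: cext2_sum cext2_add cext2_scale cext2_wedge d0) (simp add: wedge_def z ann)
  qed
  have "frobenius_pair S e k p1 p2 H11 H12 H22 a b A B (\<lambda>y. \<i> * of_real (k y))"
  proof (unfold_locales)
    show "A y h = (\<Sum>i<9. [- a 1 y, - (\<i> * of_real (k y)) - a 2 y, - a 3 y,
      a 1 y, a 2 y, a 0 y, a 3 y, 1, 0] ! i * of_real (e i y h))" if "y \<in> S" for y h
      unfolding A_c[OF that] sum_lessThan_9 sum_lessThan_4
      by (simp add: theta_forms_def algebra_simps del: One_nat_def)
    show "B y h = (\<Sum>i<9. [\<i> * of_real (k y) - b 1 y, - b 2 y, - b 3 y,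
      b 1 y, b 2 y, b 0 y, b 3 y, 0, 1] ! i * of_real (e i y h))" if "y \<in> S" for y h
      unfolding B_c[OF that] sum_lessThan_9 sum_lessThan_4
      by (simp add: theta_forms_def algebra_simps del: One_nat_def)
    show "a j differentiable (at y)" "b j differentiable (at y)" if "y \<in> S" "j < 4" for y j
      unfolding a_def b_def
      by (intro differentiable_divide differentiable_diff differentiable_mult dc d\<Delta> \<Delta> l01 that(1);
          use that(2) in simp)+
    show "cext2 (ext_d A y) H L = 0" "cext2 (ext_d B y) H L = 0"
      if "y \<in> S" "cext1 (A y) H = 0" "cext1 (B y) H = 0" "cext1 (A y) L = 0" "cext1 (B y) L = 0" for y H L
      using closed[OF that A_def dgA[OF that(1)]] closed[OF that B_def dgB[OF that(1)]] by auto
  qed simp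
  then show ?thesis by blast
qed

end

subsection \<open>Covariant derivatives of moving frames\<close>

lemma ip_simps:
  "ip A (h + h') l = ip A h l + ip A h' l" "ip A h (l + l') = ip A h l + ip A h l'"
  "ip A (h - h') l = ip A h l - ip A h' l" "ip A h (l - l') = ip A h l - ip A h l'"
  "ip A (c *\<^sub>R h) l = c * ip A h l" "ip A h (c *\<^sub>R l) = c * ip A h l"
  "ip A (- h) l = - ip A h l" "ip A h (- l) = - ip A h l"
  "ip A 0 l = 0" "ip A h 0 = 0"
  "ip (A + B) h l = ip A h l + ip B h l" "ip (c *\<^sub>R A) h l = c * ip A h l"
  unfolding ip_def
  by (simp_all add: inner_left_distrib inner_right_distrib matrix_vector_right_distrib
      inner_diff_left inner_diff_right matrix_vector_mult_diff_distrib matrix_vector_mult_scaleR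
      matrix_vector_mult_add_rdistrib scaleR_matrix_vector_assoc[symmetric] vec.neg)

lemma ip_commute: "transpose A = A \<Longrightarrow> ip A h l = ip A l h"
  unfolding ip_def by (metis dot_lmul_matrix inner_commute vector_transpose_matrix)

text \<open>Inner products with \<open>v1\<close> and \<open>v2\<close> recover the coordinates, so
  the map from coordinates to vectors is injective, and by dimension surjective.\<close>

lemma orthonormal_frame_expansion:
  assumes A: "transpose A = A" and f: "orthonormal_frame A v1 v2"
  shows "w = ip A w v1 *\<^sub>R v1 - ip A w v2 *\<^sub>R v2"
proof -
  define T :: "real^2 \<Rightarrow> real^2" where "T z = (z $ 1) *\<^sub>R v1 + (z $ 2) *\<^sub>R v2" for z
  have f': "ip A v1 v1 = 1" "ip A v2 v2 = - 1" "ip A v1 v2 = 0" "ip A v2 v1 = 0"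
    using f ip_commute[OF A, of v2 v1] by (auto simp: orthonormal_frame_def)
  have T: "ip A (T z) v1 = z $ 1" "ip A (T z) v2 = - z $ 2" for z
    by (simp_all add: T_def ip_simps f')
  have lin: "linear T" by (auto simp: linear_iff T_def algebra_simps)
  have "inj T"
  proof (rule injI)
    fix z z' assume "T z = T z'"
    then have "z $ 1 = z' $ 1" "z $ 2 = z' $ 2" using T[of z] T[of z'] by simp_all
    then show "z = z'" by (simp add: vec_eq_iff forall_2)
  qed
  then have "surj T" using lin linear_injective_imp_surjective by blast
  then obtain z where "w = T z" by blast
  then show ?thesis using T[of z] by (simp add: T_def)
qed

lemma has_derivative_ip:
  assumes "(A has_derivative A') (at y)" "(u has_derivative u') (at y)" "(v has_derivative v') (at y)"
  shows "((\<lambda>z. ip (A z) (u z) (v z)) has_derivative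
    (\<lambda>h. ip (A' h) (u y) (v y) + ip (A y) (u' h) (v y) + ip (A y) (u y) (v' h))) (at y)"
  unfolding ip_def
  by (rule has_derivative_eq_rhs[OF has_derivative_inner[OF assms(2)
        bounded_bilinear.FDERIV[OF bounded_bilinear_matrix_vector_mult assms(1,3)]]])
    (auto simp: algebra_simps)

lemma smooth_on_ip:
  assumes "open S" "smooth_on S A" "smooth_on S u" "smooth_on S v"
  shows "smooth_on S (\<lambda>z. ip (A z) (u z) (v z))"
  unfolding ip_def by (intro smooth_on_inner smooth_on_matrix_vector_mult assms)

text \<open>Christoffel symbols of the first kind as a trilinear form: the covariant derivative of
  the constant field \<open>k\<close> along \<open>h\<close>, paired with \<open>l\<close>.\<close>

definition christoffel :: "(real^2 \<Rightarrow> real^2^2) \<Rightarrow> real^2 \<Rightarrow> real^2 \<Rightarrow> real^2 \<Rightarrow> real^2 \<Rightarrow> real" where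
  "christoffel G x h k l =
     (let G' = frechet_derivative G (at x) in (ip (G' h) k l + ip (G' k) h l - ip (G' l) h k) / 2)"

text \<open>In \<open>conn_vec\<close> and \<open>hess\<close> the vectors \<open>v1, v2\<close> are an arbitrary orthonormal frame, which only
  serves to raise an index.\<close>

definition conn_vec :: "(real^2 \<Rightarrow> real^2^2) \<Rightarrow> real^2 \<Rightarrow> real^2 \<Rightarrow> real^2 \<Rightarrow> real^2 \<Rightarrow> real^2 \<Rightarrow> real^2" where
  "conn_vec G x v1 v2 h k = christoffel G x h k v1 *\<^sub>R v1 - christoffel G x h k v2 *\<^sub>R v2"

definition second_derivative :: "(real^2 \<Rightarrow> real) \<Rightarrow> real^2 \<Rightarrow> real^2 \<Rightarrow> real^2 \<Rightarrow> real" where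
  "second_derivative f x h k = frechet_derivative (\<lambda>z. frechet_derivative f (at z) k) (at x) h"

definition hess :: "(real^2 \<Rightarrow> real^2^2) \<Rightarrow> (real^2 \<Rightarrow> real) \<Rightarrow> real^2 \<Rightarrow> real^2 \<Rightarrow> real^2 \<Rightarrow> real^2 \<Rightarrow> real^2 \<Rightarrow> real" where
  "hess G f x v1 v2 h k = second_derivative f x h k - frechet_derivative f (at x) (conn_vec G x v1 v2 h k)"

section \<open>Levi-Civita connection and Hessian in a coordinate domain\<close>

locale metric_domain =
  fixes D :: "(real^2) set" and G :: "real^2 \<Rightarrow> real^2^2"
  assumes open_D: "open D" and smooth_G: "smooth_on D G"
    and symmetric_G: "\<And>x. x \<in> D \<Longrightarrow> transpose (G x) = G x"
begin

lemma linear_G': "x \<in> D \<Longrightarrow> linear (frechet_derivative G (at x))"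
  by (rule smooth_on_linear_derivative[OF smooth_G])

lemma has_derivative_G: "x \<in> D \<Longrightarrow> (G has_derivative frechet_derivative G (at x)) (at x)"
  by (rule smooth_on_has_derivative[OF smooth_G])

lemma ip_G_commute: "x \<in> D \<Longrightarrow> ip (G x) h l = ip (G x) l h"
  by (rule ip_commute[OF symmetric_G])

lemma ip_G'_commute:
  assumes x: "x \<in> D"
  shows "ip (frechet_derivative G (at x) d) h l = ip (frechet_derivative G (at x) d) l h"
proof -
  let ?G = "frechet_derivative G (at x)"
  have d: "((\<lambda>z. ip (G z) h l) has_derivative (\<lambda>d. ip (?G d) h l)) (at x)" for h l
    using has_derivative_ip[OF has_derivative_G[OF x] has_derivative_const[of h]
        has_derivative_const[of l]] by (simp add: ip_simps)
  have "((\<lambda>z. ip (G z) h l) has_derivative (\<lambda>d. ip (?G d) l h)) (at x)"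
    by (rule has_derivative_transform_within_open[OF d[of l h] open_D x]) (rule ip_G_commute)
  with d[of h l] have "(\<lambda>d. ip (?G d) h l) = (\<lambda>d. ip (?G d) l h)" by (rule has_derivative_unique)
  then show ?thesis by meson
qed

lemma christoffel_linear:
  assumes "x \<in> D"
  shows "linear (christoffel G x h k)" "linear (\<lambda>h. christoffel G x h k l)"
    "linear (\<lambda>k. christoffel G x h k l)"
  unfolding christoffel_def Let_def linear_iff
  by (simp_all add: linear_add[OF linear_G'[OF assms]] linear_cmul[OF linear_G'[OF assms]] ip_simps
      algebra_simps add_divide_distrib diff_divide_distrib)

lemma christoffel_commute: "x \<in> D \<Longrightarrow> christoffel G x h k l = christoffel G x k h l"
  unfolding christoffel_def Let_def using ip_G'_commute[of x l h k] by simp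

lemma ip_conn_vec:
  assumes x: "x \<in> D" and f: "orthonormal_frame (G x) v1 v2"
  shows "ip (G x) (conn_vec G x v1 v2 h k) l = christoffel G x h k l"
proof -
  let ?c = "christoffel G x h k"
  have "?c l = ?c (ip (G x) l v1 *\<^sub>R v1 - ip (G x) l v2 *\<^sub>R v2)"
    using orthonormal_frame_expansion[OF symmetric_G[OF x] f, of l] by simp
  also have "\<dots> = ip (G x) (conn_vec G x v1 v2 h k) l"
    using christoffel_linear(1)[OF x, of h k] ip_G_commute[OF x, of l]
    by (simp add: conn_vec_def ip_simps linear_diff linear_cmul ip_G_commute[OF x, of _ l])
  finally show ?thesis ..
qed

text \<open>By \<open>ip_conn_vec\<close> the pairing with any vector is a Christoffel symbol, which
  mentions no frame. The Hessian can thus be computed in a boosted frame.\<close>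

lemma conn_vec_frame_independent:
  assumes x: "x \<in> D" and f: "orthonormal_frame (G x) v1 v2" "orthonormal_frame (G x) w1 w2"
  shows "conn_vec G x v1 v2 h k = conn_vec G x w1 w2 h k"
  using orthonormal_frame_expansion[OF symmetric_G[OF x] f(2), of "conn_vec G x v1 v2 h k"]
  unfolding ip_conn_vec[OF x f(1)] conn_vec_def[of G x w1 w2 h k] .

lemma hess_frame_independent:
  assumes "x \<in> D" "orthonormal_frame (G x) v1 v2" "orthonormal_frame (G x) w1 w2"
  shows "hess G f x v1 v2 h k = hess G f x w1 w2 h k"
  unfolding hess_def conn_vec_frame_independent[OF assms] ..

lemma conn_vec_linear:
  assumes x: "x \<in> D"
  shows "linear (\<lambda>h. conn_vec G x v1 v2 h k)" "linear (\<lambda>k. conn_vec G x v1 v2 h k)"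
  using christoffel_linear(2,3)[OF x]
  by (auto simp: linear_iff conn_vec_def algebra_simps)

lemma conn_vec_commute: "x \<in> D \<Longrightarrow> conn_vec G x v1 v2 h k = conn_vec G x v1 v2 k h"
  using christoffel_commute[of x h k] by (simp add: conn_vec_def)

lemma second_derivative_linear:
  assumes f: "smooth_on D f" and x: "x \<in> D"
  shows "linear (\<lambda>h. second_derivative f x h k)" "second_derivative f x h k = second_derivative f x k h"
    "linear (second_derivative f x h)"
proof -
  show *: "linear (\<lambda>h. second_derivative f x h k)" for k
    unfolding second_derivative_def
    by (rule smooth_on_linear_derivative[OF smooth_on_derivative[OF f] x])
  show **: "second_derivative f x h k = second_derivative f x k h" for h k
    unfolding second_derivative_def by (rule second_derivative_symmetric[OF open_D f x])
  have "second_derivative f x h = (\<lambda>k. second_derivative f x k h)" using ** by blast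
  then show "linear (second_derivative f x h)" using * by simp
qed

lemma hess_linear:
  assumes f: "smooth_on D f" and x: "x \<in> D"
  shows "linear (\<lambda>h. hess G f x v1 v2 h k)" "linear (\<lambda>k. hess G f x v1 v2 h k)"
    "hess G f x v1 v2 h k = hess G f x v1 v2 k h"
  using second_derivative_linear[OF f x] conn_vec_linear[OF x, of v1 v2] conn_vec_commute[OF x]
    smooth_on_linear_derivative[OF f x]
  by (auto simp: linear_iff hess_def algebra_simps)

end

text \<open>The base point \<open>x\<close> is a map from an arbitrary space, so that one calculus
  covers both parametrizations of the product of the frame bundles and local sections over the
  surface, for which \<open>x\<close> is the identity.\<close>

locale moving_frame = metric_domain D G for D G +
  fixes U :: "'e::euclidean_space set" and x v1 v2 :: "'e \<Rightarrow> real^2"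
  assumes open_U: "open U" and smooth_x: "smooth_on U x" and smooth_v: "smooth_on U v1" "smooth_on U v2"
    and x_in_D: "\<And>y. y \<in> U \<Longrightarrow> x y \<in> D"
    and frame: "\<And>y. y \<in> U \<Longrightarrow> orthonormal_frame (G (x y)) (v1 y) (v2 y)"
begin

definition \<eta>1 :: "('e, real) form1" where
  "\<eta>1 y h = ip (G (x y)) (frechet_derivative x (at y) h) (v1 y)"

definition \<eta>2 :: "('e, real) form1" where
  "\<eta>2 y h = - ip (G (x y)) (frechet_derivative x (at y) h) (v2 y)"

definition nabla :: "('e \<Rightarrow> real^2) \<Rightarrow> 'e \<Rightarrow> 'e \<Rightarrow> real^2" where
  "nabla w y h = frechet_derivative w (at y) h
     + conn_vec G (x y) (v1 y) (v2 y) (frechet_derivative x (at y) h) (w y)"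

text \<open>The sign accounts for \<open>v2\<close> having square -1: this is the coefficient of
  \<open>v2\<close> in the covariant derivative of \<open>v1\<close>, that is, the form \<eta>12 of
  the Levi-Civita connection.\<close>

definition conn_form :: "('e, real) form1" where
  "conn_form y h = - ip (G (x y)) (nabla v1 y h) (v2 y)"

lemma derivative_x: "y \<in> U \<Longrightarrow> (x has_derivative frechet_derivative x (at y)) (at y)"
  by (rule smooth_on_has_derivative[OF smooth_x])

lemma has_derivative_Gx:
  assumes "y \<in> U"
  shows "((\<lambda>z. G (x z)) has_derivative
     (\<lambda>h. frechet_derivative G (at (x y)) (frechet_derivative x (at y) h))) (at y)"
  by (rule has_derivative_compose[OF derivative_x[OF assms] has_derivative_G[OF x_in_D[OF assms]]])

lemma derivative_x_expansion:
  assumes "y \<in> U"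
  shows "frechet_derivative x (at y) h = \<eta>1 y h *\<^sub>R v1 y + \<eta>2 y h *\<^sub>R v2 y"
  using orthonormal_frame_expansion[OF symmetric_G[OF x_in_D[OF assms]] frame[OF assms],
      of "frechet_derivative x (at y) h"]
  by (simp add: \<eta>1_def \<eta>2_def)

lemma frame_ip:
  assumes "y \<in> U"
  shows "ip (G (x y)) (v1 y) (v1 y) = 1" "ip (G (x y)) (v2 y) (v2 y) = - 1"
    "ip (G (x y)) (v1 y) (v2 y) = 0" "ip (G (x y)) (v2 y) (v1 y) = 0"
  using frame[OF assms] ip_G_commute[OF x_in_D[OF assms], of "v2 y" "v1 y"]
  by (auto simp: orthonormal_frame_def)

text \<open>Metric compatibility: symmetrising \<open>christoffel\<close> in its last two arguments
  gives the derivative of \<open>G\<close>.\<close>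

lemma ip_nabla:
  assumes y: "y \<in> U" and u: "smooth_on U u" and w: "smooth_on U w"
    and c: "\<And>z. z \<in> U \<Longrightarrow> ip (G (x z)) (u z) (w z) = c"
  shows "ip (G (x y)) (nabla u y h) (w y) + ip (G (x y)) (u y) (nabla w y h) = 0"
proof -
  let ?d = "frechet_derivative x (at y) h" and ?G' = "frechet_derivative G (at (x y))"
  have xD: "x y \<in> D" by (rule x_in_D[OF y])
  have "((\<lambda>z. ip (G (x z)) (u z) (w z)) has_derivative (\<lambda>h. 0)) (at y)"
    by (rule has_derivative_transform_within_open[OF has_derivative_const open_U y]) (simp add: c)
  from fun_cong[OF has_derivative_unique[OF this has_derivative_ip[OF has_derivative_Gx[OF y]
      smooth_on_has_derivative[OF u y] smooth_on_has_derivative[OF w y]]], of h]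
  have "ip (?G' ?d) (u y) (w y) + ip (G (x y)) (frechet_derivative u (at y) h) (w y)
      + ip (G (x y)) (u y) (frechet_derivative w (at y) h) = 0"
    by simp
  moreover have "christoffel G (x y) ?d (u y) (w y) + christoffel G (x y) ?d (w y) (u y)
      = ip (?G' ?d) (u y) (w y)"
    unfolding christoffel_def Let_def
    using ip_G'_commute[OF xD, of ?d "w y" "u y"] by (simp add: field_simps)
  ultimately show ?thesis
    unfolding nabla_def ip_simps ip_conn_vec[OF xD frame[OF y]]
      ip_G_commute[OF xD, of "u y" "conn_vec G (x y) (v1 y) (v2 y) ?d (w y)"] by linarith
qed

lemma nabla_frame:
  assumes y: "y \<in> U"
  shows "nabla v1 y h = conn_form y h *\<^sub>R v2 y" "nabla v2 y h = conn_form y h *\<^sub>R v1 y"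
proof -
  note exp = orthonormal_frame_expansion[OF symmetric_G[OF x_in_D[OF y]] frame[OF y]]
  note com = ip_G_commute[OF x_in_D[OF y]]
  have "ip (G (x y)) (nabla v1 y h) (v1 y) = 0"
    using ip_nabla[OF y smooth_v(1) smooth_v(1) frame_ip(1), of h] com[of "v1 y"] by simp
  then show "nabla v1 y h = conn_form y h *\<^sub>R v2 y"
    using exp[of "nabla v1 y h"] by (simp add: conn_form_def)
  have "ip (G (x y)) (nabla v2 y h) (v2 y) = 0"
    using ip_nabla[OF y smooth_v(2) smooth_v(2) frame_ip(2), of h] com[of "v2 y"] by simp
  moreover have "ip (G (x y)) (nabla v2 y h) (v1 y) = conn_form y h"
    using ip_nabla[OF y smooth_v(1) smooth_v(2) frame_ip(3), of h] com[of "v1 y" "nabla v2 y h"]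
    by (simp add: conn_form_def)
  ultimately show "nabla v2 y h = conn_form y h *\<^sub>R v1 y"
    using exp[of "nabla v2 y h"] by simp
qed

lemma derivative_frame:
  assumes y: "y \<in> U"
  shows "frechet_derivative v1 (at y) h = conn_form y h *\<^sub>R v2 y
      - conn_vec G (x y) (v1 y) (v2 y) (frechet_derivative x (at y) h) (v1 y)"
    "frechet_derivative v2 (at y) h = conn_form y h *\<^sub>R v1 y
      - conn_vec G (x y) (v1 y) (v2 y) (frechet_derivative x (at y) h) (v2 y)"
  using nabla_frame[OF y, of h] by (simp_all add: nabla_def eq_diff_eq)

text \<open>Absence of torsion: the second derivatives of \<open>x\<close> cancel by symmetry, and
  the derivatives of \<open>G\<close> assemble to Christoffel symbols, which complete the derivative
  of \<open>w\<close> to \<open>nabla\<close>.\<close>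

lemma ext_d_ip:
  assumes y: "y \<in> U" and w: "smooth_on U w"
  shows "ext_d (\<lambda>z h. ip (G (x z)) (frechet_derivative x (at z) h) (w z)) y h l
    = ip (G (x y)) (frechet_derivative x (at y) l) (nabla w y h)
      - ip (G (x y)) (frechet_derivative x (at y) h) (nabla w y l)"
proof -
  let ?x = "frechet_derivative x (at y)" and ?G' = "frechet_derivative G (at (x y))"
  let ?w = "frechet_derivative w (at y)"
  let ?xx = "\<lambda>h l. frechet_derivative (\<lambda>z. frechet_derivative x (at z) l) (at y) h"
  have xD: "x y \<in> D" by (rule x_in_D[OF y])
  have d: "frechet_derivative (\<lambda>z. ip (G (x z)) (frechet_derivative x (at z) l) (w z)) (at y) h
    = ip (?G' (?x h)) (?x l) (w y) + ip (G (x y)) (?xx h l) (w y) + ip (G (x y)) (?x l) (?w h)" for h l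
    using frechet_derivative_eqI[OF has_derivative_ip[OF has_derivative_Gx[OF y]
          smooth_on_has_derivative[OF smooth_on_derivative[OF smooth_x] y]
          smooth_on_has_derivative[OF w y]]] by meson
  have "ip (G (x y)) (?xx h l) (w y) = ip (G (x y)) (?xx l h) (w y)"
    using second_derivative_symmetric[OF open_U smooth_x y] by metis
  moreover have "christoffel G (x y) (?x h) (w y) (?x l) - christoffel G (x y) (?x l) (w y) (?x h)
      = ip (?G' (?x h)) (?x l) (w y) - ip (?G' (?x l)) (?x h) (w y)"
    unfolding christoffel_def Let_def
    using ip_G'_commute[OF xD, of "w y" "?x h" "?x l"] ip_G'_commute[OF xD, of "?x h" "w y" "?x l"]
      ip_G'_commute[OF xD, of "?x l" "w y" "?x h"]
    by (simp add: field_simps)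
  ultimately show ?thesis
    unfolding ext_d_def d nabla_def ip_simps
      ip_G_commute[OF xD, of "?x h" "conn_vec G (x y) (v1 y) (v2 y) (?x l) (w y)"]
      ip_G_commute[OF xD, of "?x l" "conn_vec G (x y) (v1 y) (v2 y) (?x h) (w y)"]
      ip_conn_vec[OF xD frame[OF y]]
    by linarith
qed

lemma ext_d_\<eta>1: "y \<in> U \<Longrightarrow> ext_d \<eta>1 y h l = - wedge (conn_form y) (\<eta>2 y) h l"
  unfolding \<eta>1_def[abs_def] using ext_d_ip[OF _ smooth_v(1), of y h l]
  by (simp add: nabla_frame ip_simps wedge_def \<eta>2_def algebra_simps)

lemma ext_d_uminus: "(\<And>h. (\<lambda>z. \<alpha> z h) differentiable (at y)) \<Longrightarrow> ext_d (\<lambda>z h. - \<alpha> z h) y h l = - ext_d \<alpha> y h l"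
  by (simp add: ext_d_def frechet_derivative_eqI[OF has_derivative_minus[OF
          frechet_derivative_works[THEN iffD1]]])

lemma smooth_ip_dx:
  assumes "smooth_on U w"
  shows "smooth_on U (\<lambda>z. ip (G (x z)) (frechet_derivative x (at z) h) (w z))"
  by (intro smooth_on_ip smooth_on_compose[OF open_U open_D smooth_x smooth_G] smooth_on_derivative
      smooth_x assms open_U) (use x_in_D in auto)

lemma ext_d_\<eta>2: "y \<in> U \<Longrightarrow> ext_d \<eta>2 y h l = - wedge (conn_form y) (\<eta>1 y) h l"
  unfolding \<eta>2_def[abs_def] using ext_d_ip[OF _ smooth_v(2), of y h l]
    ext_d_uminus[OF smooth_on_differentiable[OF smooth_ip_dx[OF smooth_v(2)]]]
  by (simp add: nabla_frame ip_simps wedge_def \<eta>1_def algebra_simps)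

text \<open>A one-form is determined by its wedge products with \<eta>1 and \<eta>2, as evaluation
  against \<open>h1\<close> and \<open>h2\<close> shows. This identifies the \<kappa> supplied by
  the structure equations with the Levi-Civita form.\<close>

lemma conn_form_unique:
  assumes y: "y \<in> U"
    and \<kappa>: "\<And>h l. ext_d \<eta>1 y h l = - wedge (\<kappa> y) (\<eta>2 y) h l"
      "\<And>h l. ext_d \<eta>2 y h l = - wedge (\<kappa> y) (\<eta>1 y) h l"
    and ind: "\<eta>1 y h1 = 1" "\<eta>2 y h1 = 0" "\<eta>1 y h2 = 0" "\<eta>2 y h2 = 1"
  shows "\<kappa> y = conn_form y"
proof
  fix h
  have w: "wedge (\<kappa> y) (\<eta>1 y) h l = wedge (conn_form y) (\<eta>1 y) h l"
    "wedge (\<kappa> y) (\<eta>2 y) h l = wedge (conn_form y) (\<eta>2 y) h l" for h l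
    using \<kappa>[of h l] ext_d_\<eta>1[OF y, of h l] ext_d_\<eta>2[OF y, of h l] by simp_all
  have "\<kappa> y h1 = conn_form y h1" using w(2)[of h2 h1] by (simp add: wedge_def ind)
  then show "\<kappa> y h = conn_form y h" using w(1)[of h h1] by (simp add: wedge_def ind)
qed

lemma has_derivative_df:
  assumes f: "smooth_on D f" and y: "y \<in> U" and w: "smooth_on U w"
  shows "((\<lambda>z. frechet_derivative f (at (x z)) (w z)) has_derivative
    (\<lambda>h. second_derivative f (x y) (frechet_derivative x (at y) h) (w y)
       + frechet_derivative f (at (x y)) (frechet_derivative w (at y) h))) (at y)"
proof -
  let ?f = "\<lambda>z. frechet_derivative f (at z)"
  have "((\<lambda>z. \<Sum>b\<in>Basis. (w z \<bullet> b) *\<^sub>R ?f (x z) b) has_derivative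
    (\<lambda>h. \<Sum>b\<in>Basis. (w y \<bullet> b) *\<^sub>R second_derivative f (x y) (frechet_derivative x (at y) h) b
       + (frechet_derivative w (at y) h \<bullet> b) *\<^sub>R ?f (x y) b)) (at y)"
    unfolding second_derivative_def
    by (intro has_derivative_sum has_derivative_scaleR has_derivative_inner_left
        smooth_on_has_derivative[OF w y] has_derivative_compose[OF derivative_x[OF y]]
        smooth_on_has_derivative[OF smooth_on_derivative[OF f] x_in_D[OF y]])
  moreover have "(\<Sum>b\<in>Basis. (w y \<bullet> b) *\<^sub>R second_derivative f (x y) (frechet_derivative x (at y) h) b
       + (frechet_derivative w (at y) h \<bullet> b) *\<^sub>R ?f (x y) b)
    = second_derivative f (x y) (frechet_derivative x (at y) h) (w y)
       + ?f (x y) (frechet_derivative w (at y) h)" for h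
    unfolding sum.distrib linear_Basis_expansion[OF second_derivative_linear(3)[OF f x_in_D[OF y]], symmetric]
      linear_Basis_expansion[OF smooth_on_linear_derivative[OF f x_in_D[OF y]], symmetric] ..
  ultimately have "((\<lambda>z. \<Sum>b\<in>Basis. (w z \<bullet> b) *\<^sub>R ?f (x z) b) has_derivative
    (\<lambda>h. second_derivative f (x y) (frechet_derivative x (at y) h) (w y)
       + ?f (x y) (frechet_derivative w (at y) h))) (at y)"
    by simp
  then show ?thesis
    by (rule has_derivative_transform_within_open[OF _ open_U y])
      (rule linear_Basis_expansion[OF smooth_on_linear_derivative[OF f x_in_D], symmetric])
qed

text \<open>The Christoffel part of the derivative of the frame turns second derivatives of
  \<open>f\<close> into the Hessian, and what is left mixes the two components through the
  connection form.\<close>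

lemma has_derivative_df_frame:
  assumes f: "smooth_on D f" and y: "y \<in> U"
  shows "((\<lambda>z. frechet_derivative f (at (x z)) (v1 z)) has_derivative
    (\<lambda>h. hess G f (x y) (v1 y) (v2 y) (frechet_derivative x (at y) h) (v1 y)
       + conn_form y h * frechet_derivative f (at (x y)) (v2 y))) (at y)"
    "((\<lambda>z. frechet_derivative f (at (x z)) (v2 z)) has_derivative
    (\<lambda>h. hess G f (x y) (v1 y) (v2 y) (frechet_derivative x (at y) h) (v2 y)
       + conn_form y h * frechet_derivative f (at (x y)) (v1 y))) (at y)"
  using has_derivative_df[OF f y smooth_v(1)] has_derivative_df[OF f y smooth_v(2)]
  unfolding derivative_frame[OF y] hess_def
  by (simp_all add: linear_diff[OF smooth_on_linear_derivative[OF f x_in_D[OF y]]]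
      linear_cmul[OF smooth_on_linear_derivative[OF f x_in_D[OF y]]] algebra_simps)

end

subsection \<open>Moving frames in Minkowski space\<close>

lemma ip12_simps:
  "ip12 (a + a') b = ip12 a b + ip12 a' b" "ip12 a (b + b') = ip12 a b + ip12 a b'"
  "ip12 (c *\<^sub>R a) b = c * ip12 a b" "ip12 a (c *\<^sub>R b) = c * ip12 a b"
  by (simp_all add: ip12_def sum_3 algebra_simps)

lemma ip12_commute: "ip12 a b = ip12 b a"
  by (simp add: ip12_def sum_3 algebra_simps)

lemma ip12_sum_right: "ip12 a (\<Sum>i\<in>I. f i) = (\<Sum>i\<in>I. ip12 a (f i))"
proof -
  have "linear (ip12 a)" by (simp add: linear_iff ip12_simps)
  then show ?thesis by (rule linear_sum)
qed

lemma bounded_bilinear_ip12: "bounded_bilinear ip12"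
proof -
  have "bilinear ip12" unfolding bilinear_def linear_iff by (simp add: ip12_simps)
  then show ?thesis by (simp add: bilinear_conv_bounded_bilinear)
qed

lemma sgn12_simps: "sgn12 1 = 1" "sgn12 2 = -1" "sgn12 3 = -1" "sgn12 i * sgn12 i = 1"
  by (simp_all add: sgn12_def)

locale minkowski_frame =
  fixes U :: "'e::euclidean_space set" and \<rho> :: "'e \<Rightarrow> real^3" and ee :: "3 \<Rightarrow> 'e \<Rightarrow> real^3"
  assumes open_U: "open U" and smooth_\<rho>: "smooth_on U \<rho>" and smooth_ee: "\<And>i. smooth_on U (ee i)"
    and ip12_ee: "\<And>y i j. y \<in> U \<Longrightarrow> ip12 (ee i y) (ee j y) = (if i = j then sgn12 i else 0)"
begin

text \<open>The pullbacks of \<open>\<omega>\<^sup>i\<close> and \<open>\<omega>\<^sup>j\<^sub>i\<close>.\<close>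

definition w :: "3 \<Rightarrow> ('e, real) form1" where
  "w i y h = sgn12 i * ip12 (frechet_derivative \<rho> (at y) h) (ee i y)"

definition q :: "3 \<Rightarrow> 3 \<Rightarrow> ('e, real) form1" where
  "q j i y h = sgn12 j * ip12 (frechet_derivative (ee i) (at y) h) (ee j y)"

lemma expansion:
  assumes "y \<in> U"
  shows "a = (\<Sum>i\<in>UNIV. (sgn12 i * ip12 a (ee i y)) *\<^sub>R ee i y)"
  using ip12_expansion[of 0 "\<chi> i. ee i y" a] ip12_ee[OF assms]
  by (simp add: frame_bundle12_def)

lemma derivative_\<rho>: "y \<in> U \<Longrightarrow> frechet_derivative \<rho> (at y) h = (\<Sum>i\<in>UNIV. w i y h *\<^sub>R ee i y)"
  unfolding w_def by (rule expansion)

lemma derivative_ee: "y \<in> U \<Longrightarrow> frechet_derivative (ee i) (at y) h = (\<Sum>j\<in>UNIV. q j i y h *\<^sub>R ee j y)"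
  unfolding q_def by (rule expansion)

text \<open>Orthonormality is differentiated: the connection matrix takes values in the Lie algebra
  of the group of signature (1,2).\<close>

lemma q_skew:
  assumes y: "y \<in> U"
  shows "q i j y h = - (sgn12 i * sgn12 j * q j i y h)"
proof -
  have "((\<lambda>z. ip12 (ee i z) (ee j z)) has_derivative (\<lambda>h. 0)) (at y)"
    by (rule has_derivative_transform_within_open[OF has_derivative_const open_U y]) (simp add: ip12_ee)
  from fun_cong[OF has_derivative_unique[OF this bounded_bilinear.FDERIV[OF bounded_bilinear_ip12
      smooth_on_has_derivative[OF smooth_ee y] smooth_on_has_derivative[OF smooth_ee y]]], of h]
  have *: "ip12 (ee i y) (frechet_derivative (ee j) (at y) h)
      + ip12 (frechet_derivative (ee i) (at y) h) (ee j y) = 0" by simp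
  have "ip12 (frechet_derivative (ee j) (at y) h) (ee i y)
      = - ip12 (frechet_derivative (ee i) (at y) h) (ee j y)"
    using * ip12_commute[of "ee i y"] by simp
  then have "q i j y h = sgn12 i * - ip12 (frechet_derivative (ee i) (at y) h) (ee j y)"
    unfolding q_def by simp
  also have "\<dots> = - (sgn12 i * (sgn12 j * sgn12 j) * ip12 (frechet_derivative (ee i) (at y) h) (ee j y))"
    by (simp add: sgn12_simps)
  finally show ?thesis by (simp add: q_def mult.assoc)
qed

text \<open>The ambient inner product is constant and second derivatives are symmetric, so only
  products of first derivatives remain; this is the flatness of Minkowski space.\<close>

lemma ext_d_ip12:
  assumes u: "smooth_on U u" and v: "smooth_on U v" and y: "y \<in> U"
  shows "ext_d (\<lambda>z h. c * ip12 (frechet_derivative u (at z) h) (v z)) y h l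
    = c * (ip12 (frechet_derivative u (at y) l) (frechet_derivative v (at y) h)
     - ip12 (frechet_derivative u (at y) h) (frechet_derivative v (at y) l))"
proof -
  let ?uu = "\<lambda>h l. frechet_derivative (\<lambda>z. frechet_derivative u (at z) l) (at y) h"
  have d: "frechet_derivative (\<lambda>z. c * ip12 (frechet_derivative u (at z) l) (v z)) (at y) h
    = c * (ip12 (frechet_derivative u (at y) l) (frechet_derivative v (at y) h) + ip12 (?uu h l) (v y))" for h l
    using frechet_derivative_eqI[OF has_derivative_mult_right[OF bounded_bilinear.FDERIV[OF
          bounded_bilinear_ip12 smooth_on_has_derivative[OF smooth_on_derivative[OF u] y]
          smooth_on_has_derivative[OF v y]]]] by meson
  have "?uu h l = ?uu l h" by (rule second_derivative_symmetric[OF open_U u y])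
  then show ?thesis unfolding ext_d_def d by (simp add: algebra_simps)
qed

lemma ext_d_w:
  assumes y: "y \<in> U"
  shows "ext_d (w i) y h l = - (\<Sum>j\<in>UNIV. wedge (q i j y) (w j y) h l)"
proof -
  let ?r = "\<lambda>h. frechet_derivative \<rho> (at y) h"
  have e: "ip12 (?r h) (ee j y) = sgn12 j * w j y h" for j h
    unfolding w_def by (simp add: sgn12_simps mult.assoc[symmetric])
  have "ext_d (w i) y h l = sgn12 i * ((\<Sum>j\<in>UNIV. q j i y h * ip12 (?r l) (ee j y))
      - (\<Sum>j\<in>UNIV. q j i y l * ip12 (?r h) (ee j y)))"
    unfolding w_def[abs_def] ext_d_ip12[OF smooth_\<rho> smooth_ee y] derivative_ee[OF y] ip12_sum_right
    by (simp add: ip12_simps)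
  also have "\<dots> = (\<Sum>j\<in>UNIV. sgn12 i * sgn12 j * (q j i y h * w j y l - q j i y l * w j y h))"
    unfolding e by (simp add: sum_distrib_left sum_subtractf algebra_simps)
  also have "\<dots> = (\<Sum>j\<in>UNIV. - wedge (q i j y) (w j y) h l)"
    by (intro sum.cong refl) (simp add: q_skew[OF y, of i] wedge_def algebra_simps)
  finally show ?thesis by (simp add: sum_negf)
qed

lemma ext_d_q:
  assumes y: "y \<in> U"
  shows "ext_d (q j i) y h l = - (\<Sum>m\<in>UNIV. wedge (q j m y) (q m i y) h l)"
proof -
  let ?e = "\<lambda>h. frechet_derivative (ee i) (at y) h"
  have e: "ip12 (?e h) (ee j y) = sgn12 j * q j i y h" for j h
    unfolding q_def by (simp add: sgn12_simps mult.assoc[symmetric])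
  have "ext_d (q j i) y h l = sgn12 j * ((\<Sum>m\<in>UNIV. q m j y h * ip12 (?e l) (ee m y))
      - (\<Sum>m\<in>UNIV. q m j y l * ip12 (?e h) (ee m y)))"
    unfolding q_def[of j i, abs_def] ext_d_ip12[OF smooth_ee smooth_ee y] derivative_ee[OF y, of j] ip12_sum_right
    by (simp add: ip12_simps)
  also have "\<dots> = (\<Sum>m\<in>UNIV. sgn12 j * sgn12 m * (q m j y h * q m i y l - q m j y l * q m i y h))"
    unfolding e by (simp add: sum_distrib_left sum_subtractf algebra_simps)
  also have "\<dots> = (\<Sum>m\<in>UNIV. - wedge (q j m y) (q m i y) h l)"
    by (intro sum.cong refl) (simp add: q_skew[OF y, of j] wedge_def algebra_simps)
  finally show ?thesis by (simp add: sum_negf)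
qed

lemma q_values:
  assumes "y \<in> U"
  shows "q 1 1 y h = 0" "q 2 2 y h = 0" "q 3 3 y h = 0" "q 2 1 y h = q 1 2 y h" "q 1 3 y h = q 3 1 y h"
    "q 2 3 y h = - q 3 2 y h"
  using q_skew[OF assms, of 1 1 h] q_skew[OF assms, of 2 2 h] q_skew[OF assms, of 3 3 h]
    q_skew[OF assms, of 2 1 h] q_skew[OF assms, of 1 3 h] q_skew[OF assms, of 2 3 h]
  by (simp_all add: sgn12_simps)

lemma structure_equations12:
  assumes y: "y \<in> U"
  shows "ext_d (w 1) y h l = - wedge (q 1 2 y) (w 2 y) h l - wedge (q 3 1 y) (w 3 y) h l"
    "ext_d (w 2) y h l = - wedge (q 1 2 y) (w 1 y) h l + wedge (q 3 2 y) (w 3 y) h l"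
    "ext_d (w 3) y h l = - wedge (q 3 1 y) (w 1 y) h l - wedge (q 3 2 y) (w 2 y) h l"
    "ext_d (q 1 2) y h l = - wedge (q 3 1 y) (q 3 2 y) h l"
    "ext_d (q 3 1) y h l = - wedge (q 3 2 y) (q 1 2 y) h l"
    "ext_d (q 3 2) y h l = - wedge (q 3 1 y) (q 1 2 y) h l"
  unfolding ext_d_w[OF y] ext_d_q[OF y] sum_3
  by (simp_all add: wedge_def q_values[OF y] algebra_simps)

lemma smooth_w: "smooth_on U (\<lambda>y. w i y h)"
  unfolding w_def by (intro smooth_on_mult bounded_bilinear.smooth_on_prod[OF bounded_bilinear_ip12]
      smooth_on_const smooth_on_derivative smooth_\<rho> smooth_ee open_U)

lemma smooth_q: "smooth_on U (\<lambda>y. q j i y h)"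
  unfolding q_def by (intro smooth_on_mult bounded_bilinear.smooth_on_prod[OF bounded_bilinear_ip12]
      smooth_on_const smooth_on_derivative smooth_ee open_U)

lemma linear_wq: "y \<in> U \<Longrightarrow> linear (w i y)" "y \<in> U \<Longrightarrow> linear (q j i y)"
  using smooth_on_linear_derivative[OF smooth_\<rho>] smooth_on_linear_derivative[OF smooth_ee]
  by (auto simp: linear_iff w_def q_def ip12_simps algebra_simps)

end

subsection \<open>The coframe of a parametrization\<close>

text \<open>Nine independent forms on a nine-dimensional space. The bijection \<pi> matches the
  index type \<open>9\<close> with the numbers below 9, so that the forms become one
  endomorphism.\<close>

lemma onto_of_inj:
  fixes e :: "nat \<Rightarrow> real^9 \<Rightarrow> real"
  assumes lin: "\<And>i. i < 9 \<Longrightarrow> linear (e i)" and inj: "\<And>h. (\<forall>i<9. e i h = 0) \<Longrightarrow> h = 0"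
  shows "\<exists>h. \<forall>i<9. e i h = v i"
proof -
  obtain \<pi> :: "9 \<Rightarrow> nat" where \<pi>: "bij_betw \<pi> UNIV {..<9}"
    using finite_same_card_bij[of "UNIV :: 9 set" "{..<9::nat}"] by auto
  have \<pi>9: "\<pi> j < 9" for j using bij_betwE[OF \<pi>] by auto
  define L :: "real^9 \<Rightarrow> real^9" where "L h = (\<chi> j. e (\<pi> j) h)" for h
  have "linear L"
    using lin[OF \<pi>9] by (simp add: linear_iff L_def vec_eq_iff)
  moreover have "inj L"
  proof (unfold linear_injective_0[OF \<open>linear L\<close>], intro allI impI)
    fix h assume "L h = 0"
    then have "e (\<pi> j) h = 0" for j by (simp add: L_def vec_eq_iff)
    then have "\<forall>i<9. e i h = 0" using \<pi> unfolding bij_betw_def by (metis imageE lessThan_iff)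
    then show "h = 0" by (rule inj)
  qed
  ultimately have "surj L" using linear_injective_imp_surjective by blast
  then obtain h where h: "L h = (\<chi> j. v (\<pi> j))" by (metis surjD)
  have "e i h = v i" if "i < 9" for i
  proof -
    obtain j where "i = \<pi> j" using \<pi> \<open>i < 9\<close> unfolding bij_betw_def by (metis imageE lessThan_iff)
    then show ?thesis using h by (simp add: L_def vec_eq_iff)
  qed
  then show ?thesis by blast
qed

context metric_domain
begin

lemma smooth_on_christoffel:
  fixes U :: "'e::euclidean_space set"
  assumes U: "open U" "smooth_on U x" "x ` U \<subseteq> D" "smooth_on U a" "smooth_on U b" "smooth_on U c"
  shows "smooth_on U (\<lambda>y. christoffel G (x y) (a y) (b y) (c y))"
proof -
  have G': "smooth_on U (\<lambda>y. frechet_derivative G (at (x y)) (u y))" if "smooth_on U u" for u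
  proof (rule smooth_on_linear_family[OF U(1) _ _ that])
    show "linear (frechet_derivative G (at (x y)))" if "y \<in> U" for y
      using linear_G' U(3) that by blast
    show "smooth_on U (\<lambda>y. frechet_derivative G (at (x y)) b)" for b
      by (rule smooth_on_compose[OF U(1) open_D U(2) smooth_on_derivative[OF smooth_G] U(3)])
  qed
  have "smooth_on U (\<lambda>y. (1 / 2) * (ip (frechet_derivative G (at (x y)) (a y)) (b y) (c y)
      + ip (frechet_derivative G (at (x y)) (b y)) (a y) (c y)
      - ip (frechet_derivative G (at (x y)) (c y)) (a y) (b y)))"
    by (intro smooth_on_mult smooth_on_add smooth_on_diff smooth_on_ip smooth_on_const G' U)
  then show ?thesis by (simp add: christoffel_def Let_def)
qed

lemma smooth_on_df:
  fixes U :: "'e::euclidean_space set"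
  assumes U: "open U" "smooth_on U x" "x ` U \<subseteq> D" "smooth_on U a" and f: "smooth_on D f"
  shows "smooth_on U (\<lambda>y. frechet_derivative f (at (x y)) (a y))"
proof (rule smooth_on_linear_family[OF U(1) _ _ U(4)])
  show "linear (frechet_derivative f (at (x y)))" if "y \<in> U" for y
    using smooth_on_linear_derivative[OF f] U(3) that by blast
  show "smooth_on U (\<lambda>y. frechet_derivative f (at (x y)) b)" for b
    by (rule smooth_on_compose[OF U(1) open_D U(2) smooth_on_derivative[OF f] U(3)])
qed

lemma smooth_on_hess:
  fixes U :: "'e::euclidean_space set" and f :: "real^2 \<Rightarrow> real"
  assumes U: "open U" "smooth_on U x" "x ` U \<subseteq> D" and f: "smooth_on D f"
    and v: "smooth_on U v1" "smooth_on U v2" "smooth_on U a" "smooth_on U b"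
  shows "smooth_on U (\<lambda>y. hess G f (x y) (v1 y) (v2 y) (a y) (b y))"
proof -
  have "smooth_on U (\<lambda>y. second_derivative f (x y) (a y) (b y))"
  proof (rule smooth_on_linear_family[OF U(1) _ _ v(4)])
    show "linear (second_derivative f (x y) (a y))" if "y \<in> U" for y
      using second_derivative_linear(3)[OF f] U(3) that by blast
    show "smooth_on U (\<lambda>y. second_derivative f (x y) (a y) c)" for c
      unfolding second_derivative_def by (rule smooth_on_df[OF U v(3) smooth_on_derivative[OF f]])
  qed
  then show ?thesis
    unfolding hess_def conn_vec_def
    by (intro smooth_on_diff smooth_on_df smooth_on_scaleR smooth_on_christoffel U f v)
qed

end

lemma frechet_derivative_linear:
  fixes L :: "'b::euclidean_space \<Rightarrow> 'c::real_normed_vector"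
  assumes "linear L" "(f has_derivative f') (at y)"
  shows "frechet_derivative (\<lambda>z. L (f z)) (at y) h = L (f' h)"
proof -
  have "bounded_linear L" using assms(1) by (simp add: linear_conv_bounded_linear)
  from frechet_derivative_eqI[OF bounded_linear.has_derivative[OF this assms(2)]] show ?thesis by simp
qed

lemma ext_d_cong:
  fixes \<alpha> :: "('e::euclidean_space, 'f::real_normed_field) form1"
  assumes S: "open S" "y \<in> S" and eq: "\<And>z h. z \<in> S \<Longrightarrow> \<alpha> z h = \<beta> z h"
    and d: "\<And>h. (\<lambda>z. \<alpha> z h) differentiable (at y)"
  shows "ext_d \<alpha> y h l = ext_d \<beta> y h l"
proof -
  have "frechet_derivative (\<lambda>z. \<alpha> z l) (at y) = frechet_derivative (\<lambda>z. \<beta> z l) (at y)" for l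
    by (rule frechet_derivative_transform_within_open[OF d S]) (rule eq)
  then show ?thesis by (simp add: ext_d_def)
qed

lemma in_span_at_cong:
  assumes "length \<alpha>s = length \<beta>s" "\<And>i h. i < length \<alpha>s \<Longrightarrow> (\<alpha>s ! i) y h = (\<beta>s ! i) y h"
  shows "in_span_at \<alpha>s y \<phi> \<longleftrightarrow> in_span_at \<beta>s y \<phi>"
  unfolding in_span_at_def using assms by simp

text \<open>Integrability is used near the given adapted frame: all forms are pulled back along a
  parametrization there, which instantiates the abstract coframe, and the algebraic result is read
  off at the parameter of that frame.\<close>

theorem hessian_of_integrable:
  fixes D :: "(real^2) set" and G :: "real^2 \<Rightarrow> real^2^2" and K :: "real^2 \<Rightarrow> real"
  assumes D: "open D" and G: "lorentzian_metric D G"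
    and K: "smooth_on D K" "\<And>x. x \<in> D \<Longrightarrow> K x > 0"
    and int: "locally_integrable \<i> D G K"
    and f_def: "f = (\<lambda>x. ln (K x) / 4)"
    and x0: "x0 \<in> D" "orthonormal_frame (G x0) u1 u2"
    and df: "frechet_derivative f (at x0) u1 = 0" "frechet_derivative f (at x0) u2 \<noteq> 0"
  shows "hess G f x0 u1 u2 u1 u2 = 0" "hess G f x0 u1 u2 u1 u1 = - K x0"
    "hess G f x0 u1 u2 u2 u2 = 3 * (frechet_derivative f (at x0) u2)\<^sup>2 + K x0"
proof -
  interpret metric_domain D G
    using D G by unfold_locales (auto simp: lorentzian_metric_def)
  have f: "smooth_on D f"
    unfolding f_def by (intro smooth_on_divide smooth_on_ln smooth_on_const D K) auto
  have K_f: "K x = exp (4 * f x)" if "x \<in> D" for x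
    using K(2)[OF that] by (simp add: f_def)
  \<comment> \<open>The frame is completed by the origin and the standard frame of Minkowski space;
    any other choice would serve, since the conclusion concerns the surface alone.\<close>
  have "((x0, u1, u2), (0, mat 1)) \<in> frame_bundle D G \<times> frame_bundle12"
    using x0 by (simp add: frame_bundle_def frame_bundle12_def ip12_def sum_3 mat_def sgn12_def forall_3)
  then obtain S \<Psi> \<kappa> where par: "parametrization S \<Psi> (frame_bundle D G \<times> frame_bundle12)"
    and in_S: "((x0, u1, u2), (0, mat 1)) \<in> \<Psi> ` S"
    and se: "structure_equations G K S (fst \<circ> \<Psi>) \<kappa>"
    and fr: "has_transverse_frobenius S (singular_system \<i> G K \<Psi> \<kappa>) (thetas G \<Psi> \<kappa>)"
    using int unfolding locally_integrable_def by blast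
  have S: "open S" and \<Psi>: "smooth_on S \<Psi>" and inj: "\<And>y. y \<in> S \<Longrightarrow> inj (frechet_derivative \<Psi> (at y))"
    and N: "\<And>y. y \<in> S \<Longrightarrow> \<Psi> y \<in> frame_bundle D G \<times> frame_bundle12"
    using par openin_imp_subset unfolding parametrization_def by blast+
  obtain y0 where y0: "y0 \<in> S" "\<Psi> y0 = ((x0, u1, u2), (0, mat 1))" using in_S by force
  define x v1 v2 where "x y = fst (fst (\<Psi> y))" and "v1 y = fst (snd (fst (\<Psi> y)))"
    and "v2 y = snd (snd (fst (\<Psi> y)))" for y
  define \<rho> where "\<rho> y = fst (snd (\<Psi> y))" for y
  define ee where "ee i y = snd (snd (\<Psi> y)) $ i" for i y
  have sm: "smooth_on S x" "smooth_on S v1" "smooth_on S v2" "smooth_on S \<rho>" "smooth_on S (ee i)" for i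
    unfolding x_def[abs_def] v1_def[abs_def] v2_def[abs_def] \<rho>_def[abs_def] ee_def[abs_def]
    by (intro smooth_on_fst smooth_on_snd smooth_on_vec_nth S \<Psi>)+
  have N': "x y \<in> D" "orthonormal_frame (G (x y)) (v1 y) (v2 y)"
    "ip12 (ee i y) (ee j y) = (if i = j then sgn12 i else 0)" if "y \<in> S" for y i j
    using N[OF that] by (auto simp: frame_bundle_def frame_bundle12_def x_def v1_def v2_def ee_def
        split: prod.splits)
  interpret MF: moving_frame D G S x v1 v2
    using N' by unfold_locales (auto intro: S sm)
  interpret MK: minkowski_frame S \<rho> ee
    using N' by unfold_locales (auto intro: S sm)
  have d\<Psi>: "(\<Psi> has_derivative frechet_derivative \<Psi> (at y)) (at y)" if "y \<in> S" for y
    by (rule smooth_on_has_derivative[OF \<Psi> that])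
  have der: "frechet_derivative x (at y) h = fst (fst (frechet_derivative \<Psi> (at y) h))"
    "frechet_derivative v1 (at y) h = fst (snd (fst (frechet_derivative \<Psi> (at y) h)))"
    "frechet_derivative v2 (at y) h = snd (snd (fst (frechet_derivative \<Psi> (at y) h)))"
    "frechet_derivative \<rho> (at y) h = fst (snd (frechet_derivative \<Psi> (at y) h))"
    "frechet_derivative (ee i) (at y) h = snd (snd (frechet_derivative \<Psi> (at y) h)) $ i"
    "frechet_derivative (fst \<circ> \<Psi>) (at y) h = fst (frechet_derivative \<Psi> (at y) h)"
    "frechet_derivative (snd \<circ> \<Psi>) (at y) h = snd (frechet_derivative \<Psi> (at y) h)"
    if "y \<in> S" for y h i
    unfolding x_def[abs_def] v1_def[abs_def] v2_def[abs_def] \<rho>_def[abs_def] ee_def[abs_def] comp_def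
    by (rule frechet_derivative_linear[OF _ d\<Psi>[OF that]]; simp add: linear_iff)+
  have pull: "pullback (fst \<circ> \<Psi>) (eta1 G) y h = MF.\<eta>1 y h"
    "pullback (fst \<circ> \<Psi>) (eta2 G) y h = MF.\<eta>2 y h"
    "pullback (snd \<circ> \<Psi>) (omega1 i) y h = MK.w i y h"
    "pullback (snd \<circ> \<Psi>) (omega2 j i) y h = MK.q j i y h" if "y \<in> S" for y h i j
    unfolding pullback_def der(6,7)[OF that] MF.\<eta>1_def MF.\<eta>2_def MK.w_def MK.q_def der(1-5)[OF that]
    by (simp_all add: eta1_def eta2_def omega1_def omega2_def x_def v1_def v2_def ee_def split_beta)
  have sm_\<eta>: "smooth_on S (\<lambda>y. MF.\<eta>1 y h)" "smooth_on S (\<lambda>y. MF.\<eta>2 y h)" for h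
    unfolding MF.\<eta>1_def MF.\<eta>2_def by (intro smooth_on_uminus MF.smooth_ip_dx sm S)+
  have lin_\<eta>: "linear (MF.\<eta>1 y)" "linear (MF.\<eta>2 y)" if "y \<in> S" for y
    using smooth_on_linear_derivative[OF sm(1) that]
    by (simp_all add: linear_iff MF.\<eta>1_def MF.\<eta>2_def ip_simps)
  have lin_conn: "linear (MF.conn_form y)" if y: "y \<in> S" for y
    using smooth_on_linear_derivative[OF sm(1) y] smooth_on_linear_derivative[OF sm(2) y]
      conn_vec_linear(1)[OF N'(1)[OF y]]
    by (simp add: linear_iff MF.conn_form_def MF.nabla_def ip_simps algebra_simps)
  have \<kappa>: "smooth_form1 S \<kappa>" using se by (simp add: structure_equations_def)
  have d\<eta>: "ext_d (pullback (fst \<circ> \<Psi>) (eta1 G)) y h l = ext_d MF.\<eta>1 y h l"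
    "ext_d (pullback (fst \<circ> \<Psi>) (eta2 G)) y h l = ext_d MF.\<eta>2 y h l" if "y \<in> S" for y h l
    by (rule ext_d_cong[OF S that, symmetric];
        simp add: pull smooth_on_differentiable[OF sm_\<eta>(1) that] smooth_on_differentiable[OF sm_\<eta>(2) that])+
  have se': "ext_d MF.\<eta>1 y h l = - wedge (\<kappa> y) (MF.\<eta>2 y) h l"
    "ext_d MF.\<eta>2 y h l = - wedge (\<kappa> y) (MF.\<eta>1 y) h l"
    "ext_d \<kappa> y h l = - K (x y) * wedge (MF.\<eta>1 y) (MF.\<eta>2 y) h l" if "y \<in> S" for y h l
    using se that unfolding structure_equations_def Let_def d\<eta>[OF that, symmetric]
    by (simp_all add: wedge_def pull x_def)
  \<comment> \<open>The nine forms control the derivatives of all components of \<Psi>, and \<Psi>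
    is an immersion.\<close>
  have zero: "h = 0" if y: "y \<in> S" and z: "MF.\<eta>1 y h = 0" "MF.\<eta>2 y h = 0" "MF.conn_form y h = 0"
      "MK.w 1 y h = 0" "MK.w 2 y h = 0" "MK.w 3 y h = 0"
      "MK.q 1 2 y h = 0" "MK.q 3 1 y h = 0" "MK.q 3 2 y h = 0" for y h
  proof -
    have dx: "frechet_derivative x (at y) h = 0" using MF.derivative_x_expansion[OF y, of h] z by simp
    have cv: "conn_vec G (x y) (v1 y) (v2 y) 0 u = 0" for u
      using linear_0[OF conn_vec_linear(1)[OF N'(1)[OF y]]] by simp
    have "frechet_derivative v1 (at y) h = 0" "frechet_derivative v2 (at y) h = 0"
      using MF.derivative_frame[OF y, of h] by (simp_all add: dx cv z)
    moreover have "frechet_derivative \<rho> (at y) h = 0"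
      using MK.derivative_\<rho>[OF y, of h] z by (simp add: sum_3)
    moreover have q0: "MK.q j i y h = 0" for i j
      using z MK.q_values[OF y, of h] exhaust_3[of i] exhaust_3[of j] by auto
    have "frechet_derivative (ee i) (at y) h = 0" for i
      using MK.derivative_ee[OF y, of i h] by (simp add: q0)
    ultimately have "frechet_derivative \<Psi> (at y) h = 0"
      using dx by (simp add: der[OF y] prod_eq_iff vec_eq_iff)
    then show "h = 0"
      using inj[OF y] linear_injective_0[OF smooth_on_linear_derivative[OF \<Psi> y]] by blast
  qed
  let ?l = "\<lambda>c i. [MF.\<eta>1, MF.\<eta>2, c, MK.w 1, MK.w 2, MK.w 3, MK.q 1 2, MK.q 3 1, MK.q 3 2] ! i"
  have cases9: "P i" if "i < 9" "P 0" "P 1" "P 2" "P 3" "P 4" "P 5" "P 6" "P 7" "P 8" for P and i :: nat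
  proof -
    have "i \<in> {0, 1, 2, 3, 4, 5, 6, 7, 8}" using that(1) by auto
    then show ?thesis using that by (elim insertE) simp_all
  qed
  have inj_conn: "h = 0" if y: "y \<in> S" and h: "\<forall>i<9. ?l MF.conn_form i y h = 0" for y h
    by (rule zero[OF y]) (use h[rule_format, of 0] h[rule_format, of 1] h[rule_format, of 2]
        h[rule_format, of 3] h[rule_format, of 4] h[rule_format, of 5] h[rule_format, of 6]
        h[rule_format, of 7] h[rule_format, of 8] in simp_all)
  \<comment> \<open>The coframe property is obtained with \<open>conn_form\<close> in place of
    \<kappa>, because identifying the two requires vectors dual to \<eta>1 and \<eta>2.\<close>
  have onto_conn: "\<exists>h. \<forall>i<9. ?l MF.conn_form i y h = v i" if y: "y \<in> S" for y v
  proof (rule onto_of_inj)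
    show "linear (?l MF.conn_form i y)" if "i < 9" for i
      by (rule cases9[OF that])
        (simp_all add: lin_\<eta>[OF y] lin_conn[OF y] MK.linear_wq[OF y])
  qed (rule inj_conn[OF y])
  have conn: "\<kappa> y = MF.conn_form y" if y: "y \<in> S" for y
  proof -
    obtain h1 h2 where h1: "\<forall>i<9. ?l MF.conn_form i y h1 = (if i = 0 then 1 else 0)"
      and h2: "\<forall>i<9. ?l MF.conn_form i y h2 = (if i = 1 then 1 else 0)"
      using onto_conn[OF y, of "\<lambda>i. if i = 0 then 1 else 0"]
        onto_conn[OF y, of "\<lambda>i. if i = 1 then 1 else 0"] by blast
    show ?thesis
      by (rule MF.conn_form_unique[of y \<kappa> h1 h2])
        (use y se'(1,2)[OF y] h1[rule_format, of 0] h1[rule_format, of 1] h2[rule_format, of 0] h2[rule_format, of 1] in simp_all)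
  qed
  define e where "e = ?l \<kappa>"
  have e: "e 0 = MF.\<eta>1" "e 1 = MF.\<eta>2" "e 2 = \<kappa>" "e 3 = MK.w 1" "e 4 = MK.w 2" "e 5 = MK.w 3"
    "e 6 = MK.q 1 2" "e 7 = MK.q 3 1" "e 8 = MK.q 3 2"
    by (simp_all add: e_def)
  have e_conn: "e i y h = ?l MF.conn_form i y h" if "y \<in> S" "i < 9" for i y h
    unfolding e_def by (rule cases9[OF that(2)]) (simp_all add: conn[OF that(1)])
  define k where "k y = exp (2 * f (x y))" for y
  define p1 p2 where "p1 y = frechet_derivative f (at (x y)) (v1 y)"
    and "p2 y = frechet_derivative f (at (x y)) (v2 y)" for y
  define H where "H a b y = hess G f (x y) (v1 y) (v2 y) (a y) (b y)" for a b y
  have kK: "(k y)\<^sup>2 = K (x y)" "sqrt \<bar>K (x y)\<bar> = k y" if "y \<in> S" for y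
  proof -
    show "(k y)\<^sup>2 = K (x y)"
      using K_f[OF N'(1)[OF that]] by (simp add: k_def power2_eq_square flip: exp_add)
    then have "\<bar>K (x y)\<bar> = (k y)\<^sup>2" using K(2)[OF N'(1)[OF that]] by simp
    then show "sqrt \<bar>K (x y)\<bar> = k y" by (simp add: k_def)
  qed
  note lin_hess = hess_linear[OF f N'(1)]
  have hess_dx: "hess G f (x y) (v1 y) (v2 y) (frechet_derivative x (at y) h) u
      = MF.\<eta>1 y h * hess G f (x y) (v1 y) (v2 y) (v1 y) u + MF.\<eta>2 y h * hess G f (x y) (v1 y) (v2 y) (v2 y) u"
    if y: "y \<in> S" for y h u
    unfolding MF.derivative_x_expansion[OF y]
    by (simp add: linear_add[OF lin_hess(1)[OF y]] linear_cmul[OF lin_hess(1)[OF y]])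
  interpret EC: embedding_coframe S e k p1 p2 "H v1 v1" "H v1 v2" "H v2 v2"
  proof (rule embedding_coframe.intro)
    show "open S" by (rule S)
    fix y assume y: "y \<in> S"
    show "(\<lambda>z. e i z h) differentiable (at y)" if "i < 9" for i h
      unfolding e_def by (rule cases9[OF that])
        (use \<kappa> in \<open>auto intro!: smooth_on_differentiable[OF _ y] simp: sm_\<eta> MK.smooth_w MK.smooth_q smooth_form1_def\<close>)
    show "linear (e i y)" if "i < 9" for i
      unfolding e_def by (rule cases9[OF that])
        (use \<kappa> y in \<open>auto simp: lin_\<eta> MK.linear_wq smooth_form1_def\<close>)
    show "\<exists>h. \<forall>i<9. e i y h = v i" for v
      using onto_conn[OF y, of v] e_conn[OF y] by auto
    fix h l
    show "ext_d (e 0) y h l = - wedge (e 2 y) (e 1 y) h l"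
      "ext_d (e 1) y h l = - wedge (e 2 y) (e 0 y) h l"
      "ext_d (e 2) y h l = - (k y)\<^sup>2 * wedge (e 0 y) (e 1 y) h l"
      unfolding e kK[OF y] by (rule se'[OF y])+
    show "ext_d (e 3) y h l = - wedge (e 6 y) (e 4 y) h l - wedge (e 7 y) (e 5 y) h l"
      "ext_d (e 4) y h l = - wedge (e 6 y) (e 3 y) h l + wedge (e 8 y) (e 5 y) h l"
      "ext_d (e 5) y h l = - wedge (e 7 y) (e 3 y) h l - wedge (e 8 y) (e 4 y) h l"
      "ext_d (e 6) y h l = - wedge (e 7 y) (e 8 y) h l"
      "ext_d (e 7) y h l = - wedge (e 8 y) (e 6 y) h l"
      "ext_d (e 8) y h l = - wedge (e 7 y) (e 6 y) h l"
      unfolding e by (rule MK.structure_equations12[OF y])+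
  next
    fix y assume y: "y \<in> S"
    show "k y > 0" by (simp add: k_def)
    note lin_f = smooth_on_linear_derivative[OF f N'(1)[OF y]]
    have "((\<lambda>y. exp (2 * f (x y))) has_derivative (\<lambda>h. exp (2 * f (x y))
        * (2 * frechet_derivative f (at (x y)) (frechet_derivative x (at y) h)))) (at y)"
      by (rule has_derivative_eq_rhs[OF has_derivative_exp[OF has_derivative_mult_right[OF
              has_derivative_compose[OF MF.derivative_x[OF y] smooth_on_has_derivative[OF f N'(1)[OF y]]]]]])
        (simp add: fun_eq_iff)
    then show "(k has_derivative (\<lambda>h. 2 * k y * (p1 y * e 0 y h + p2 y * e 1 y h))) (at y)"
      unfolding k_def[abs_def] p1_def p2_def e MF.derivative_x_expansion[OF y]
      by (rule has_derivative_eq_rhs)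
        (simp add: fun_eq_iff linear_add[OF lin_f] linear_cmul[OF lin_f] algebra_simps)
    show "(p1 has_derivative (\<lambda>h. H v1 v1 y * e 0 y h + H v1 v2 y * e 1 y h + p2 y * e 2 y h)) (at y)"
      using MF.has_derivative_df_frame(1)[OF f y]
      unfolding p1_def[abs_def] p2_def H_def e conn[OF y] hess_dx[OF y] lin_hess(3)[OF y, of _ _ "v2 y" "v1 y"]
      by (simp add: mult.commute)
    show "(p2 has_derivative (\<lambda>h. H v1 v2 y * e 0 y h + H v2 v2 y * e 1 y h + p1 y * e 2 y h)) (at y)"
      using MF.has_derivative_df_frame(2)[OF f y]
      unfolding p1_def p2_def[abs_def] H_def e conn[OF y] hess_dx[OF y]
      by (simp add: mult.commute)
    \<comment> \<open>The Hessian entries factor through the frame bundle of the surface, where a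
      direction annihilated by \<eta>1, \<eta>2 and the connection form has zero image. They are
      taken as functions of all triples over \<open>D\<close>, an open set, because the bundle
      itself is not open.\<close>
    have dH: "\<exists>d. (H (\<lambda>y. a (fst (\<Psi> y))) (\<lambda>y. b (fst (\<Psi> y))) has_derivative d) (at y) \<and>
        (\<forall>h. e 0 y h = 0 \<and> e 1 y h = 0 \<and> e 2 y h = 0 \<longrightarrow> d h = 0)"
      if ab: "smooth_on (D \<times> UNIV) a" "smooth_on (D \<times> UNIV) b" for a b :: "frame2 \<Rightarrow> real^2"
    proof -
      let ?F = "\<lambda>z :: frame2. hess G f (fst z) (fst (snd z)) (snd (snd z)) (a z) (b z)"
      have o: "open (D \<times> (UNIV :: ((real^2) \<times> (real^2)) set))" by (intro open_Times D open_UNIV)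
      have F: "smooth_on (D \<times> UNIV) ?F"
        by (intro smooth_on_hess[OF o _ _ f] smooth_on_fst smooth_on_snd smooth_on_ident o ab) auto
      have in_o: "fst (\<Psi> y) \<in> D \<times> UNIV" using N'(1)[OF y] by (simp add: x_def mem_Times_iff)
      have d1: "((\<lambda>y. fst (\<Psi> y)) has_derivative (\<lambda>h. fst (frechet_derivative \<Psi> (at y) h))) (at y)"
        by (rule has_derivative_fst[OF d\<Psi>[OF y]])
      have "((\<lambda>y. ?F (fst (\<Psi> y))) has_derivative (\<lambda>h. frechet_derivative ?F (at (fst (\<Psi> y)))
          (fst (frechet_derivative \<Psi> (at y) h)))) (at y)"
        by (rule has_derivative_compose[OF d1 smooth_on_has_derivative[OF F in_o]])
      moreover have "frechet_derivative ?F (at (fst (\<Psi> y))) (fst (frechet_derivative \<Psi> (at y) h)) = 0"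
        if h: "e 0 y h = 0" "e 1 y h = 0" "e 2 y h = 0" for h
      proof -
        have dx: "frechet_derivative x (at y) h = 0"
          using MF.derivative_x_expansion[OF y, of h] h by (simp add: e del: One_nat_def)
        have cv: "conn_vec G (x y) (v1 y) (v2 y) 0 u = 0" for u
          using linear_0[OF conn_vec_linear(1)[OF N'(1)[OF y]]] by simp
        have "frechet_derivative v1 (at y) h = 0" "frechet_derivative v2 (at y) h = 0"
          using MF.derivative_frame[OF y, of h] h(3) by (simp_all add: dx cv e conn[OF y])
        then have "fst (frechet_derivative \<Psi> (at y) h) = 0"
          using dx by (simp add: der[OF y] prod_eq_iff)
        then show ?thesis using linear_0[OF smooth_on_linear_derivative[OF F in_o]] by simp
      qed
      ultimately show ?thesis
        unfolding H_def[abs_def] x_def v1_def v2_def by blast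
    qed
    have o: "open (D \<times> (UNIV :: ((real^2) \<times> (real^2)) set))" by (intro open_Times D open_UNIV)
    have sv: "smooth_on (D \<times> UNIV) (\<lambda>z :: frame2. fst (snd z))" "smooth_on (D \<times> UNIV) (\<lambda>z :: frame2. snd (snd z))"
      by (intro smooth_on_fst smooth_on_snd smooth_on_ident o)+
    show "\<exists>d. (F has_derivative d) (at y) \<and>
        (\<forall>h. e 0 y h = 0 \<and> e 1 y h = 0 \<and> e 2 y h = 0 \<longrightarrow> d h = 0)"
      if "F \<in> {H v1 v1, H v1 v2, H v2 v2}" for F
      using that dH[OF sv(1) sv(1)] dH[OF sv(1) sv(2)] dH[OF sv(2) sv(2)]
      unfolding v1_def[abs_def, symmetric] v2_def[abs_def, symmetric] by blast
  qed
  have th: "in_span_at (thetas G \<Psi> \<kappa>) y \<phi> \<longleftrightarrow> in_span_at EC.theta_forms y \<phi>"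
    and si: "in_span_at (singular_system \<i> G K \<Psi> \<kappa>) y \<phi> \<longleftrightarrow> in_span_at EC.singular_forms y \<phi>"
    if y: "y \<in> S" for y and \<phi> :: "real^9 \<Rightarrow> complex"
  proof -
    note simps = pull[OF y] e e(2)[unfolded One_nat_def] kK(2)[OF y, unfolded x_def]
    have eq: "(singular_system \<i> G K \<Psi> \<kappa> ! i) y h = (EC.singular_forms ! i) y h" if "i < 6" for i h
    proof -
      have "i \<in> {0, 1, 2, 3, 4, 5}" using that by auto
      then show ?thesis unfolding singular_system_def thetas_def EC.singular_forms_def EC.theta_forms_def Let_def
        by (elim insertE) (simp_all add: simps)
    qed
    have eq': "(thetas G \<Psi> \<kappa> ! i) y h = (EC.theta_forms ! i) y h" if "i < 4" for i h
    proof -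
      have "i \<in> {0, 1, 2, 3}" using that by auto
      then show ?thesis unfolding thetas_def EC.theta_forms_def Let_def
        by (elim insertE) (simp_all add: simps)
    qed
    have len: "length (thetas G \<Psi> \<kappa> :: (real^9, complex) form1 list) = 4" "length EC.theta_forms = 4"
      "length (singular_system \<i> G K \<Psi> \<kappa>) = 6" "length EC.singular_forms = 6"
      by (simp_all add: singular_system_def thetas_def EC.singular_forms_def EC.theta_forms_def Let_def)
    show "in_span_at (thetas G \<Psi> \<kappa>) y \<phi> \<longleftrightarrow> in_span_at EC.theta_forms y \<phi>"
      by (rule in_span_at_cong) (simp_all add: len eq')
    show "in_span_at (singular_system \<i> G K \<Psi> \<kappa>) y \<phi> \<longleftrightarrow> in_span_at EC.singular_forms y \<phi>"
      by (rule in_span_at_cong) (simp_all add: len eq)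
  qed
  have "has_transverse_frobenius S EC.singular_forms EC.theta_forms"
    using fr unfolding has_transverse_frobenius_def by (simp add: th si cong: conj_cong)
  moreover have "h = 0" if y: "y \<in> S" and "\<forall>i<9. e i y h = 0" for y h
    using inj_conn[OF y] that(2) e_conn[OF y] by simp
  ultimately obtain a b A B
    where "frobenius_pair S e k p1 p2 (H v1 v1) (H v1 v2) (H v2 v2) a b A B (\<lambda>y. \<i> * of_real (k y))"
    using EC.transverse_frobenius_imp_frobenius_pair by blast
  then interpret FP: frobenius_pair S e k p1 p2 "H v1 v1" "H v1 v2" "H v2 v2" a b A B
      "\<lambda>y. \<i> * of_real (k y)" .
  have at0: "x y0 = x0" "v1 y0 = u1" "v2 y0 = u2" by (simp_all add: x_def v1_def v2_def y0)
  have "p1 y0 = 0" "p2 y0 \<noteq> 0" using df by (simp_all add: p1_def p2_def at0)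
  from FP.hessian_at_adapted_frame[OF y0(1) this] kK(1)[OF y0(1)]
  show "hess G f x0 u1 u2 u1 u2 = 0" "hess G f x0 u1 u2 u1 u1 = - K x0"
    "hess G f x0 u1 u2 u2 u2 = 3 * (frechet_derivative f (at x0) u2)\<^sup>2 + K x0"
    by (simp_all add: H_def p2_def at0)
qed

subsection \<open>The Hessian equation of a Darboux integrable metric\<close>

lemma Ck_on_local:
  assumes "\<And>x. x \<in> D \<Longrightarrow> \<exists>S. open S \<and> x \<in> S \<and> Ck_on n S f"
  shows "Ck_on n D f"
  using assms
proof (induction n arbitrary: f)
  case 0
  then show ?case
    by (fastforce intro: continuous_at_imp_continuous_on simp: continuous_on_eq_continuous_at)
next
  case (Suc n)
  have "f differentiable (at x)" if "x \<in> D" for x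
    using Suc.prems[OF that] by auto
  moreover have "Ck_on n D (\<lambda>x. frechet_derivative f (at x) h)" for h
    by (rule Suc.IH) (use Suc.prems in fastforce)
  ultimately show ?case by simp
qed

lemma smooth_on_local:
  assumes "\<And>x. x \<in> D \<Longrightarrow> \<exists>S. open S \<and> x \<in> S \<and> smooth_on S f"
  shows "smooth_on D f"
  unfolding smooth_on_def by (intro allI Ck_on_local) (use assms in \<open>auto simp: smooth_on_def\<close>)

lemma linear_derivative_form1:
  assumes S: "open S" "y \<in> S" and \<kappa>: "smooth_form1 S \<kappa>"
  shows "linear (\<lambda>l. frechet_derivative (\<lambda>z. \<kappa> z l) (at y) h)"
proof -
  have d: "((\<lambda>z. \<kappa> z l) has_derivative frechet_derivative (\<lambda>z. \<kappa> z l) (at y)) (at y)" for l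
    using \<kappa> S(2) by (intro smooth_on_has_derivative[of S]) (auto simp: smooth_form1_def)
  have lin: "linear (\<kappa> z)" if "z \<in> S" for z using \<kappa> that by (auto simp: smooth_form1_def)
  show ?thesis
  proof (rule linearI)
    fix l l' :: 'a and c :: real
    have "((\<lambda>z. \<kappa> z (l + l')) has_derivative (\<lambda>h. frechet_derivative (\<lambda>z. \<kappa> z l) (at y) h
        + frechet_derivative (\<lambda>z. \<kappa> z l') (at y) h)) (at y)"
      by (rule has_derivative_transform_within_open[OF has_derivative_add[OF d d] S])
        (simp add: linear_add[OF lin])
    from frechet_derivative_eqI[OF this] show "frechet_derivative (\<lambda>z. \<kappa> z (l + l')) (at y) h
        = frechet_derivative (\<lambda>z. \<kappa> z l) (at y) h + frechet_derivative (\<lambda>z. \<kappa> z l') (at y) h" by simp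
    have "((\<lambda>z. \<kappa> z (c *\<^sub>R l)) has_derivative (\<lambda>h. c *\<^sub>R frechet_derivative (\<lambda>z. \<kappa> z l) (at y) h)) (at y)"
      by (rule has_derivative_transform_within_open[OF has_derivative_scaleR_right[OF d] S])
        (simp add: linear_cmul[OF lin])
    from frechet_derivative_eqI[OF this] show "frechet_derivative (\<lambda>z. \<kappa> z (c *\<^sub>R l)) (at y) h
        = c *\<^sub>R frechet_derivative (\<lambda>z. \<kappa> z l) (at y) h" by simp
  qed
qed

lemma smooth_on_ext_d:
  fixes \<kappa> :: "('e::euclidean_space, real) form1"
  assumes S: "open S" and \<kappa>: "smooth_form1 S \<kappa>" and v: "smooth_on S v" "smooth_on S w"
  shows "smooth_on S (\<lambda>y. ext_d \<kappa> y (v y) (w y))"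
proof -
  have *: "smooth_on S (\<lambda>y. frechet_derivative (\<lambda>z. \<kappa> z (w y)) (at y) (v y))"
    if v: "smooth_on S v" "smooth_on S w" for v w
  proof (rule smooth_on_linear_family[OF S _ _ v(1)])
    show "linear (frechet_derivative (\<lambda>z. \<kappa> z (w y)) (at y))" if "y \<in> S" for y
      using \<kappa> that by (intro smooth_on_linear_derivative[of S]) (auto simp: smooth_form1_def)
    show "smooth_on S (\<lambda>y. frechet_derivative (\<lambda>z. \<kappa> z (w y)) (at y) b)" for b
      by (rule smooth_on_linear_family[OF S linear_derivative_form1[OF S _ \<kappa>] _ v(2)])
        (use \<kappa> in \<open>auto simp: smooth_form1_def intro: smooth_on_derivative\<close>)
  qed
  then show ?thesis unfolding ext_d_def by (intro smooth_on_diff S * v)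
qed

text \<open>By the third structure equation \<open>K\<close> equals - d\<kappa>(v1, v2), since
  \<eta>1 and \<eta>2 are dual to \<open>v1\<close> and \<open>v2\<close>; smoothness of the
  curvature follows from that of \<kappa> and the frame.\<close>

lemma curvature_section:
  assumes D: "open D" and G: "lorentzian_metric D G" and K: "is_curvature D G K" and x: "x \<in> D"
  obtains U v1 v2 where "x \<in> U" "U \<subseteq> D" "moving_frame D G U (\<lambda>y. y) v1 v2" "smooth_on U K"
proof -
  from K[unfolded is_curvature_def, rule_format, OF x] obtain U v1 v2 \<kappa> where
    "open U \<and> x \<in> U \<and> U \<subseteq> D \<and> smooth_on U v1 \<and> smooth_on U v2 \<and>
      (\<forall>y\<in>U. orthonormal_frame (G y) (v1 y) (v2 y)) \<and>
      structure_equations G K U (\<lambda>y. (y, v1 y, v2 y)) \<kappa>"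
    by (elim exE) (rule that)
  then have U: "open U" "x \<in> U" "U \<subseteq> D" and v: "smooth_on U v1" "smooth_on U v2"
    and fr: "\<And>y. y \<in> U \<Longrightarrow> orthonormal_frame (G y) (v1 y) (v2 y)"
    and se: "structure_equations G K U (\<lambda>y. (y, v1 y, v2 y)) \<kappa>"
    by simp_all
  interpret moving_frame D G U "\<lambda>y. y" v1 v2
    using D G U v fr by unfold_locales (auto simp: lorentzian_metric_def smooth_on_ident)
  have \<kappa>: "smooth_form1 U \<kappa>" using se by (simp add: structure_equations_def)
  have d: "((\<lambda>y. (y, v1 y, v2 y)) has_derivative
      (\<lambda>h. (h, frechet_derivative v1 (at y) h, frechet_derivative v2 (at y) h))) (at y)" if "y \<in> U" for y
    by (intro has_derivative_Pair has_derivative_ident smooth_on_has_derivative[OF _ that] v)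
  have pull: "pullback (\<lambda>y. (y, v1 y, v2 y)) (eta1 G) y h = \<eta>1 y h"
    "pullback (\<lambda>y. (y, v1 y, v2 y)) (eta2 G) y h = \<eta>2 y h" if "y \<in> U" for y h
    unfolding pullback_def frechet_derivative_eqI[OF d[OF that]]
    by (simp_all add: eta1_def eta2_def \<eta>1_def \<eta>2_def)
  have "- ext_d \<kappa> y (v1 y) (v2 y) = K y" if y: "y \<in> U" for y
  proof -
    have "ext_d \<kappa> y (v1 y) (v2 y) = - K y * wedge (\<eta>1 y) (\<eta>2 y) (v1 y) (v2 y)"
      using se y unfolding structure_equations_def Let_def by (simp add: pull wedge_def)
    then show ?thesis using frame_ip[OF y] by (simp add: wedge_def \<eta>1_def \<eta>2_def)
  qed
  moreover have "smooth_on U (\<lambda>y. - ext_d \<kappa> y (v1 y) (v2 y))"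
    by (intro smooth_on_uminus smooth_on_ext_d U \<kappa> v)
  ultimately have "smooth_on U K" by (rule smooth_on_cong[OF U(1)])
  then show thesis by (intro that[OF U(2,3) moving_frame_axioms])
qed

lemma hessian_equation:
  fixes D :: "(real^2) set" and G :: "real^2 \<Rightarrow> real^2^2" and K :: "real^2 \<Rightarrow> real"
  assumes D: "open D" and G: "lorentzian_metric D G"
    and K: "smooth_on D K" "\<And>x. x \<in> D \<Longrightarrow> K x > 0"
    and int: "locally_integrable \<i> D G K"
    and V: "timelike_V D G K"
    and f_def: "f = (\<lambda>x. ln (K x) / 4)"
    and x: "x \<in> D" "orthonormal_frame (G x) w1 w2"
  shows "(frechet_derivative f (at x) w1)\<^sup>2 < (frechet_derivative f (at x) w2)\<^sup>2"
    and "hess G f x w1 w2 h k = 3 * frechet_derivative f (at x) h * frechet_derivative f (at x) k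
      - K x * ip (G x) h k"
proof -
  interpret metric_domain D G
    using D G by unfold_locales (auto simp: lorentzian_metric_def)
  have f: "smooth_on D f"
    unfolding f_def by (intro smooth_on_divide smooth_on_ln smooth_on_const D K) auto
  let ?df = "frechet_derivative f (at x)"
  have lin: "linear ?df" by (rule smooth_on_linear_derivative[OF f x(1)])
  define f1 f2 where "f1 = ?df w1" and "f2 = ?df w2"
  have w: "ip (G x) w1 w1 = 1" "ip (G x) w2 w2 = - 1" "ip (G x) w1 w2 = 0" "ip (G x) w2 w1 = 0"
    using x(2) ip_G_commute[OF x(1), of w2 w1] by (auto simp: orthonormal_frame_def)
  have "((\<lambda>y. exp (-3 * f y)) has_derivative (\<lambda>h. exp (-3 * f x) * (-3 * ?df h))) (at x)"
    by (rule has_derivative_eq_rhs[OF has_derivative_exp[OF has_derivative_mult_right[OF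
            smooth_on_has_derivative[OF f x(1)]]]]) (simp add: fun_eq_iff)
  moreover have "exp (-3 * f y) = \<bar>K y\<bar> powr (-3/4)" if "y \<in> D" for y
    using K(2)[OF that] by (simp add: f_def powr_def)
  ultimately have dq: "((\<lambda>y. \<bar>K y\<bar> powr (-3/4)) has_derivative (\<lambda>h. exp (-3 * f x) * (-3 * ?df h))) (at x)"
    by (rule has_derivative_transform_within_open[OF _ D x(1)])
  define c where "c = -3 * exp (-3 * f x)"
  \<comment> \<open>Since dq = -3 exp (-3 f) df, the Killing field is a nonzero multiple of f1 w2 -
    f2 w1, and its being timelike compares the squares of f1 and f2.\<close>
  have V_eq: "killing_V K x w1 w2 = (c * f1) *\<^sub>R w2 - (c * f2) *\<^sub>R w1"
    unfolding killing_V_def frechet_derivative_eqI[OF dq] Let_def by (simp add: c_def f1_def f2_def ac_simps)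
  have "0 < ip (G x) (killing_V K x w1 w2) (killing_V K x w1 w2)"
    using V x unfolding timelike_V_def by blast
  also have "\<dots> = c\<^sup>2 * (f2\<^sup>2 - f1\<^sup>2)"
    unfolding V_eq by (simp add: ip_simps w power2_eq_square algebra_simps)
  finally have lt: "f1\<^sup>2 < f2\<^sup>2" by (simp add: c_def zero_less_mult_iff)
  then show "?df w1 ^ 2 < ?df w2 ^ 2" by (simp add: f1_def f2_def)
  define r where "r = sqrt (f2\<^sup>2 - f1\<^sup>2)"
  have r: "r > 0" "r * r = f2\<^sup>2 - f1\<^sup>2" using lt by (simp_all add: r_def)
  \<comment> \<open>The boost to the adapted frame: \<open>u1\<close> is the Killing field scaled to
    unit length, on which df vanishes, and \<open>u2\<close> is a multiple of the gradient of
    \<open>f\<close>.\<close>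
  define u1 u2 where "u1 = (1 / r) *\<^sub>R (f2 *\<^sub>R w1 - f1 *\<^sub>R w2)"
    and "u2 = (1 / r) *\<^sub>R (f2 *\<^sub>R w2 - f1 *\<^sub>R w1)"
  have u: "ip (G x) u1 u1 = 1" "ip (G x) u2 u2 = - 1" "ip (G x) u1 u2 = 0"
    using r by (auto simp: u1_def u2_def ip_simps w field_simps power2_eq_square)
  then have fu: "orthonormal_frame (G x) u1 u2" by (simp add: orthonormal_frame_def)
  have dfu: "?df u1 = 0" "?df u2 = r"
    using r by (simp_all add: u1_def u2_def linear_cmul[OF lin] linear_diff[OF lin] f1_def[symmetric]
        f2_def[symmetric] field_simps power2_eq_square)
  then have dfu': "?df u1 = 0" "?df u2 \<noteq> 0" using r by auto
  note Hu = hessian_of_integrable[OF D G K int f_def x(1) fu dfu']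
  have u21: "ip (G x) u2 u1 = 0" using u ip_G_commute[OF x(1), of u2 u1] by simp
  note hl = hess_linear[OF f x(1), of u1 u2]
  define a1 a2 where "a1 l = ip (G x) l u1" and "a2 l = - ip (G x) l u2" for l
  have ex: "l = a1 l *\<^sub>R u1 + a2 l *\<^sub>R u2" for l
    using orthonormal_frame_expansion[OF symmetric_G[OF x(1)] fu, of l] by (simp add: a1_def a2_def)
  have "hess G f x u1 u2 (s *\<^sub>R u1 + t *\<^sub>R u2) (s' *\<^sub>R u1 + t' *\<^sub>R u2)
      = - (s * s' * K x) + t * t' * (3 * r\<^sup>2 + K x)" for s t s' t'
    using Hu hl(3)[of u2 u1]
    by (simp add: linear_add[OF hl(1)] linear_add[OF hl(2)] linear_cmul[OF hl(1)] linear_cmul[OF hl(2)]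
        dfu algebra_simps)
  moreover have "ip (G x) (s *\<^sub>R u1 + t *\<^sub>R u2) (s' *\<^sub>R u1 + t' *\<^sub>R u2) = s * s' - t * t'" for s t s' t'
    by (simp add: ip_simps u u21)
  moreover have "?df (s *\<^sub>R u1 + t *\<^sub>R u2) = t * r" for s t
    by (simp add: linear_add[OF lin] linear_cmul[OF lin] dfu)
  ultimately have "hess G f x u1 u2 (s *\<^sub>R u1 + t *\<^sub>R u2) (s' *\<^sub>R u1 + t' *\<^sub>R u2)
      = 3 * ?df (s *\<^sub>R u1 + t *\<^sub>R u2) * ?df (s' *\<^sub>R u1 + t' *\<^sub>R u2)
        - K x * ip (G x) (s *\<^sub>R u1 + t *\<^sub>R u2) (s' *\<^sub>R u1 + t' *\<^sub>R u2)" for s t s' t'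
    by (simp only:) (simp add: algebra_simps power2_eq_square)
  from this[of "a1 h" "a2 h" "a1 k" "a2 k"]
  have "hess G f x u1 u2 h k = 3 * ?df h * ?df k - K x * ip (G x) h k"
    unfolding ex[symmetric] .
  then show "hess G f x w1 w2 h k = 3 * ?df h * ?df k - K x * ip (G x) h k"
    using hess_frame_independent[OF x(1) x(2) fu] by simp
qed

subsection \<open>Primitives of closed forms\<close>

text \<open>The Poincare lemma on a ball: the primitive integrates \<mu> along the segments issuing
  from the centre, and it is differentiated under the integral sign.\<close>

lemma closed_form_primitive:
  fixes \<mu> :: "('e::euclidean_space, real) form1"
  assumes \<mu>: "smooth_form1 (ball x0 r) \<mu>"
    and closed: "\<And>y h l. y \<in> ball x0 r \<Longrightarrow> ext_d \<mu> y h l = 0"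
  obtains v where "\<And>y. y \<in> ball x0 r \<Longrightarrow> (v has_derivative \<mu> y) (at y)"
proof -
  let ?U = "ball x0 r"
  define B where "B z h l = frechet_derivative (\<lambda>z. \<mu> z l) (at z) h" for z h l
  have lin: "linear (\<mu> z)" if "z \<in> ?U" for z using \<mu> that by (auto simp: smooth_form1_def)
  have sm: "smooth_on ?U (\<lambda>z. \<mu> z l)" for l using \<mu> by (auto simp: smooth_form1_def)
  have dB: "((\<lambda>z. \<mu> z l) has_derivative (\<lambda>h. B z h l)) (at z)" if "z \<in> ?U" for z l
    unfolding B_def by (rule smooth_on_has_derivative[OF sm that])
  have linB: "linear (\<lambda>h. B z h l)" "linear (B z h)" if "z \<in> ?U" for z h l
    using has_derivative_linear[OF dB[OF that]] linear_derivative_form1[OF open_ball that \<mu>]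
    by (simp_all add: B_def[abs_def])
  have symB: "B z h l = B z l h" if "z \<in> ?U" for z h l
    using closed[OF that, of h l] by (simp add: ext_d_def B_def)
  have smB: "smooth_on ?U (\<lambda>z. B z h l)" for h l
    unfolding B_def by (rule smooth_on_derivative[OF sm])
  define p where "p y t = x0 + t *\<^sub>R (y - x0)" for y t
  have p_in: "p y t \<in> ?U" if "y \<in> ?U" "t \<in> cbox 0 1" for y and t :: real
  proof -
    have "dist x0 (p y t) = \<bar>t\<bar> * dist x0 y" by (simp add: p_def dist_norm norm_minus_commute)
    also have "\<dots> \<le> 1 * dist x0 y" using that(2) by (intro mult_right_mono) auto
    finally show ?thesis using that(1) by simp
  qed
  define F where "F y t = \<mu> (p y t) (y - x0)" for y t
  have F_sum: "(\<Sum>b\<in>Basis. ((y - x0) \<bullet> b) *\<^sub>R \<mu> (p y t) b) = F y t" if "y \<in> ?U" "t \<in> cbox 0 1" for y t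
    unfolding F_def by (rule linear_Basis_expansion[OF lin[OF p_in[OF that]], symmetric])
  define F' where "F' y t h = t * B (p y t) h (y - x0) + \<mu> (p y t) h" for y t h
  have dF: "((\<lambda>y. F y t) has_derivative F' y t) (at y within ?U)" if y: "y \<in> ?U" and t: "t \<in> cbox 0 1" for y t
  proof -
    have dp: "((\<lambda>y. p y t) has_derivative (\<lambda>h. t *\<^sub>R h)) (at y)"
      unfolding p_def by (auto intro!: derivative_eq_intros)
    have "((\<lambda>y. \<Sum>b\<in>Basis. ((y - x0) \<bullet> b) *\<^sub>R \<mu> (p y t) b) has_derivative
      (\<lambda>h. \<Sum>b\<in>Basis. ((y - x0) \<bullet> b) *\<^sub>R B (p y t) (t *\<^sub>R h) b + (h \<bullet> b) *\<^sub>R \<mu> (p y t) b)) (at y)"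
      by (intro has_derivative_sum has_derivative_scaleR has_derivative_compose[OF dp dB[OF p_in[OF y t]]])
        (auto intro!: derivative_eq_intros)
    moreover have "(\<Sum>b\<in>Basis. ((y - x0) \<bullet> b) *\<^sub>R B (p y t) (t *\<^sub>R h) b + (h \<bullet> b) *\<^sub>R \<mu> (p y t) b) = F' y t h" for h
      unfolding sum.distrib F'_def
        linear_Basis_expansion[OF linB(2)[OF p_in[OF y t]], symmetric]
        linear_Basis_expansion[OF lin[OF p_in[OF y t]], symmetric]
      by (simp add: linear_cmul[OF linB(1)[OF p_in[OF y t]]])
    ultimately have "((\<lambda>y. \<Sum>b\<in>Basis. ((y - x0) \<bullet> b) *\<^sub>R \<mu> (p y t) b) has_derivative F' y t) (at y)"
      by (simp add: fun_eq_iff[symmetric])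
    then have "((\<lambda>y. F y t) has_derivative F' y t) (at y)"
      by (rule has_derivative_transform_within_open[OF _ open_ball y]) (rule F_sum[OF _ t])
    then show ?thesis by (rule has_derivative_at_withinI)
  qed
  have blF: "bounded_linear (F' y t)" if "y \<in> ?U" "t \<in> cbox 0 1" for y t
    using dF[OF that] by (rule has_derivative_bounded_linear)
  define FB where "FB y t = Blinfun (F' y t)" for y t
  have FB: "blinfun_apply (FB y t) = F' y t" if "y \<in> ?U" "t \<in> cbox 0 1" for y t
    unfolding FB_def by (rule bounded_linear_Blinfun_apply[OF blF[OF that]])
  have cp: "continuous_on (?U \<times> cbox 0 1) (\<lambda>z. p (fst z) (snd z))"
    unfolding p_def by (intro continuous_intros)
  have p_sub: "(\<lambda>z. p (fst z) (snd z)) ` (?U \<times> cbox 0 1) \<subseteq> ?U"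
    using p_in by (simp add: image_subset_iff mem_Times_iff)
  have c\<mu>: "continuous_on (?U \<times> cbox 0 1) (\<lambda>(y, t). \<mu> (p y t) l)" for l
    using continuous_on_compose2[OF smooth_on_continuous_on[OF sm[of l]] cp p_sub] by (simp add: split_beta)
  have cB: "continuous_on (?U \<times> cbox 0 1) (\<lambda>(y, t). B (p y t) h l)" for h l
    using continuous_on_compose2[OF smooth_on_continuous_on[OF smB[of h l]] cp p_sub]
    by (simp add: split_beta)
  have cF': "continuous_on (?U \<times> cbox 0 1) (\<lambda>(y, t). F' y t h)" for h
  proof -
    have "continuous_on (?U \<times> cbox 0 1) (\<lambda>z. snd z * (\<Sum>b\<in>Basis. ((fst z - x0) \<bullet> b) *\<^sub>R
        (\<lambda>(y, t). B (p y t) h b) z) + (\<lambda>(y, t). \<mu> (p y t) h) z)"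
      by (intro continuous_intros cB c\<mu>)
    moreover have "snd z * (\<Sum>b\<in>Basis. ((fst z - x0) \<bullet> b) *\<^sub>R (\<lambda>(y, t). B (p y t) h b) z)
        + (\<lambda>(y, t). \<mu> (p y t) h) z = (\<lambda>(y, t). F' y t h) z" if "z \<in> ?U \<times> cbox 0 1" for z
      using that linear_Basis_expansion[OF linB(2)[OF p_in[of "fst z" "snd z"]], of h "fst z - x0"]
      unfolding F'_def split_beta mem_Times_iff by metis
    ultimately show ?thesis by (rule continuous_on_eq)
  qed
  have cFB: "continuous_on (?U \<times> cbox 0 1) (\<lambda>(y, t). FB y t)"
  proof (rule continuous_on_blinfun_componentwise)
    fix i :: 'e
    show "continuous_on (?U \<times> cbox 0 1) (\<lambda>x. blinfun_apply (case x of (y, t) \<Rightarrow> FB y t) i)"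
      by (rule continuous_on_eq[OF cF'[of i]]) (auto simp: FB)
  qed
  have slice: "continuous_on (cbox 0 1) (\<lambda>t. g (y, t))"
    if "continuous_on (?U \<times> cbox 0 1) g" "y \<in> ?U" for g :: "'e \<times> real \<Rightarrow> 'c::topological_space" and y
    by (rule continuous_on_compose2[OF that(1)]) (use that(2) in \<open>auto intro!: continuous_intros\<close>)
  have intF: "F y integrable_on cbox 0 1" if y: "y \<in> ?U" for y
  proof (rule integrable_continuous)
    have "continuous_on (cbox 0 1) (\<lambda>t. \<Sum>b\<in>Basis. ((y - x0) \<bullet> b) *\<^sub>R \<mu> (p y t) b)"
      using slice[OF c\<mu> y] by (intro continuous_intros) simp
    then show "continuous_on (cbox 0 1) (F y)"
      by (rule continuous_on_eq) (rule F_sum[OF y])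
  qed
  have "((\<lambda>y. integral (cbox 0 1) (F y)) has_derivative \<mu> y) (at y)" if y: "y \<in> ?U" for y
  proof -
    have "((\<lambda>y. integral (cbox 0 1) (F y)) has_derivative blinfun_apply (integral (cbox 0 1) (FB y))) (at y within ?U)"
      by (rule leibniz_rule[OF _ intF cFB y convex_ball]) (use dF FB in auto)
    then have L: "((\<lambda>y. integral (cbox 0 1) (F y)) has_derivative blinfun_apply (integral (cbox 0 1) (FB y))) (at y)"
      using at_within_open[OF y open_ball] by simp
    have "blinfun_apply (integral (cbox 0 1) (FB y)) h = \<mu> y h" for h
    proof -
      have iFB: "FB y integrable_on cbox 0 1"
        using slice[OF cFB y] by (intro integrable_continuous) simp
      have "blinfun_apply (integral (cbox 0 1) (FB y)) h = integral (cbox 0 1) (\<lambda>t. blinfun_apply (FB y t) h)"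
        using integral_linear[OF iFB bounded_bilinear.bounded_linear_left[OF bounded_bilinear_blinfun_apply, of h]]
        by (simp add: comp_def)
      also have "\<dots> = integral (cbox 0 1) (\<lambda>t. F' y t h)"
        by (rule integral_cong) (simp add: FB[OF y])
      also have "\<dots> = \<mu> y h"
      proof -
        \<comment> \<open>Closedness makes \<open>B\<close> symmetric, so the integrand is the
          derivative in \<open>t\<close> of \<open>t * \<mu> (p y t) h\<close>, whose boundary
          values are 0 and \<open>\<mu> y h\<close>.\<close>
        have "((\<lambda>t. F' y t h) has_integral (1 * \<mu> (p y 1) h - 0 * \<mu> (p y 0) h)) {0..1}"
        proof (rule fundamental_theorem_of_calculus)
          fix t :: real assume t: "t \<in> {0..1}"
          then have t': "t \<in> cbox 0 1" by simp
          have dp: "((\<lambda>t. p y t) has_derivative (\<lambda>s. s *\<^sub>R (y - x0))) (at t)"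
            unfolding p_def by (auto intro!: derivative_eq_intros)
          have "((\<lambda>t. t * \<mu> (p y t) h) has_derivative
              (\<lambda>s. t * B (p y t) (s *\<^sub>R (y - x0)) h + s * \<mu> (p y t) h)) (at t)"
            by (intro has_derivative_mult has_derivative_ident has_derivative_compose[OF dp dB[OF p_in[OF y t']]])
          moreover have "t * B (p y t) (s *\<^sub>R (y - x0)) h + s * \<mu> (p y t) h = s *\<^sub>R F' y t h" for s
            unfolding linear_cmul[OF linB(1)[OF p_in[OF y t']]] F'_def symB[OF p_in[OF y t'], of "y - x0" h]
            by (simp add: algebra_simps)
          ultimately show "((\<lambda>t. t * \<mu> (p y t) h) has_vector_derivative F' y t h) (at t within {0..1})"
            unfolding has_vector_derivative_def by (simp add: has_derivative_at_withinI)
        qed simp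
        then show ?thesis by (simp add: integral_unique p_def)
      qed
      finally show ?thesis .
    qed
    then have "blinfun_apply (integral (cbox 0 1) (FB y)) = \<mu> y" by (rule ext)
    with L show ?thesis by simp
  qed
  then show thesis by (rule that)
qed

subsection \<open>Normal form of a metric satisfying the Hessian equation\<close>

text \<open>Bootstrapping: the derivative of \<sigma> is an expression in \<sigma> itself with
  smooth coefficient fields, so class C^n implies class C^(n+1), starting from mere
  continuity.\<close>

lemma smooth_on_inverse_map:
  fixes \<sigma> :: "real^2 \<Rightarrow> real^2"
  assumes V: "open V" and B: "open B" "\<sigma> ` V \<subseteq> B"
    and Z: "smooth_on B Z1" "smooth_on B Z2"
    and d: "\<And>y. y \<in> V \<Longrightarrow> (\<sigma> has_derivative (\<lambda>h. h $ 1 *\<^sub>R Z1 (\<sigma> y) + h $ 2 *\<^sub>R Z2 (\<sigma> y))) (at y)"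
  shows "smooth_on V \<sigma>"
proof -
  have "Ck_on n V \<sigma>" for n
  proof (induction n)
    case 0
    have "isCont \<sigma> y" if "y \<in> V" for y using has_derivative_continuous[OF d[OF that]] .
    then show ?case by (simp add: continuous_at_imp_continuous_on)
  next
    case (Suc n)
    show ?case
      by (rule Ck_on_SucI[OF V d], assumption)
        (intro Ck_on_add Ck_on_scaleR Ck_on_const V Ck_on_compose[OF V B(1) Suc _ B(2)];
          use Z in \<open>simp add: smooth_on_def\<close>)
  qed
  then show ?thesis by (simp add: smooth_on_def)
qed

locale hessian_metric = moving_frame D G U "\<lambda>y. y" v1 v2
  for D G and U :: "(real^2) set" and v1 v2 +
  fixes f :: "real^2 \<Rightarrow> real"
  assumes smooth_f: "smooth_on D f"
    and hessian: "\<And>y h k. y \<in> U \<Longrightarrow> hess G f y (v1 y) (v2 y) h k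
      = 3 * frechet_derivative f (at y) h * frechet_derivative f (at y) k - exp (4 * f y) * ip (G y) h k"
    and timelike: "\<And>y. y \<in> U \<Longrightarrow>
      (frechet_derivative f (at y) (v1 y))\<^sup>2 < (frechet_derivative f (at y) (v2 y))\<^sup>2"
begin

abbreviation df :: "real^2 \<Rightarrow> real^2 \<Rightarrow> real" where
  "df y \<equiv> frechet_derivative f (at y)"

definition f1 :: "real^2 \<Rightarrow> real" where "f1 y = df y (v1 y)"
definition f2 :: "real^2 \<Rightarrow> real" where "f2 y = df y (v2 y)"

text \<open>The squared length of the gradient of \<open>f\<close> in the metric; it is negative
  because the gradient is orthogonal to the timelike Killing field.\<close>

definition grad_norm :: "real^2 \<Rightarrow> real" where "grad_norm y = (f1 y)\<^sup>2 - (f2 y)\<^sup>2"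

text \<open>This function turns out to be locally constant, and its value is the square root of the scale
  factor of the metric.\<close>

definition scale :: "real^2 \<Rightarrow> real" where
  "scale y = exp (-2 * f y) - exp (-6 * f y) * grad_norm y"

lemma U_subset_D: "U \<subseteq> D"
  using x_in_D by blast

lemma derivative_f: "y \<in> U \<Longrightarrow> (f has_derivative df y) (at y)"
  using smooth_on_has_derivative[OF smooth_f x_in_D] .

lemma linear_df: "y \<in> U \<Longrightarrow> linear (df y)"
  using smooth_on_linear_derivative[OF smooth_f x_in_D] .

lemma \<eta>_eq: "\<eta>1 y h = ip (G y) h (v1 y)" "\<eta>2 y h = - ip (G y) h (v2 y)"
  by (simp_all add: \<eta>1_def \<eta>2_def)

lemma vector_expansion: "y \<in> U \<Longrightarrow> h = \<eta>1 y h *\<^sub>R v1 y + \<eta>2 y h *\<^sub>R v2 y"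
  using derivative_x_expansion[of y h] by simp

lemma df_eq: "y \<in> U \<Longrightarrow> df y h = f1 y * \<eta>1 y h + f2 y * \<eta>2 y h"
  using arg_cong[OF vector_expansion[of y h], of "df y"]
  by (simp add: linear_add[OF linear_df] linear_cmul[OF linear_df] f1_def f2_def mult.commute)

lemma grad_norm_neg: "y \<in> U \<Longrightarrow> grad_norm y < 0"
  using timelike[of y] by (simp add: grad_norm_def f1_def f2_def)

lemma derivative_f1:
  assumes y: "y \<in> U"
  shows "(f1 has_derivative (\<lambda>h. 3 * df y h * f1 y - exp (4 * f y) * \<eta>1 y h + conn_form y h * f2 y)) (at y)"
  using has_derivative_df_frame(1)[OF smooth_f y]
  by (simp add: hessian[OF y] \<eta>_eq f1_def[abs_def] f2_def)

lemma derivative_f2: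
  assumes y: "y \<in> U"
  shows "(f2 has_derivative (\<lambda>h. 3 * df y h * f2 y + exp (4 * f y) * \<eta>2 y h + conn_form y h * f1 y)) (at y)"
  using has_derivative_df_frame(2)[OF smooth_f y]
  by (simp add: hessian[OF y] \<eta>_eq f2_def[abs_def] f1_def)

text \<open>The differential of this squared length is twice the Hessian contracted with the
  gradient, and the Hessian equation makes it a multiple of df.\<close>

lemma derivative_grad_norm:
  assumes y: "y \<in> U"
  shows "(grad_norm has_derivative (\<lambda>h. (6 * grad_norm y - 2 * exp (4 * f y)) * df y h)) (at y)"
  unfolding grad_norm_def[abs_def] power2_eq_square
  by (rule has_derivative_eq_rhs[OF has_derivative_diff[OF has_derivative_mult[OF derivative_f1[OF y] derivative_f1[OF y]]
          has_derivative_mult[OF derivative_f2[OF y] derivative_f2[OF y]]]])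
    (simp add: fun_eq_iff df_eq[OF y] algebra_simps)

lemma has_derivative_exp_f:
  assumes y: "y \<in> U"
  shows "((\<lambda>y. exp (c * f y)) has_derivative (\<lambda>h. c * exp (c * f y) * df y h)) (at y)"
  by (rule has_derivative_eq_rhs[OF has_derivative_exp[OF has_derivative_mult_right[OF derivative_f[OF y]]]])
    (simp add: fun_eq_iff)

text \<open>With N for \<open>grad_norm\<close>, the preceding lemma is the linear equation dN = (6
  N - 2 exp (4 f)) df along \<open>f\<close>. Its integrating factor is exp (-6 f), and
  \<open>scale\<close> is the resulting constant of integration up to sign.\<close>

lemma derivative_scale:
  assumes y: "y \<in> U"
  shows "(scale has_derivative (\<lambda>h. 0)) (at y)"
proof -
  have e: "exp (-6 * f y) * exp (4 * f y) = exp (-2 * f y)" by (simp flip: exp_add)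
  have "-2 * E2 * d - (E6 * ((6 * N - 2 * E4) * d) + -6 * E6 * d * N) = 0"
    if "E6 * E4 = E2" for E2 E4 E6 N d :: real
    using that by (auto simp: algebra_simps)
  from this[OF e] have "-2 * exp (-2 * f y) * df y h - (exp (-6 * f y) * ((6 * grad_norm y - 2 * exp (4 * f y)) * df y h)
      + -6 * exp (-6 * f y) * df y h * grad_norm y) = 0" for h
    by blast
  then show ?thesis
    unfolding scale_def[abs_def]
    by (intro has_derivative_eq_rhs[OF has_derivative_diff[OF has_derivative_exp_f[OF y]
            has_derivative_mult[OF has_derivative_exp_f[OF y] derivative_grad_norm[OF y]]]] ext)
qed

lemma scale_gt: "y \<in> U \<Longrightarrow> exp (-2 * f y) < scale y"
  using grad_norm_neg[of y] by (simp add: scale_def mult_pos_neg)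

lemma smooth_fs: "smooth_on U f" "smooth_on U f1" "smooth_on U f2" "smooth_on U grad_norm"
proof -
  show f: "smooth_on U f" by (rule smooth_on_subset[OF smooth_f U_subset_D])
  show *: "smooth_on U f1" "smooth_on U f2"
    unfolding f1_def[abs_def] f2_def[abs_def]
    by (intro smooth_on_df[OF open_U smooth_x _ _ smooth_f] smooth_v; use x_in_D in blast)+
  show "smooth_on U grad_norm"
    unfolding grad_norm_def[abs_def] power2_eq_square by (intro smooth_on_diff smooth_on_mult * open_U)
qed

lemma smooth_\<eta>: "smooth_on U (\<lambda>y. \<eta>1 y h)" "smooth_on U (\<lambda>y. \<eta>2 y h)"
  unfolding \<eta>1_def \<eta>2_def by (intro smooth_on_uminus smooth_ip_dx smooth_v open_U)+

lemma linear_\<eta>: "linear (\<eta>1 y)" "linear (\<eta>2 y)"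
  by (simp_all add: linear_iff \<eta>_eq ip_simps)

text \<open>\<open>\<mu>\<close> is a multiple of the metric dual of the Killing field divided by its squared length.\<close>

definition \<mu> :: "(real^2, real) form1" where
  "\<mu> y h = exp (3 * f y) / grad_norm y * (f2 y * \<eta>1 y h + f1 y * \<eta>2 y h)"

lemma smooth_form1_\<mu>: "smooth_form1 U \<mu>"
  unfolding smooth_form1_def
proof (intro conjI ballI allI)
  show "linear (\<mu> y)" for y
    by (simp add: linear_iff \<mu>_def linear_add[OF linear_\<eta>(1)] linear_add[OF linear_\<eta>(2)]
        linear_cmul[OF linear_\<eta>(1)] linear_cmul[OF linear_\<eta>(2)] algebra_simps add_divide_distrib)
  show "smooth_on U (\<lambda>y. \<mu> y h)" for h
    unfolding \<mu>_def
    by (intro smooth_on_mult smooth_on_divide smooth_on_exp smooth_on_add smooth_fs smooth_\<eta> open_U smooth_on_const)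
      (use grad_norm_neg in force)
qed

text \<open>The connection terms cancel by the structure equations, and the -3 in
  \<open>d\<rho>\<close> cancels the part of the Hessian with df \<otimes> df. The two terms with K
  cancel because df \<and> (f2 \<eta>1 + f1 \<eta>2) = N (\<eta>1 \<and> \<eta>2).\<close>

lemma closed_\<mu>:
  assumes y: "y \<in> U"
  shows "ext_d \<mu> y h l = 0"
proof -
  define K N E c where "K = exp (4 * f y)" and "N = grad_norm y" and "E = exp (3 * f y)" and "c = conn_form y"
  have N: "N \<noteq> 0" "N = f1 y * f1 y - f2 y * f2 y"
    using grad_norm_neg[OF y] by (auto simp: N_def grad_norm_def power2_eq_square)
  define \<rho> where "\<rho> z = exp (3 * f z) / grad_norm z" for z
  define d\<rho> where "d\<rho> h = E / N * (-3 + 2 * K / N) * df y h" for h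
  have d\<rho>: "(\<rho> has_derivative d\<rho>) (at y)"
    unfolding \<rho>_def[abs_def] d\<rho>_def
    by (rule has_derivative_eq_rhs[OF has_derivative_divide[OF has_derivative_exp_f[OF y] derivative_grad_norm[OF y]]])
      (unfold K_def[symmetric] N_def[symmetric] E_def[symmetric],
        use N(1) in \<open>simp_all add: fun_eq_iff N_def[symmetric] field_simps power2_eq_square\<close>)
  define g where "g i z = \<rho> z * (if i = 0 then f2 z else f1 z)" for i :: nat and z
  define dg where "dg i h = \<rho> y * (if i = 0 then 3 * df y h * f2 y + K * \<eta>2 y h + c h * f1 y
      else 3 * df y h * f1 y - K * \<eta>1 y h + c h * f2 y) + d\<rho> h * (if i = 0 then f2 y else f1 y)" for i :: nat and h
  have dg: "(g i has_derivative dg i) (at y)" for i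
    unfolding g_def[abs_def] dg_def K_def c_def
    using has_derivative_mult[OF d\<rho> derivative_f1[OF y]] has_derivative_mult[OF d\<rho> derivative_f2[OF y]]
    by (cases "i = 0") simp_all
  have "ext_d \<mu> y h l = (\<Sum>i<2. wedge (dg i) ((if i = 0 then \<eta>1 else \<eta>2) y) h l
      + g i y * ext_d (if i = 0 then \<eta>1 else \<eta>2) y h l)"
  proof (rule ext_d_combination[OF open_U y])
    show "\<mu> z h = (\<Sum>i<2. g i z * (if i = 0 then \<eta>1 else \<eta>2) z h)" for z h
      by (simp add: \<mu>_def g_def \<rho>_def numeral_2_eq_2 algebra_simps)
    show "(\<lambda>z. (if i = 0 then \<eta>1 else \<eta>2) z h) differentiable (at y)" for i :: nat and h
      using smooth_on_differentiable[OF smooth_\<eta>(1) y] smooth_on_differentiable[OF smooth_\<eta>(2) y]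
      by (cases "i = 0") simp_all
  qed (rule dg)
  also have "\<dots> = wedge (dg 0) (\<eta>1 y) h l + wedge (dg 1) (\<eta>2 y) h l
      - \<rho> y * (f2 y * wedge c (\<eta>2 y) h l + f1 y * wedge c (\<eta>1 y) h l)"
    by (simp add: numeral_2_eq_2 g_def ext_d_\<eta>1[OF y] ext_d_\<eta>2[OF y] c_def algebra_simps)
  also have "\<dots> = \<rho> y * (2 * K / N) * (f1 y * f1 y - f2 y * f2 y) * wedge (\<eta>1 y) (\<eta>2 y) h l
      - 2 * \<rho> y * K * wedge (\<eta>1 y) (\<eta>2 y) h l"
  proof -
    have \<rho>: "E / N = \<rho> y" by (simp add: \<rho>_def E_def N_def)
    show ?thesis
      unfolding dg_def d\<rho>_def \<rho> wedge_def df_eq[OF y] by (simp add: algebra_simps)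
  qed
  also have "\<dots> = 0" unfolding N(2)[symmetric] using N(1) by (simp add: field_simps)
  finally show ?thesis .
qed

section \<open>The normal coordinates\<close>

lemma scale_constant_on_ball:
  assumes "ball x0 r \<subseteq> U"
  obtains P where "\<And>y. y \<in> ball x0 r \<Longrightarrow> scale y = P"
proof -
  have "\<exists>c. \<forall>y\<in>ball x0 r. scale y = c"
    by (rule has_derivative_zero_constant[OF convex_ball])
      (rule has_derivative_at_withinI, rule derivative_scale, rule subsetD[OF assms])
  then show thesis using that by blast
qed

theorem normal_coordinates:
  assumes x0: "x0 \<in> U"
  shows "\<exists>U' V \<tau> \<sigma> C. open U' \<and> x0 \<in> U' \<and> U' \<subseteq> U \<and> open V \<and> homeomorphism U' V \<tau> \<sigma> \<and>
    smooth_on U' \<tau> \<and> smooth_on V \<sigma> \<and> C > 0 \<and>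
    (\<forall>y\<in>U'. (\<forall>h k. ip (C *\<^sub>R model_metric (\<tau> y)) (frechet_derivative \<tau> (at y) h)
        (frechet_derivative \<tau> (at y) k) = ip (G y) h k) \<and>
      C * exp (4 * f y) = 1 / cos (\<tau> y $ 1) ^ 4)"
proof -
  obtain r where r: "r > 0" "ball x0 r \<subseteq> U" using open_U x0 openE by blast
  let ?B = "ball x0 r"
  obtain P where P: "\<And>y. y \<in> ?B \<Longrightarrow> scale y = P" using scale_constant_on_ball[OF r(2)] by blast
  have inU: "y \<in> U" if "y \<in> ?B" for y using r(2) that by blast
  have P_gt: "exp (-2 * f y) < P" if "y \<in> ?B" for y using scale_gt[OF inU[OF that]] P[OF that] by simp
  have P0: "P > 0" using P_gt[of x0] r(1) exp_gt_zero[of "-2 * f x0"] by (simp del: exp_gt_zero)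
  have sm: "smooth_on ?B F" if "smooth_on U F" for F :: "real^2 \<Rightarrow> real"
    by (rule smooth_on_subset[OF that r(2)])
  \<comment> \<open>The curvature condition with factor P^2 asks for cos^4 u = exp (-4 f) / P^2, so
    \<open>t\<close> is the required value of cos u; \<open>scale_gt\<close> keeps it strictly below
    1.\<close>
  define t where "t y = exp (- f y) / sqrt P" for y
  define u where "u y = arccos (t y)" for y
  have t2: "(t y)\<^sup>2 = exp (-2 * f y) / P" for y
    using P0 by (simp add: t_def power_divide power2_eq_square flip: exp_add)
  have t_pos: "t y > 0" for y using P0 by (simp add: t_def)
  have t_lt: "(t y)\<^sup>2 < 1" if "y \<in> ?B" for y using P_gt[OF that] P0 by (simp add: t2)
  have t_lt1: "t y < 1" if "y \<in> ?B" for y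
    using t_lt[OF that] t_pos[of y] by (metis abs_square_less_1 abs_of_pos)
  have one_t: "P * (1 - (t y)\<^sup>2) = - exp (-6 * f y) * grad_norm y" if "y \<in> ?B" for y
    using P[OF that] P0 unfolding t2 scale_def by (simp add: field_simps)
  \<comment> \<open>This is cot u. Since dt = - t df, differentiating arccos gives du = s
    df.\<close>
  define s where "s y = t y / sqrt (1 - (t y)\<^sup>2)" for y
  have s_pos: "s y > 0" if "y \<in> ?B" for y using t_lt[OF that] t_pos by (simp add: s_def)
  have dt: "(t has_derivative (\<lambda>h. - t y * df y h)) (at y)" if y: "y \<in> ?B" for y
    using has_derivative_mult_left[OF has_derivative_exp_f[OF inU[OF y], of "-1"], of "1 / sqrt P"]
    by (simp add: t_def[abs_def])
  have du: "(u has_derivative (\<lambda>h. s y * df y h)) (at y)" if y: "y \<in> ?B" for y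
  proof -
    have "DERIV arccos (t y) :> inverse (- sqrt (1 - (t y)\<^sup>2))"
      by (rule DERIV_arccos) (use t_pos[of y] t_lt1[OF y] in auto)
    then have "(arccos has_derivative (\<lambda>d. inverse (- sqrt (1 - (t y)\<^sup>2)) * d)) (at (t y))"
      unfolding has_field_derivative_def .
    from has_derivative_compose[OF dt[OF y] this] show ?thesis
      unfolding u_def[abs_def] s_def by (rule has_derivative_eq_rhs) (simp add: fun_eq_iff field_simps)
  qed
  have sm_t: "smooth_on ?B t"
    unfolding t_def[abs_def]
    by (intro smooth_on_divide smooth_on_exp smooth_on_uminus sm[OF smooth_fs(1)] smooth_on_const open_ball)
      (use P0 in simp)
  have sm_s: "smooth_on ?B s"
    unfolding s_def[abs_def] power2_eq_square
    by (intro smooth_on_divide smooth_on_sqrt smooth_on_diff smooth_on_mult sm_t smooth_on_const open_ball)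
      (use t_lt in \<open>force simp: power2_eq_square\<close>)+
  \<comment> \<open>The future dv. The factor 1 / sqrt P is fixed by \<open>c2\<close> below: it
    makes P^2 sin^2 u times the square of \<nu> free of \<open>P\<close>.\<close>
  define \<nu> where "\<nu> y h = 1 / sqrt P * \<mu> y h" for y h
  have \<nu>: "smooth_form1 ?B \<nu>"
  proof -
    have "linear (\<nu> y)" if "y \<in> ?B" for y
      using smooth_form1_\<mu> inU[OF that] by (auto simp: smooth_form1_def \<nu>_def linear_iff algebra_simps add_divide_distrib)
    moreover have "smooth_on ?B (\<lambda>y. \<nu> y h)" for h
      unfolding \<nu>_def by (intro smooth_on_mult smooth_on_const open_ball sm)
        (use smooth_form1_\<mu> in \<open>simp add: smooth_form1_def\<close>)
    ultimately show ?thesis by (simp add: smooth_form1_def)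
  qed
  have "ext_d \<nu> y h l = 0" if y: "y \<in> ?B" for y h l
  proof -
    have "ext_d \<nu> y h l = (\<Sum>i<Suc 0. wedge (\<lambda>h. 0) (\<mu> y) h l + 1 / sqrt P * ext_d \<mu> y h l)"
      by (rule ext_d_combination[OF open_U inU[OF y], where c = "\<lambda>i z. 1 / sqrt P" and \<alpha> = "\<lambda>i. \<mu>"])
        (use smooth_form1_\<mu> inU[OF y] in \<open>auto simp: \<nu>_def smooth_form1_def intro: smooth_on_differentiable\<close>)
    then show ?thesis by (simp add: closed_\<mu>[OF inU[OF y]] wedge_def)
  qed
  then obtain v where dv: "\<And>y. y \<in> ?B \<Longrightarrow> (v has_derivative \<nu> y) (at y)"
    using closed_form_primitive[OF \<nu>] by blast
  define \<tau> :: "real^2 \<Rightarrow> real^2" where "\<tau> y = u y *\<^sub>R axis 1 1 + v y *\<^sub>R axis 2 1" for y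
  define T :: "real^2 \<Rightarrow> real^2 \<Rightarrow> real^2" where "T y h = (s y * df y h) *\<^sub>R axis 1 1 + \<nu> y h *\<^sub>R axis 2 1" for y h
  have \<tau>1: "\<tau> y $ 1 = u y" for y by (simp add: \<tau>_def axis_def)
  have T12: "T y h $ 1 = s y * df y h" "T y h $ 2 = \<nu> y h" for y h by (simp_all add: T_def axis_def)
  have d\<tau>: "(\<tau> has_derivative T y) (at y)" if "y \<in> ?B" for y
    unfolding \<tau>_def[abs_def] T_def[abs_def]
    by (intro has_derivative_add has_derivative_scaleR_left du dv that)
  have sm_T: "smooth_on ?B (\<lambda>y. T y h)" for h
    unfolding T_def using \<nu>
    by (intro smooth_on_add smooth_on_scaleR smooth_on_mult sm_s smooth_on_const open_ball
        smooth_on_derivative sm[OF smooth_fs(1)]) (simp add: smooth_form1_def)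
  have sm_\<tau>: "smooth_on ?B \<tau>" by (rule smooth_onI[OF open_ball d\<tau> sm_T])
  \<comment> \<open>\<open>Z1\<close> and \<open>Z2\<close> are the coordinate fields dual to du and
    dv: multiples of the gradient and of the Killing field. Having them explicitly is what makes the
    inverse chart smooth.\<close>
  define Z1 where "Z1 y = (1 / (s y * grad_norm y)) *\<^sub>R (f1 y *\<^sub>R v1 y - f2 y *\<^sub>R v2 y)" for y
  define Z2 where "Z2 y = (- sqrt P * exp (-3 * f y)) *\<^sub>R (f2 y *\<^sub>R v1 y - f1 y *\<^sub>R v2 y)" for y
  have nz: "grad_norm y \<noteq> 0" "s y \<noteq> 0" if "y \<in> ?B" for y
    using grad_norm_neg[OF inU[OF that]] s_pos[OF that] by auto
  have sm_Z: "smooth_on ?B Z1" "smooth_on ?B Z2"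
    unfolding Z1_def[abs_def] Z2_def[abs_def]
    by (intro smooth_on_scaleR smooth_on_divide smooth_on_mult smooth_on_diff smooth_on_exp sm_s sm smooth_fs
        smooth_on_const open_ball smooth_on_subset[OF smooth_v(1) r(2)] smooth_on_subset[OF smooth_v(2) r(2)];
        use nz in simp)+
  define L :: "real^2 \<Rightarrow> real^2 \<Rightarrow> real^2" where "L y h = h $ 1 *\<^sub>R Z1 y + h $ 2 *\<^sub>R Z2 y" for y h
  have linL: "linear (L y)" for y by (simp add: linear_iff L_def algebra_simps)
  have linT: "linear (T y)" if "y \<in> ?B" for y using has_derivative_linear[OF d\<tau>[OF that]] .
  have TL: "T y (L y h) = h" if y: "y \<in> ?B" for y h
  proof -
    note ly = linear_df[OF inU[OF y]]
    have l\<nu>: "linear (\<nu> y)" using \<nu> y by (simp add: smooth_form1_def)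
    let ?g = "f1 y *\<^sub>R v1 y - f2 y *\<^sub>R v2 y" and ?k = "f2 y *\<^sub>R v1 y - f1 y *\<^sub>R v2 y"
    have \<eta>: "\<eta>1 y ?g = f1 y" "\<eta>2 y ?g = - f2 y" "\<eta>1 y ?k = f2 y" "\<eta>2 y ?k = - f1 y"
      using frame_ip[OF inU[OF y]] by (simp_all add: \<eta>_eq ip_simps)
    have "df y ?g = grad_norm y" "df y ?k = 0"
      unfolding df_eq[OF inU[OF y]] \<eta> by (simp_all add: grad_norm_def power2_eq_square)
    moreover have "f2 y * f2 y + f1 y * - f1 y = - grad_norm y"
      by (simp add: grad_norm_def power2_eq_square)
    then have "\<nu> y ?g = 0" "\<nu> y ?k = - (exp (3 * f y) / sqrt P)"
      unfolding \<nu>_def \<mu>_def \<eta> using nz[OF y] by simp_all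
    moreover have "(- sqrt P * exp (-3 * f y)) * - (exp (3 * f y) / sqrt P) = 1"
      using P0 exp_add[of "-3 * f y" "3 * f y"] by simp
    ultimately have "df y (L y h) = h $ 1 / s y" "\<nu> y (L y h) = h $ 2"
      unfolding L_def Z1_def Z2_def linear_add[OF ly] linear_cmul[OF ly] linear_add[OF l\<nu>] linear_cmul[OF l\<nu>]
      using nz[OF y] by (simp_all only: mult_zero_right add_0_left add_0_right mult_1_right real_scaleR_def)
        (simp add: field_simps)
    then show ?thesis using nz[OF y] by (simp add: vec_eq_iff forall_2 T12)
  qed
  have LT: "L y (T y h) = h" and bijT: "bij (T y)" if y: "y \<in> ?B" for y h
  proof -
    have "surj (T y)" using TL[OF y] by (metis surjI)
    then have "inj (T y)" using linear_surj_imp_inj[OF linT[OF y]] by blast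
    then show "L y (T y h) = h" using TL[OF y, of "T y h"] by (simp add: inj_eq)
    show "bij (T y)" using \<open>surj (T y)\<close> \<open>inj (T y)\<close> by (simp add: bij_def)
  qed
  have invT: "inv (T y) = L y" if y: "y \<in> ?B" for y
    by (rule inv_equality) (use TL[OF y] LT[OF y] in auto)
  define TB where "TB y = Blinfun (T y)" for y
  have TB: "blinfun_apply (TB y) = T y" if "y \<in> ?B" for y
    unfolding TB_def using linT[OF that] by (simp add: bounded_linear_Blinfun_apply linear_conv_bounded_linear)
  have cTB: "continuous_on ?B TB"
    by (rule continuous_on_blinfun_componentwise, rule continuous_on_eq[OF smooth_on_continuous_on[OF sm_T]])
      (simp add: TB)
  have LB: "Blinfun (L x0) o\<^sub>L TB x0 = id_blinfun"
    using linL[of x0] r(1)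
    by (intro blinfun_eqI) (simp add: TB LT bounded_linear_Blinfun_apply linear_conv_bounded_linear)
  have x0B: "x0 \<in> ?B" using r by simp
  have dTB: "(\<tau> has_derivative blinfun_apply (TB y)) (at y)" if "y \<in> ?B" for y
    unfolding TB[OF that] by (rule d\<tau>[OF that])
  obtain U' V \<sigma> g' where inv: "open U'" "U' \<subseteq> ?B" "x0 \<in> U'" "open V" "\<tau> x0 \<in> V" "homeomorphism U' V \<tau> \<sigma>"
    "\<And>y. y \<in> V \<Longrightarrow> (\<sigma> has_derivative g' y) (at y)"
    "\<And>y. y \<in> V \<Longrightarrow> g' y = inv (blinfun_apply (TB (\<sigma> y)))"
    using inverse_function_theorem[OF open_ball dTB cTB x0B LB] by metis
  have \<sigma>B: "\<sigma> y \<in> ?B" if "y \<in> V" for y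
    using inv(2,6) that by (auto simp: homeomorphism_def)
  have "smooth_on V \<sigma>"
  proof (rule smooth_on_inverse_map[OF inv(4) open_ball _ sm_Z])
    show "\<sigma> ` V \<subseteq> ?B" using \<sigma>B by blast
    show "(\<sigma> has_derivative (\<lambda>h. h $ 1 *\<^sub>R Z1 (\<sigma> y) + h $ 2 *\<^sub>R Z2 (\<sigma> y))) (at y)" if "y \<in> V" for y
      using inv(7)[OF that] unfolding inv(8)[OF that] TB[OF \<sigma>B[OF that]] invT[OF \<sigma>B[OF that]] L_def[abs_def] .
  qed
  moreover have "smooth_on U' \<tau>" by (rule smooth_on_subset[OF sm_\<tau> inv(2)])
  moreover have "U' \<subseteq> U" using inv(2) r(2) by blast
  moreover have "P\<^sup>2 > 0" using P0 by simp
  moreover have "ip (P\<^sup>2 *\<^sub>R model_metric (\<tau> y)) (frechet_derivative \<tau> (at y) h) (frechet_derivative \<tau> (at y) k)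
      = ip (G y) h k \<and> P\<^sup>2 * exp (4 * f y) = 1 / cos (\<tau> y $ 1) ^ 4" if "y \<in> U'" for y h k
  proof
    have y: "y \<in> ?B" using that inv(2) by blast
    note yU = inU[OF y]
    have t01: "-1 \<le> t y" "t y \<le> 1" using t_pos[of y] t_lt1[OF y] by simp_all
    have cosu: "cos (\<tau> y $ 1) = t y" unfolding \<tau>1 u_def by (rule cos_arccos[OF t01])
    have sinu: "(sin (\<tau> y $ 1))\<^sup>2 = 1 - (t y)\<^sup>2" using sin_squared_eq[of "\<tau> y $ 1"] cosu by simp
    have "t y ^ 4 = ((t y)\<^sup>2)\<^sup>2" by (simp add: power2_eq_square eval_nat_numeral)
    also have "\<dots> = exp (-4 * f y) / P\<^sup>2"
      unfolding t2 by (simp add: power_divide power2_eq_square flip: exp_add)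
    finally have "t y ^ 4 = exp (-4 * f y) / P\<^sup>2" .
    then show "P\<^sup>2 * exp (4 * f y) = 1 / cos (\<tau> y $ 1) ^ 4"
      unfolding cosu by (simp add: exp_minus field_simps)
    define N E where "N = grad_norm y" and "E = exp (-2 * f y)"
    have N: "N \<noteq> 0" "N = f1 y * f1 y - f2 y * f2 y" using nz[OF y] by (simp_all add: N_def grad_norm_def power2_eq_square)
    have E: "E > 0" "exp (-6 * f y) = E ^ 3" by (simp_all add: E_def flip: exp_of_nat_mult)
    have Pt: "P * (t y)\<^sup>2 = E" using P0 by (simp add: t2 E_def)
    have P1t: "P * (1 - (t y)\<^sup>2) = - (E ^ 3) * N" using one_t[OF y] unfolding E(2) N_def by simp
    have e6: "(exp (3 * f y))\<^sup>2 * E ^ 3 = 1"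
      by (simp add: E_def power2_eq_square flip: exp_add exp_of_nat_mult)
    have s2: "(s y)\<^sup>2 * (1 - (t y)\<^sup>2) = (t y)\<^sup>2"
      using t_lt[OF y] by (simp add: s_def power_divide)
    \<comment> \<open>Both coefficients are evaluated with \<open>P1t\<close>, a form of the
      constancy of \<open>scale\<close>: the u-part of the scaled model metric becomes (df)^2 / N
      and the v-part minus the square of f2 \<eta>1 + f1 \<eta>2, divided by N.\<close>
    have c1: "- P\<^sup>2 * t y ^ 4 * (s y)\<^sup>2 = 1 / N"
    proof -
      have "- P\<^sup>2 * t y ^ 4 * (s y)\<^sup>2 * (P * (1 - (t y)\<^sup>2)) = - ((P * (t y)\<^sup>2) ^ 3)"
        using s2 by algebra
      then have "(- P\<^sup>2 * t y ^ 4 * (s y)\<^sup>2 * N) * E ^ 3 = 1 * E ^ 3" unfolding P1t Pt by algebra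
      then have "- P\<^sup>2 * t y ^ 4 * (s y)\<^sup>2 * N = 1"
        by (rule mult_right_cancel[THEN iffD1, rotated]) (use E(1) in simp)
      then show ?thesis using N(1) by (simp add: field_simps)
    qed
    have c2: "P\<^sup>2 * (1 - (t y)\<^sup>2) * (1 / sqrt P * (exp (3 * f y) / N))\<^sup>2 = - 1 / N"
    proof -
      have "(1 / sqrt P)\<^sup>2 = 1 / P" using P0 by (simp add: power_divide)
      then have "P\<^sup>2 * (1 - (t y)\<^sup>2) * (1 / sqrt P * (exp (3 * f y) / N))\<^sup>2
          = (P * (1 - (t y)\<^sup>2)) * (exp (3 * f y))\<^sup>2 / N\<^sup>2"
        unfolding power_mult_distrib[of "1 / sqrt P"] by (simp add: power_divide power2_eq_square[of P])
      also have "\<dots> = - ((exp (3 * f y))\<^sup>2 * E ^ 3) * N / N\<^sup>2" unfolding P1t by simp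
      finally show ?thesis unfolding e6 using N(1) by (simp add: power2_eq_square)
    qed
    have FD: "frechet_derivative \<tau> (at y) = T y" by (rule frechet_derivative_eqI[OF d\<tau>[OF y]])
    have "ip (P\<^sup>2 *\<^sub>R model_metric (\<tau> y)) (T y h) (T y k)
        = - P\<^sup>2 * t y ^ 4 * (T y h $ 1 * T y k $ 1) + P\<^sup>2 * (1 - (t y)\<^sup>2) * (T y h $ 2 * T y k $ 2)"
      unfolding ip_simps
      by (simp add: ip_def model_metric_def inner_vec_def sum_2 matrix_vector_mult_def vector_2 cosu sinu algebra_simps)
    also have "\<dots> = (- P\<^sup>2 * t y ^ 4 * (s y)\<^sup>2) * (df y h * df y k)
        + (P\<^sup>2 * (1 - (t y)\<^sup>2) * (1 / sqrt P * (exp (3 * f y) / N))\<^sup>2)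
          * ((f2 y * \<eta>1 y h + f1 y * \<eta>2 y h) * (f2 y * \<eta>1 y k + f1 y * \<eta>2 y k))"
      unfolding T12 \<nu>_def \<mu>_def N_def[symmetric] by (simp add: power2_eq_square ac_simps)
    also have "\<dots> = (df y h * df y k - (f2 y * \<eta>1 y h + f1 y * \<eta>2 y h) * (f2 y * \<eta>1 y k + f1 y * \<eta>2 y k)) / N"
      unfolding c1 c2 by (simp add: diff_divide_distrib)
    \<comment> \<open>The difference of the squares of f1 \<eta>1 + f2 \<eta>2 and f2 \<eta>1 + f1
      \<eta>2 is N times \<eta>1^2 - \<eta>2^2, here in polarised form.\<close>
    also have "\<dots> = (N * (\<eta>1 y h * \<eta>1 y k - \<eta>2 y h * \<eta>2 y k)) / N"
      unfolding df_eq[OF yU] N(2) by (simp add: algebra_simps)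
    also have "\<dots> = ip (G y) (\<eta>1 y h *\<^sub>R v1 y + \<eta>2 y h *\<^sub>R v2 y) (\<eta>1 y k *\<^sub>R v1 y + \<eta>2 y k *\<^sub>R v2 y)"
      using N(1) frame_ip[OF yU] by (simp add: ip_simps)
    also have "\<dots> = ip (G y) h k" using vector_expansion[OF yU] by metis
    finally show "ip (P\<^sup>2 *\<^sub>R model_metric (\<tau> y)) (frechet_derivative \<tau> (at y) h) (frechet_derivative \<tau> (at y) k)
      = ip (G y) h k" unfolding FD .
  qed
  ultimately show ?thesis using inv(1,3,4,6) by blast
qed

end

subsection \<open>Composing a chart with a local diffeomorphism\<close>

lemma chart_inv_apply: "inj_on (snd c) (fst c) \<Longrightarrow> r \<in> fst c \<Longrightarrow> chart_inv c (snd c r) = r"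
  by (simp add: chart_inv_def)

lemma homeomorphic_map_chart_inj:
  assumes "openin X W" "homeomorphic_map (subtopology X W) Y \<phi>"
  shows "inj_on \<phi> W"
proof -
  have "topspace (subtopology X W) = W" using openin_subset[OF assms(1)] by auto
  then show ?thesis using homeomorphic_imp_injective_map[OF assms(2)] by simp
qed

text \<open>The chart is an open map onto its image with the relative topology, and the image is
  open in the plane.\<close>

lemma open_chart_image:
  assumes W: "openin X W" and hom: "homeomorphic_map (subtopology X W) (top_of_set (\<phi> ` W)) \<phi>"
    and op: "open (\<phi> ` W)" and W': "openin X W'"
  shows "open (\<phi> ` (W \<inter> W'))"
proof -
  have "openin (subtopology X W) (W \<inter> W')"
    using W' unfolding openin_subtopology by blast
  then have "openin (top_of_set (\<phi> ` W)) (\<phi> ` (W \<inter> W'))"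
    using homeomorphic_imp_open_map[OF hom] unfolding open_map_def by blast
  then show ?thesis using op openin_open_trans by blast
qed

text \<open>The normal form arises from a coordinate change \<tau> inside the chart
  \<open>c\<close>. Restricting \<open>c\<close> to the preimage of \<open>U\<close> and composing
  with \<tau> gives a chart of the surface itself, compatible with the whole atlas.\<close>

locale refined_chart =
  fixes X :: "'a topology" and A :: "'a chart set" and c :: "'a chart"
    and U V :: "(real^2) set" and \<tau> \<sigma> :: "real^2 \<Rightarrow> real^2"
  assumes atlas: "smooth_atlas X A" and c: "c \<in> A"
    and U: "open U" "U \<subseteq> chart_image c" and V: "open V" and hom: "homeomorphism U V \<tau> \<sigma>"
    and smooth: "smooth_on U \<tau>" "smooth_on V \<sigma>"
begin

definition N :: "'a set" where "N = {r \<in> fst c. snd c r \<in> U}"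
definition \<psi> :: "'a \<Rightarrow> real^2" where "\<psi> r = \<tau> (snd c r)"

lemma chart:
  assumes "d \<in> A"
  shows "openin X (fst d)" "open (chart_image d)" "homeomorphic_map (subtopology X (fst d)) (top_of_set (chart_image d)) (snd d)"
    "inj_on (snd d) (fst d)"
proof -
  show *: "openin X (fst d)" "open (chart_image d)" "homeomorphic_map (subtopology X (fst d)) (top_of_set (chart_image d)) (snd d)"
    using atlas assms unfolding smooth_atlas_def by blast+
  show "inj_on (snd d) (fst d)" by (rule homeomorphic_map_chart_inj[OF *(1,3)])
qed

lemma N_subset: "N \<subseteq> fst c"
  by (auto simp: N_def)

lemma image_N: "snd c ` N = U"
  using U(2) by (auto simp: N_def chart_image_def)

lemma \<tau>_\<sigma>: "\<tau> ` U = V" "\<And>x. x \<in> U \<Longrightarrow> \<sigma> (\<tau> x) = x" "\<And>y. y \<in> V \<Longrightarrow> \<tau> (\<sigma> y) = y" "\<sigma> ` V = U"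
  using hom by (auto simp: homeomorphism_def)

lemma image_\<psi>: "\<psi> ` N = V"
proof -
  have "\<psi> ` N = \<tau> ` (snd c ` N)" by (simp add: \<psi>_def[abs_def] image_image)
  then show ?thesis unfolding image_N \<tau>_\<sigma>(1) .
qed

lemma openin_N: "openin X N"
proof -
  have "openin (top_of_set (chart_image c)) U" using U open_subset by blast
  then have "openin (subtopology X (fst c)) {r \<in> topspace (subtopology X (fst c)). snd c r \<in> U}"
    using homeomorphic_imp_continuous_map[OF chart(3)[OF c]] openin_continuous_map_preimage by blast
  moreover have "{r \<in> topspace (subtopology X (fst c)). snd c r \<in> U} = N"
    using openin_subset[OF chart(1)[OF c]] by (auto simp: N_def)
  ultimately show ?thesis using openin_trans_full[OF _ chart(1)[OF c]] by simp
qed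

lemma homeomorphic_\<psi>: "homeomorphic_map (subtopology X N) (top_of_set V) \<psi>"
proof -
  have "homeomorphic_map (subtopology (subtopology X (fst c)) N) (subtopology (top_of_set (chart_image c)) U) (snd c)"
  proof (rule homeomorphic_map_subtopologies[OF chart(3)[OF c]])
    show "snd c ` (topspace (subtopology X (fst c)) \<inter> N) = topspace (top_of_set (chart_image c)) \<inter> U"
      using openin_subset[OF openin_N] N_subset image_N U(2) by (simp add: Int_absorb1 Int_absorb2)
  qed
  moreover have "subtopology (subtopology X (fst c)) N = subtopology X N"
    using N_subset by (simp add: subtopology_subtopology inf_absorb2)
  moreover have "subtopology (top_of_set (chart_image c)) U = top_of_set U"
    using U(2) by (simp add: subtopology_subtopology inf_absorb2)
  ultimately have "homeomorphic_map (subtopology X N) (top_of_set U) (snd c)" by simp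
  moreover have "homeomorphic_map (top_of_set U) (top_of_set V) \<tau>"
    unfolding homeomorphic_map_maps homeomorphic_maps_def
    by (rule exI[of _ \<sigma>]) (use hom in \<open>auto simp: homeomorphism_def\<close>)
  ultimately have "homeomorphic_map (subtopology X N) (top_of_set V) (\<tau> \<circ> snd c)"
    by (rule homeomorphic_map_compose)
  then show ?thesis by (simp add: \<psi>_def[abs_def] comp_def)
qed

lemma inj_\<psi>: "inj_on \<psi> N"
  by (rule homeomorphic_map_chart_inj[OF openin_N homeomorphic_\<psi>])

lemma \<psi>_values: "r \<in> N \<Longrightarrow> \<psi> r \<in> V" "r \<in> N \<Longrightarrow> \<sigma> (\<psi> r) = snd c r" "r \<in> N \<Longrightarrow> chart_inv (N, \<psi>) (\<psi> r) = r"
  "r \<in> N \<Longrightarrow> snd c r \<in> U"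
  using image_\<psi> \<tau>_\<sigma>(2) chart_inv_apply[of "(N, \<psi>)"] inj_\<psi> by (auto simp: N_def \<psi>_def)

lemma open_\<psi>_image: "openin X W \<Longrightarrow> open (\<psi> ` (N \<inter> W))"
  using open_chart_image[OF openin_N _ _, of \<psi>] homeomorphic_\<psi> V by (simp add: image_\<psi>)

lemma open_image: "d \<in> A \<Longrightarrow> openin X W \<Longrightarrow> open (snd d ` (fst d \<inter> W))"
  using open_chart_image[OF chart(1), of d "snd d"] chart[of d] by (simp add: chart_image_def)

lemma transition_smooth:
  assumes "d \<in> A" "d' \<in> A"
  shows "smooth_on (snd d ` (fst d \<inter> fst d')) (snd d' \<circ> chart_inv d)"
  using atlas assms unfolding smooth_atlas_def by blast

lemma transition_from:
  assumes d: "d \<in> A" and y: "y \<in> \<psi> ` (N \<inter> fst d)"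
  shows "\<sigma> y \<in> snd c ` (fst c \<inter> fst d)" "y \<in> V" "(snd d \<circ> chart_inv (N, \<psi>)) y = (snd d \<circ> chart_inv c) (\<sigma> y)"
proof -
  obtain r where r: "r \<in> N" "r \<in> fst d" "y = \<psi> r" using y by blast
  have "r \<in> fst c" using r(1) N_subset by blast
  then show "\<sigma> y \<in> snd c ` (fst c \<inter> fst d)" "y \<in> V" "(snd d \<circ> chart_inv (N, \<psi>)) y = (snd d \<circ> chart_inv c) (\<sigma> y)"
    using r chart_inv_apply[OF chart(4)[OF c]] by (auto simp: \<psi>_values)
qed

lemma smooth_transition_from:
  assumes d: "d \<in> A"
  shows "smooth_on (\<psi> ` (N \<inter> fst d)) (snd d \<circ> chart_inv (N, \<psi>))"
proof -
  have o: "open (\<psi> ` (N \<inter> fst d))" by (rule open_\<psi>_image[OF chart(1)[OF d]])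
  have "smooth_on (\<psi> ` (N \<inter> fst d)) (\<lambda>y. (snd d \<circ> chart_inv c) (\<sigma> y))"
    by (rule smooth_on_compose[OF o open_image[OF c chart(1)[OF d]]
          smooth_on_subset[OF smooth(2)] transition_smooth[OF c d]])
      (use transition_from[OF d] in blast)+
  then show ?thesis
    by (rule smooth_on_cong[OF o, rotated]) (rule transition_from(3)[OF d, symmetric])
qed

lemma smooth_transition_to:
  assumes d: "d \<in> A"
  shows "smooth_on (snd d ` (fst d \<inter> N)) (\<psi> \<circ> chart_inv d)"
proof -
  have o: "open (snd d ` (fst d \<inter> N))" by (rule open_image[OF d openin_N])
  have inv: "chart_inv d (snd d r) = r" if "r \<in> fst d" for r
    by (rule chart_inv_apply[OF chart(4)[OF d] that])
  have "smooth_on (snd d ` (fst d \<inter> N)) (\<lambda>y. \<tau> ((snd c \<circ> chart_inv d) y))"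
    by (rule smooth_on_compose[OF o U(1) smooth_on_subset[OF transition_smooth[OF d c]] smooth(1)])
      (use N_subset in \<open>auto simp: inv \<psi>_values\<close>)
  then show ?thesis by (simp add: comp_def \<psi>_def)
qed

lemma smooth_transition_self: "smooth_on (\<psi> ` (N \<inter> N)) (\<psi> \<circ> chart_inv (N, \<psi>))"
proof -
  have o: "open (\<psi> ` (N \<inter> N))" by (rule open_\<psi>_image[OF openin_N])
  show ?thesis
    by (rule smooth_on_cong[OF o _ smooth_on_ident[OF o]]) (auto simp: \<psi>_values)
qed

theorem smooth_atlas_insert: "smooth_atlas X (insert (N, \<psi>) A)"
  unfolding smooth_atlas_def
proof (intro conjI ballI)
  show "(\<Union>d\<in>insert (N, \<psi>) A. fst d) = topspace X"
    using atlas openin_subset[OF openin_N] by (auto simp: smooth_atlas_def)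
  fix d assume d: "d \<in> insert (N, \<psi>) A"
  show "openin X (fst d)" using d chart(1)[of d] openin_N by (cases "d = (N, \<psi>)") auto
  show "open (chart_image d)"
    using d chart(2)[of d] V by (cases "d = (N, \<psi>)") (auto simp: chart_image_def image_\<psi>)
  show "homeomorphic_map (subtopology X (fst d)) (top_of_set (chart_image d)) (snd d)"
    using d chart(3)[of d] homeomorphic_\<psi>
    by (cases "d = (N, \<psi>)") (auto simp: chart_image_def image_\<psi>)
  fix d' assume d': "d' \<in> insert (N, \<psi>) A"
  show "smooth_on (snd d ` (fst d \<inter> fst d')) (snd d' \<circ> chart_inv d)"
    using d d' transition_smooth[of d d'] smooth_transition_from[of d'] smooth_transition_to[of d]
      smooth_transition_self
    by (cases "d = (N, \<psi>)"; cases "d' = (N, \<psi>)") auto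
qed

text \<open>The transition from the new chart to \<open>d\<close> is \<sigma> followed by the
  transition from \<open>c\<close> to \<open>d\<close>. The derivative of \<sigma> inverts that of
  \<tau>, so the isometry property of \<tau> and the compatibility of \<open>c\<close> with
  \<open>d\<close> combine.\<close>

theorem same_metric_refined:
  assumes g: "\<forall>d\<in>A. same_metric c G d (g d)"
    and iso: "\<And>x h k. x \<in> U \<Longrightarrow> ip (M (\<tau> x)) (frechet_derivative \<tau> (at x) h) (frechet_derivative \<tau> (at x) k)
      = ip (G x) h k"
    and d: "d \<in> A"
  shows "same_metric (N, \<psi>) M d (g d)"
  unfolding same_metric_def Let_def fst_conv snd_conv
proof (intro ballI allI)
  let ?T = "snd d \<circ> chart_inv c" and ?S = "snd d \<circ> chart_inv (N, \<psi>)"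
  fix y h k assume y: "y \<in> \<psi> ` (N \<inter> fst d)"
  have o: "open (\<psi> ` (N \<inter> fst d))" by (rule open_\<psi>_image[OF chart(1)[OF d]])
  note yV = transition_from(2)[OF d y]
  have \<sigma>U: "\<sigma> y \<in> U" using yV \<tau>_\<sigma>(4) by blast
  have d\<sigma>: "(\<sigma> has_derivative frechet_derivative \<sigma> (at y)) (at y)"
    by (rule smooth_on_has_derivative[OF smooth(2) yV])
  have dT: "(?T has_derivative frechet_derivative ?T (at (\<sigma> y))) (at (\<sigma> y))"
    by (rule smooth_on_has_derivative[OF transition_smooth[OF c d] transition_from(1)[OF d y]])
  have "((\<lambda>y. ?T (\<sigma> y)) has_derivative (\<lambda>h. frechet_derivative ?T (at (\<sigma> y)) (frechet_derivative \<sigma> (at y) h))) (at y)"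
    by (rule has_derivative_compose[OF d\<sigma> dT])
  then have "(?S has_derivative (\<lambda>h. frechet_derivative ?T (at (\<sigma> y)) (frechet_derivative \<sigma> (at y) h))) (at y)"
    by (rule has_derivative_transform_within_open[OF _ o y]) (rule transition_from(3)[OF d, symmetric])
  note dS = frechet_derivative_eqI[OF this]
  have "((\<lambda>y. \<tau> (\<sigma> y)) has_derivative (\<lambda>h. frechet_derivative \<tau> (at (\<sigma> y)) (frechet_derivative \<sigma> (at y) h))) (at y)"
    by (rule has_derivative_compose[OF d\<sigma> smooth_on_has_derivative[OF smooth(1) \<sigma>U]])
  moreover have "((\<lambda>y. \<tau> (\<sigma> y)) has_derivative (\<lambda>h. h)) (at y)"
    by (rule has_derivative_transform_within_open[OF has_derivative_ident V yV]) (simp add: \<tau>_\<sigma>(3))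
  ultimately have "(\<lambda>h. frechet_derivative \<tau> (at (\<sigma> y)) (frechet_derivative \<sigma> (at y) h)) = (\<lambda>h. h)"
    by (rule has_derivative_unique)
  then have id: "frechet_derivative \<tau> (at (\<sigma> y)) (frechet_derivative \<sigma> (at y) h) = h" for h by meson
  have "ip (M y) h k = ip (G (\<sigma> y)) (frechet_derivative \<sigma> (at y) h) (frechet_derivative \<sigma> (at y) k)"
    using iso[OF \<sigma>U, of "frechet_derivative \<sigma> (at y) h" "frechet_derivative \<sigma> (at y) k"]
    by (simp add: id \<tau>_\<sigma>(3)[OF yV])
  also have "\<dots> = ip (g d (?T (\<sigma> y))) (frechet_derivative ?T (at (\<sigma> y)) (frechet_derivative \<sigma> (at y) h))
      (frechet_derivative ?T (at (\<sigma> y)) (frechet_derivative \<sigma> (at y) k))"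
    using g d transition_from(1)[OF d y] unfolding same_metric_def Let_def by blast
  finally show "ip (M y) h k = ip (g d (?S y)) (frechet_derivative ?S (at y) h) (frechet_derivative ?S (at y) k)"
    unfolding dS transition_from(3)[OF d y] .
qed

end

section \<open>From a chart to the surface\<close>

theorem theorem12:
  fixes X :: "'a topology" and A :: "'a chart set"
    and g :: "'a chart \<Rightarrow> real^2 \<Rightarrow> real^2^2" and K :: "'a \<Rightarrow> real"
  assumes "lorentzian_surface X A g"
    and "\<forall>c\<in>A. is_curvature (chart_image c) (g c) (K \<circ> chart_inv c)"
    and "\<forall>p\<in>topspace X. K p > 0"
    and "\<forall>c\<in>A. darboux_integrable (chart_image c) (g c) (K \<circ> chart_inv c)"
    and "\<forall>c\<in>A. timelike_V (chart_image c) (g c) (K \<circ> chart_inv c)"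
  shows "\<forall>p\<in>topspace X. \<exists>N \<psi>. \<exists>C::real. p \<in> N \<and> C > 0 \<and>
           smooth_atlas X (insert (N, \<psi>) A) \<and>
           (\<forall>c\<in>A. same_metric (N, \<psi>) (\<lambda>x. C *\<^sub>R model_metric x) c (g c)) \<and>
           (\<forall>r\<in>N. C * K r = 1 / cos (\<psi> r $ 1) ^ 4)"
proof
  fix p assume p: "p \<in> topspace X"
  have atlas: "smooth_atlas X A" and lor: "\<And>c. c \<in> A \<Longrightarrow> lorentzian_metric (chart_image c) (g c)"
    and same: "\<And>c d. c \<in> A \<Longrightarrow> d \<in> A \<Longrightarrow> same_metric c (g c) d (g d)"
    using assms(1) unfolding lorentzian_surface_def by blast+
  then obtain c where c: "c \<in> A" "p \<in> fst c" using p unfolding smooth_atlas_def by blast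
  have chart: "openin X (fst c)" "open (chart_image c)"
    "homeomorphic_map (subtopology X (fst c)) (top_of_set (chart_image c)) (snd c)"
    using atlas c(1) unfolding smooth_atlas_def by blast+
  note inv = chart_inv_apply[OF homeomorphic_map_chart_inj[OF chart(1,3)]]
  define KK where "KK = K \<circ> chart_inv c"
  define f where "f = (\<lambda>x. ln (KK x) / 4)"
  have KK: "KK (snd c r) = K r" if "r \<in> fst c" for r using inv[OF that] by (simp add: KK_def)
  have pos: "KK x > 0" if "x \<in> chart_image c" for x
  proof -
    obtain r where r: "r \<in> fst c" "x = snd c r" using \<open>x \<in> chart_image c\<close> by (auto simp: chart_image_def)
    then show ?thesis using KK[OF r(1)] assms(3) openin_subset[OF chart(1)] by auto
  qed
  have curv: "is_curvature (chart_image c) (g c) KK" using assms(2) c(1) by (simp add: KK_def)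
  have sec: "\<exists>U v1 v2. x \<in> U \<and> U \<subseteq> chart_image c \<and> moving_frame (chart_image c) (g c) U (\<lambda>y. y) v1 v2
      \<and> smooth_on U KK" if x: "x \<in> chart_image c" for x
  proof -
    obtain U v1 v2 where U: "x \<in> U" "U \<subseteq> chart_image c"
      "moving_frame (chart_image c) (g c) U (\<lambda>y. y) v1 v2" "smooth_on U KK"
      by (rule curvature_section[OF chart(2) lor[OF c(1)] curv x])
    show ?thesis
      by (rule exI[of _ U], rule exI[of _ v1], rule exI[of _ v2]) (intro conjI U)
  qed
  have smooth_K: "smooth_on (chart_image c) KK"
  proof (rule smooth_on_local)
    fix x assume "x \<in> chart_image c"
    from sec[OF this] obtain U v1 v2 where "x \<in> U"
      and mf: "moving_frame (chart_image c) (g c) U (\<lambda>y. y) v1 v2" and "smooth_on U KK"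
      by (elim exE conjE)
    with moving_frame.open_U[OF mf] show "\<exists>S. open S \<and> x \<in> S \<and> smooth_on S KK" by blast
  qed
  have x0: "snd c p \<in> chart_image c" using c(2) by (simp add: chart_image_def)
  have "darboux_integrable (chart_image c) (g c) KK" using assms(4) c(1) by (simp add: KK_def)
  \<comment> \<open>Positive curvature at the image of \<open>p\<close> excludes the hyperbolic
    alternative, leaving the complex singular systems.\<close>
  then have int: "locally_integrable \<i> (chart_image c) (g c) KK"
    unfolding darboux_integrable_def using x0 pos[OF x0] by force
  have tl: "timelike_V (chart_image c) (g c) KK" using assms(5) c(1) by (simp add: KK_def)
  note eq = hessian_equation[OF chart(2) lor[OF c(1)] smooth_K pos int tl f_def]
  obtain W v1 v2 where W: "snd c p \<in> W" "W \<subseteq> chart_image c"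
    and mf: "moving_frame (chart_image c) (g c) W (\<lambda>y. y) v1 v2"
    using sec[OF x0] by (elim exE conjE)
  interpret MF: moving_frame "chart_image c" "g c" W "\<lambda>y. y" v1 v2 by (rule mf)
  have K_f: "exp (4 * f x) = KK x" if "x \<in> chart_image c" for x using pos[OF that] by (simp add: f_def)
  \<comment> \<open>The equation is imported in a smooth section \<open>v1\<close>,
    \<open>v2\<close> of the frame bundle, with exp (4 f) in the role of the curvature.\<close>
  interpret HM: hessian_metric "chart_image c" "g c" W v1 v2 f
  proof unfold_locales
    show "smooth_on (chart_image c) f"
      unfolding f_def by (intro smooth_on_divide smooth_on_ln smooth_on_const chart(2) smooth_K pos) auto
    show "hess (g c) f y (v1 y) (v2 y) h k = 3 * frechet_derivative f (at y) h * frechet_derivative f (at y) k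
        - exp (4 * f y) * ip (g c y) h k" if "y \<in> W" for y h k
      using eq(2)[OF _ MF.x_in_D[OF that] MF.frame[OF that]] K_f[OF MF.x_in_D[OF that]] by simp
    show "(frechet_derivative f (at y) (v1 y))\<^sup>2 < (frechet_derivative f (at y) (v2 y))\<^sup>2" if "y \<in> W" for y
      using eq(1)[OF _ MF.x_in_D[OF that] MF.frame[OF that]] by simp
  qed
  obtain U V \<tau> \<sigma> C where U: "open U" "snd c p \<in> U" "U \<subseteq> W" and V: "open V" "homeomorphism U V \<tau> \<sigma>"
    and sm: "smooth_on U \<tau>" "smooth_on V \<sigma>" and C: "C > 0"
    and iso: "\<And>y h k. y \<in> U \<Longrightarrow> ip (C *\<^sub>R model_metric (\<tau> y)) (frechet_derivative \<tau> (at y) h)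
        (frechet_derivative \<tau> (at y) k) = ip (g c y) h k"
    and curv_eq: "\<And>y. y \<in> U \<Longrightarrow> C * exp (4 * f y) = 1 / cos (\<tau> y $ 1) ^ 4"
    using HM.normal_coordinates[OF W(1)] by blast
  interpret RC: refined_chart X A c U V \<tau> \<sigma>
    using atlas c(1) U V sm W(2) by unfold_locales auto
  show "\<exists>N \<psi>. \<exists>C::real. p \<in> N \<and> C > 0 \<and> smooth_atlas X (insert (N, \<psi>) A) \<and>
      (\<forall>c\<in>A. same_metric (N, \<psi>) (\<lambda>x. C *\<^sub>R model_metric x) c (g c)) \<and>
      (\<forall>r\<in>N. C * K r = 1 / cos (\<psi> r $ 1) ^ 4)"
  proof (intro exI conjI ballI)
    show "p \<in> RC.N" using c(2) U(2) by (simp add: RC.N_def)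
    show "C > 0" by (rule C)
    show "smooth_atlas X (insert (RC.N, RC.\<psi>) A)" by (rule RC.smooth_atlas_insert)
    show "same_metric (RC.N, RC.\<psi>) (\<lambda>x. C *\<^sub>R model_metric x) d (g d)" if "d \<in> A" for d
      by (rule RC.same_metric_refined[OF _ iso that]) (use same c(1) in auto)
    show "C * K r = 1 / cos (RC.\<psi> r $ 1) ^ 4" if "r \<in> RC.N" for r
    proof -
      have r: "r \<in> fst c" "snd c r \<in> U" using that RC.N_subset by (auto simp: RC.\<psi>_values)
      then have "snd c r \<in> chart_image c" by (simp add: chart_image_def)
      then show ?thesis using curv_eq[OF r(2)] K_f KK[OF r(1)] by (simp add: RC.\<psi>_def)
    qed
  qed
qed

end
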